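(* Let $n \ge 1$ be an integer and $s \in (0,1)$. Let $E \subset \mathbb{R}^{n+1}$ be a measurable set contained in a half-space and that satisfies $\mathrm{H}_{s,E} = 0$ in the viscosity sense. Assume that either of the following assumptions holds true: (a) the complement of $E$ enjoys uniform thick density estimates around every point of its boundary and at all scales, i.e., there exists a constant $c_\star>0$ such that $$|B_\rho(q)\setminus E| \ge c_\star\, \rho^{n+1} \quad \text{for all } q \in \partial E \text{ and } \rho>0,$$ or (b) $E$ has boundary of class $C^1$ outside of a compact set. Then, $E$ is a half-space.
   Context: Inclusions and equalities between sets are understood up to sets of Lebesgue measure zero ($F \subset E$ means $|F \setminus E| = 0$, and $E=F$ means $|E\Delta F|=0$). Every measurable set $E$ is represented, within its class modulo null sets, so that it contains its measure theoretic interior $\{x : |E\cap B_r(x)| = |B_r| \text{ for some } r>0\}$, is disjoint from its measure theoretic exterior $\{x : |E \cap B_r(x)| = 0 \text{ for some } r>0\}$, and its topological boundary is $\partial E = \{x : 0<|E\cap B_r(x)|<|B_r| \text{ for all } r>0\}$. For a measurable set $F \subset \mathbb{R}^{n+1}$ and $x \in \partial F$, the fractional $s$-mean curvature is $$\mathrm{H}_{s,F}(x) := \lim_{\varepsilon \to 0^+} \int_{\mathbb{R}^{n+1}\setminus B_\varepsilon(x)} \frac{\chi_{\mathbb{R}^{n+1}\setminus F}(y) - \chi_F(y)}{|x-y|^{n+1+s}}\, dy.$$ Viscosity sense: let $E \subset \mathbb{R}^{n+1}$ be measurable and $x \in \partial E$. - $\mathrm{H}_{s,E} \ge 0$ at $x$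 in the viscosity sense if $|B_r(x)\setminus E|>0$ for all $r>0$ and $\mathrm{H}_{s,F}(x) \ge 0$ for every set $F \subset E$ such that $x \in \partial F$ and $\partial F$ is of class $C^2$ in a neighbourhood of $x$. - $\mathrm{H}_{s,E} \le 0$ at $x$ in the viscosity sense if $|B_r(x)\cap E|>0$ for all $r>0$ and $\mathrm{H}_{s,F}(x) \le 0$ for every set $F \supset E$ such that $x \in \partial F$ and $\partial F$ is of class $C^2$ in a neighbourhood of $x$. - $\mathrm{H}_{s,E} = 0$ at $x$ in the viscosity sense if both $\mathrm{H}_{s,E} \ge 0$ at $x$ in the viscosity sense and $\mathrm{H}_{s,E} \le 0$ at $x$ in the viscosity sense. If no point is specified, the condition is required at every $x\in\partial E$. A half-space is a set of the form $\{x\in\mathbb{R}^{n+1} : x\cdot\omega<a\}$ with $|\omega|=1$, $a\in\mathbb{R}$.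
   Formalization: The formal theorem additionally assumes that E is not a null set; the empty set is contained in a half-space and satisfies the curvature condition and (a) vacuously, but is not a half-space. *)

theory Defs
  imports "HOL-Analysis.Analysis"
begin

text \<open>Set relations modulo Lebesgue null sets.\<close>

definition ae_subset :: "'a::euclidean_space set \<Rightarrow> 'a set \<Rightarrow> bool" where
  "ae_subset F E \<longleftrightarrow> F - E \<in> null_sets lebesgue"

definition ae_equal :: "'a::euclidean_space set \<Rightarrow> 'a set \<Rightarrow> bool" where
  "ae_equal E F \<longleftrightarrow> (E - F) \<union> (F - E) \<in> null_sets lebesgue"

definition mt_interior :: "'a::euclidean_space set \<Rightarrow> 'a set" where
  "mt_interior E =
     {x. \<exists>r>0. measure lebesgue (E \<inter> ball x r) = measure lebesgue (ball x r)}"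

definition mt_exterior :: "'a::euclidean_space set \<Rightarrow> 'a set" where
  "mt_exterior E = {x. \<exists>r>0. measure lebesgue (E \<inter> ball x r) = 0}"

definition mt_boundary :: "'a::euclidean_space set \<Rightarrow> 'a set" where
  "mt_boundary E =
     {x. \<forall>r>0. 0 < measure lebesgue (E \<inter> ball x r) \<and>
               measure lebesgue (E \<inter> ball x r) < measure lebesgue (ball x r)}"

text \<open>A measurable set that is a good representative of its class modulo null sets.
  Every Lebesgue measurable set has such a representative, for instance
  \<open>(E \<union> mt_interior E) - mt_exterior E\<close>.\<close>

definition normalized :: "'a::euclidean_space set \<Rightarrow> bool" where
  "normalized E \<longleftrightarrow>
     E \<in> sets lebesgue \<and> mt_interior E \<subseteq> E \<and> E \<inter> mt_exterior E = {} \<and>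
     frontier E = mt_boundary E"

text \<open>The limit exists whenever \<open>F\<close> is normalized and \<open>frontier F\<close> is of class \<open>C\<^sup>2\<close> near
  \<open>x\<close>, the only case in which the viscosity conditions below evaluate it.\<close>

definition frac_mean_curv :: "real \<Rightarrow> 'a::euclidean_space set \<Rightarrow> 'a \<Rightarrow> real" where
  "frac_mean_curv s F x =
     Lim (at_right 0) (\<lambda>\<epsilon>. LINT y : - ball x \<epsilon> | lebesgue.
       (indicat_real (- F) y - indicat_real F y) / norm (x - y) powr (real DIM('a) + s))"

text \<open>\<open>C\<^sup>k\<close> regularity on an open set \<open>S\<close>: differentiable, with all partial derivatives
  of class \<open>C\<^bsup>k-1\<^esup>\<close>.\<close>

primrec Ck_on :: "nat \<Rightarrow> ('a::euclidean_space \<Rightarrow> real) \<Rightarrow> 'a set \<Rightarrow> bool" where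
  "Ck_on 0 g S \<longleftrightarrow> continuous_on S g"
| "Ck_on (Suc k) g S \<longleftrightarrow>
     (\<exists>G :: 'a \<Rightarrow> 'a. (\<forall>x\<in>S. GDERIV g x :> G x) \<and> (\<forall>b\<in>Basis. Ck_on k (\<lambda>x. G x \<bullet> b) S))"

text \<open>\<open>M\<close> is of class \<open>C\<^sup>k\<close> in a neighbourhood of \<open>x\<close>: there it is the graph, in some
  direction \<open>\<omega>\<close>, of a \<open>C\<^sup>k\<close> function of the orthogonal variable \<open>y - (y \<bullet> \<omega>) \<omega>\<close>.
  Only the values of \<open>g\<close> on the hyperplane orthogonal to \<open>\<omega>\<close> matter; a \<open>C\<^sup>k\<close> function
  near a point of that hyperplane becomes globally \<open>C\<^sup>k\<close> after a cut-off and composition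
  with the projection, so taking \<open>g\<close> on the whole space is no restriction.\<close>

definition Ck_hypersurface_near :: "nat \<Rightarrow> 'a::euclidean_space set \<Rightarrow> 'a \<Rightarrow> bool" where
  "Ck_hypersurface_near k M x \<longleftrightarrow>
     (\<exists>U \<omega> g. open U \<and> x \<in> U \<and> norm \<omega> = 1 \<and> Ck_on k g UNIV \<and>
        M \<inter> U = {y \<in> U. y \<bullet> \<omega> = g (y - (y \<bullet> \<omega>) *\<^sub>R \<omega>)})"

definition visc_nonneg_at :: "real \<Rightarrow> 'a::euclidean_space set \<Rightarrow> 'a \<Rightarrow> bool" where
  "visc_nonneg_at s E x \<longleftrightarrow>
     (\<forall>r>0. measure lebesgue (ball x r - E) > 0) \<and>
     (\<forall>F. normalized F \<and> ae_subset F E \<and> x \<in> frontier F \<and>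
          Ck_hypersurface_near 2 (frontier F) x \<longrightarrow> frac_mean_curv s F x \<ge> 0)"

definition visc_nonpos_at :: "real \<Rightarrow> 'a::euclidean_space set \<Rightarrow> 'a \<Rightarrow> bool" where
  "visc_nonpos_at s E x \<longleftrightarrow>
     (\<forall>r>0. measure lebesgue (ball x r \<inter> E) > 0) \<and>
     (\<forall>F. normalized F \<and> ae_subset E F \<and> x \<in> frontier F \<and>
          Ck_hypersurface_near 2 (frontier F) x \<longrightarrow> frac_mean_curv s F x \<le> 0)"

definition visc_zero :: "real \<Rightarrow> 'a::euclidean_space set \<Rightarrow> bool" where
  "visc_zero s E \<longleftrightarrow> (\<forall>x\<in>frontier E. visc_nonneg_at s E x \<and> visc_nonpos_at s E x)"

definition halfspace :: "'a::euclidean_space set \<Rightarrow> bool" where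
  "halfspace H \<longleftrightarrow> (\<exists>\<omega> a. norm \<omega> = 1 \<and> H = {x. x \<bullet> \<omega> < a})"

definition thick_complement :: "'a::euclidean_space set \<Rightarrow> bool" where
  "thick_complement E \<longleftrightarrow>
     (\<exists>c>0. \<forall>q\<in>frontier E. \<forall>\<rho>>0. measure lebesgue (ball q \<rho> - E) \<ge> c * \<rho> ^ DIM('a))"

definition C1_boundary_outside_compact :: "'a::euclidean_space set \<Rightarrow> bool" where
  "C1_boundary_outside_compact E \<longleftrightarrow>
     (\<exists>K. compact K \<and> (\<forall>x \<in> frontier E - K. Ck_hypersurface_near 1 (frontier E) x))"

end

theory Submission imports Defs begin

text \<open>Let \<open>H = {y. y \<bullet> e < b}\<close> be the smallest half-space containing \<open>E\<close> in the given direction, and call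
  \<open>b - y \<bullet> e\<close> the depth of \<open>y\<close>. If a ball of radius \<open>r\<close> inside \<open>E\<close> (or outside) touches the frontier
  at \<open>z\<close>, testing the curvature with a paraboloid inside the ball gives an integral inequality for
  \<open>E\<close> on and outside \<open>ball z \<rho>\<close>, with an error of order \<open>\<rho> powr (1 - s) / r\<close>.

  Frontier points of depth at most \<open>\<epsilon>\<close> exist for every \<open>\<epsilon> > 0\<close>. A ball of radius of order
  \<open>\<rho>\<^sup>2 / \<epsilon>\<close> outside \<open>E\<close> touching near such a point shows that \<open>H - E\<close> has measure at most
  \<open>C * \<epsilon> * \<rho> ^ (N - 1)\<close> in balls of radius \<open>\<rho>\<close>, where \<open>N\<close> is the dimension: \<open>E\<close> is flat at
  infinity. On the other hand, a ball inside \<open>E\<close> cannot touch the frontier at a point of depth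
  \<open>D > 0\<close> around which \<open>H - E\<close> is so small, because the slab of width \<open>D\<close> between \<open>z\<close> and the boundary
  of \<open>H\<close> then lies almost entirely in \<open>E\<close>. Hypothesis (a) or (b) and a covering argument provide
  a starting point for sliding such a ball upwards to any frontier point of positive depth.
  Hence the frontier has depth zero and \<open>E = H\<close>.\<close>

text \<open>The supremum of \<open>y \<bullet> e\<close> over the frontier need not be attained, and
  \<open>E\<close> has no regularity, so the curvature of \<open>E\<close> cannot be evaluated at an
  extremal point; every comparison uses touching balls and a one-sided inequality. The radius
  \<open>\<rho>\<^sup>2 / \<epsilon>\<close> makes the curvature error of the touching ball and the
  mass of a slab of width \<epsilon> equal in order, both
  \<open>\<epsilon> / \<rho> * \<rho> powr - s\<close>. Flatness at infinity is known only at scales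
  above some \<open>R0\<close>, whereas a sliding ball may touch while it is still tiny. Its
  starting point must therefore see little of the complement at all scales, and it must lie in
  \<open>E\<close> off the frontier. Only here do (a) and (b) enter: under (a) low density excludes
  frontier points; under (b) the frontier outside the compact set is negligible and can be avoided,
  while the compact set is left behind by starting far below it. For a late contact at depth
  \<open>D\<close> with radius \<open>r\<close>, the scale is of order \<open>sqrt (D * r)\<close>:
  small enough for the curvature error to be absorbed, and large enough for the contact point to be
  comparable with the given frontier point.\<close>

declare emeasure_completion [simp del] space_completion [simp del]

section \<open>The weighted measure\<close>

lemma sets_lebesgue_ball [simp]: "ball z r \<in> sets lebesgue" for z :: "'a::euclidean_space"
  by (simp add: fmeasurableD)

declare Compl_in_sets_lebesgue [simp]

text \<open>Turning the kernel into a measure replaces integrals of signed indicators by masses of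
  sets, to which monotonicity and subadditivity apply. At \<open>y = z\<close> the density is 0,
  because \<open>0 powr c = 0\<close>; lower bounds on the weight therefore have to exclude the
  centre.\<close>

definition frac_measure :: "real \<Rightarrow> 'a::euclidean_space \<Rightarrow> 'a measure" where
  "frac_measure s z = density lebesgue (\<lambda>y. ennreal (norm (z - y) powr - (real DIM('a) + s)))"

lemma frac_kernel_measurable [measurable]:
  "(\<lambda>y. norm (z - y) powr c) \<in> borel_measurable lebesgue"
  for z :: "'a::euclidean_space"
  by (rule measurable_completion) measurable

lemma sets_frac_measure [simp]: "sets (frac_measure s z) = sets lebesgue"
  by (simp add: frac_measure_def)

lemma space_frac_measure [simp]: "space (frac_measure s z) = UNIV"
  by (simp add: frac_measure_def space_completion)

lemma emeasure_frac_measure: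
  fixes z :: "'a::euclidean_space"
  assumes "S \<in> sets lebesgue"
  shows "emeasure (frac_measure s z) S =
    (\<integral>\<^sup>+y. ennreal (norm (z - y) powr - (real DIM('a) + s)) * indicator S y \<partial>lebesgue)"
  unfolding frac_measure_def using assms by (subst emeasure_density) auto

lemma null_sets_frac_measure:
  "S \<in> null_sets lebesgue \<Longrightarrow> S \<in> null_sets (frac_measure s z)"
  using absolutely_continuousI_density[of "\<lambda>y. ennreal (norm (z - y) powr - (real DIM('a) + s))" lebesgue]
  unfolding frac_measure_def absolutely_continuous_def by auto

lemma emeasure_frac_measure_le:
  fixes z :: "'a::euclidean_space"
  assumes "S \<in> sets lebesgue" "0 < t" "0 < s" "\<And>y. y \<in> S \<Longrightarrow> t \<le> norm (z - y)"
  shows "emeasure (frac_measure s z) S \<le> ennreal (t powr - (real DIM('a) + s)) * emeasure lebesgue S"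
proof -
  have "emeasure (frac_measure s z) S \<le>
      (\<integral>\<^sup>+y. ennreal (t powr - (real DIM('a) + s)) * indicator S y \<partial>lebesgue)"
    unfolding emeasure_frac_measure[OF assms(1)]
    by (intro nn_integral_mono) (use assms in \<open>auto simp: indicator_def intro!: ennreal_leI powr_mono2'\<close>)
  also have "\<dots> = ennreal (t powr - (real DIM('a) + s)) * emeasure lebesgue S"
    using assms by (subst nn_integral_cmult_indicator) auto
  finally show ?thesis .
qed

lemma emeasure_frac_measure_ge:
  fixes z :: "'a::euclidean_space"
  assumes "S \<in> sets lebesgue" "0 < s" "\<And>y. y \<in> S \<Longrightarrow> y \<noteq> z \<and> norm (z - y) \<le> t"
  shows "ennreal (t powr - (real DIM('a) + s)) * emeasure lebesgue S \<le> emeasure (frac_measure s z) S"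
proof -
  have "ennreal (t powr - (real DIM('a) + s)) * emeasure lebesgue S =
      (\<integral>\<^sup>+y. ennreal (t powr - (real DIM('a) + s)) * indicator S y \<partial>lebesgue)"
    using assms by (subst nn_integral_cmult_indicator) auto
  also have "\<dots> \<le> emeasure (frac_measure s z) S"
    unfolding emeasure_frac_measure[OF assms(1)]
    by (intro nn_integral_mono)
      (use assms in \<open>force simp: indicator_def intro!: ennreal_leI powr_mono2'\<close>)
  finally show ?thesis .
qed

lemma emeasure_le_geometric:
  assumes "S \<subseteq> (\<Union>k. T k)" "\<And>k. T k \<in> sets M" "0 \<le> q" "q < 1" "0 \<le> c"
    and "\<And>k. emeasure M (T k) \<le> ennreal (c * q ^ k)"
  shows "emeasure M S \<le> ennreal (c / (1 - q))"
proof -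
  have sm: "summable (\<lambda>k. c * q ^ k)"
    using assms by (intro summable_mult summable_geometric) auto
  have "emeasure M S \<le> emeasure M (\<Union>k. T k)"
    using assms by (intro emeasure_mono) auto
  also have "\<dots> \<le> (\<Sum>k. emeasure M (T k))"
    using assms by (intro emeasure_subadditive_countably) auto
  also have "\<dots> \<le> (\<Sum>k. ennreal (c * q ^ k))"
    using assms by (intro suminf_le) auto
  also have "\<dots> = ennreal (\<Sum>k. c * q ^ k)"
    using assms sm by (intro suminf_ennreal2) auto
  also have "(\<Sum>k. c * q ^ k) = c / (1 - q)"
    using assms suminf_mult[OF summable_geometric[of q], of c] suminf_geometric[of q] by simp
  finally show ?thesis .
qed

lemma fmeasurable_Int_ball [intro]:
  "S \<in> sets lebesgue \<Longrightarrow> S \<inter> ball z r \<in> fmeasurable lebesgue" for z :: "'a::euclidean_space"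
  by (rule fmeasurableI2[OF lmeasurable_ball]) (auto intro: sets.Int)

text \<open>Off \<open>ball z t\<close> the weight is at most its value at distance
  \<open>t\<close>, so an unweighted bound on all of \<open>S \<inter> ball z u\<close>
  suffices.\<close>

lemma frac_measure_annulus:
  fixes z :: "'a::euclidean_space"
  assumes S: "S \<in> sets lebesgue" and "0 < s" "0 < t" and "measure lebesgue (S \<inter> ball z u) \<le> B"
  shows "emeasure (frac_measure s z) (S \<inter> ball z u - ball z t) \<le> ennreal (t powr - (real DIM('a) + s) * B)"
proof -
  have "0 \<le> B" using assms(4) measure_nonneg order_trans by blast
  have "emeasure (frac_measure s z) (S \<inter> ball z u - ball z t)
      \<le> ennreal (t powr - (real DIM('a) + s)) * emeasure lebesgue (S \<inter> ball z u - ball z t)"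
    using assms by (intro emeasure_frac_measure_le) (auto simp: dist_norm intro!: sets.Diff sets.Int)
  also have "\<dots> \<le> ennreal (t powr - (real DIM('a) + s)) * emeasure lebesgue (S \<inter> ball z u)"
    using S by (intro mult_left_mono emeasure_mono sets.Int) auto
  also have "\<dots> \<le> ennreal (t powr - (real DIM('a) + s)) * ennreal B"
    using assms(4) fmeasurable_Int_ball[OF S, of z u]
    by (intro mult_left_mono) (auto simp: emeasure_eq_measure2 intro!: ennreal_leI)
  also have "\<dots> = ennreal (t powr - (real DIM('a) + s) * B)"
    using \<open>0 \<le> B\<close> by (simp add: ennreal_mult)
  finally show ?thesis .
qed

lemma fmeasurableI_bound:
  "S \<in> sets M \<Longrightarrow> emeasure M S \<le> ennreal c \<Longrightarrow> S \<in> fmeasurable M"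
  by (auto simp: fmeasurable_def intro: le_less_trans)

lemma measure_le_of_emeasure:
  "emeasure M S \<le> ennreal c \<Longrightarrow> 0 \<le> c \<Longrightarrow> measure M S \<le> c"
  by (simp add: measure_def enn2real_leI)

lemma two_power_powr: "((2::real) ^ k) powr a = (2 powr a) ^ k"
  by (induction k) (simp_all add: powr_mult)

text \<open>Dyadic annuli: the weight is integrable at infinity against a density of order
  \<open>r ^ N\<close>, and near the centre against one of order \<open>r ^ (N + 1)\<close>.\<close>

lemma frac_measure_far:
  fixes z :: "'a::euclidean_space"
  assumes S: "S \<in> sets lebesgue" and "0 < s" "0 < \<rho>" "0 \<le> A"
    and le: "\<And>r. \<rho> \<le> r \<Longrightarrow> measure lebesgue (S \<inter> ball z r) \<le> A * r ^ DIM('a)"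
  shows "S - ball z \<rho> \<in> fmeasurable (frac_measure s z)"
    and "measure (frac_measure s z) (S - ball z \<rho>)
      \<le> 2 ^ DIM('a) / (1 - 2 powr - s) * A * \<rho> powr - s"
proof -
  define T where "T k = S \<inter> ball z (\<rho> * 2 ^ Suc k) - ball z (\<rho> * 2 ^ k)" for k
  have q: "2 powr - s < (1::real)" using \<open>0 < s\<close> powr_less_mono[of "-s" 0 2] by simp
  have cov: "S - ball z \<rho> \<subseteq> (\<Union>k. T k)"
  proof
    fix y assume y: "y \<in> S - ball z \<rho>"
    define P where "P k \<longleftrightarrow> dist z y < \<rho> * 2 ^ k" for k
    obtain k0 where "dist z y / \<rho> < 2 ^ k0"
      using real_arch_pow[of 2] by auto
    then have k0: "P k0" using \<open>0 < \<rho>\<close> by (simp add: P_def field_simps)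
    have n0: "\<not> P 0" using y by (simp add: P_def)
    obtain k where "\<not> P k" "P (Suc k)"
      using k0 n0 by (induction k0) auto
    then have "y \<in> T k" using y by (auto simp: T_def P_def not_less)
    then show "y \<in> (\<Union>k. T k)" by blast
  qed
  have "emeasure (frac_measure s z) (T k) \<le> ennreal ((2 ^ DIM('a) * A * \<rho> powr - s) * (2 powr - s) ^ k)" for k
  proof -
    have "emeasure (frac_measure s z) (T k) \<le>
        ennreal ((\<rho> * 2 ^ k) powr - (real DIM('a) + s) * (A * (\<rho> * 2 ^ Suc k) ^ DIM('a)))"
      unfolding T_def
    proof (rule frac_measure_annulus[OF S])
      have "\<rho> * 1 \<le> \<rho> * 2 ^ Suc k" using \<open>0 < \<rho>\<close> by (intro mult_left_mono one_le_power) auto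
      then show "measure lebesgue (S \<inter> ball z (\<rho> * 2 ^ Suc k)) \<le> A * (\<rho> * 2 ^ Suc k) ^ DIM('a)"
        using le by simp
    qed (use assms in auto)
    also have "(\<rho> * 2 ^ k) powr - (real DIM('a) + s) * (A * (\<rho> * 2 ^ Suc k) ^ DIM('a))
       = (2 ^ DIM('a) * A * \<rho> powr - s) * (2 powr - s) ^ k"
    proof -
      define u where "u = \<rho> * 2 ^ k"
      have u: "u > 0" using \<open>0 < \<rho>\<close> by (simp add: u_def)
      have "u powr - (real DIM('a) + s) = u powr - real DIM('a) * u powr - s"
        using powr_add[of u "- real DIM('a)" "- s"] by simp
      also have "\<dots> = u powr - s / u ^ DIM('a)"
        using u powr_realpow[of u "DIM('a)"] by (simp add: powr_minus_divide)
      finally have "u powr - (real DIM('a) + s) * (A * (2 * u) ^ DIM('a)) = 2 ^ DIM('a) * A * u powr - s"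
        using u by (simp add: power_mult_distrib)
      moreover have "u powr - s = \<rho> powr - s * (2 powr - s) ^ k"
        using \<open>0 < \<rho>\<close> two_power_powr[of k "-s"] unfolding u_def by (simp add: powr_mult)
      ultimately show ?thesis by (simp add: u_def mult_ac)
    qed
    finally show ?thesis .
  qed
  then have *: "emeasure (frac_measure s z) (S - ball z \<rho>) \<le> ennreal ((2 ^ DIM('a) * A * \<rho> powr - s) / (1 - 2 powr - s))"
    using assms q by (intro emeasure_le_geometric[OF cov]) (auto simp: T_def intro!: sets.Diff sets.Int S)
  show "S - ball z \<rho> \<in> fmeasurable (frac_measure s z)"
    using S by (intro fmeasurableI_bound[OF _ *]) auto
  show "measure (frac_measure s z) (S - ball z \<rho>)
      \<le> 2 ^ DIM('a) / (1 - 2 powr - s) * A * \<rho> powr - s"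
    using measure_le_of_emeasure[OF *] assms q by simp
qed

lemma frac_measure_near:
  fixes z :: "'a::euclidean_space"
  assumes S: "S \<in> sets lebesgue" and "0 < s" "s < 1" "0 < \<rho>" "0 \<le> A" "z \<notin> S"
    and le: "\<And>r. 0 < r \<Longrightarrow> r \<le> \<rho> \<Longrightarrow> measure lebesgue (S \<inter> ball z r) \<le> A * r ^ (DIM('a) + 1)"
  shows "S \<inter> ball z \<rho> \<in> fmeasurable (frac_measure s z)"
    and "measure (frac_measure s z) (S \<inter> ball z \<rho>)
      \<le> 2 powr (real DIM('a) + s) / (1 - 2 powr - (1 - s)) * A * \<rho> powr (1 - s)"
proof -
  define T where "T k = S \<inter> ball z (\<rho> / 2 ^ k) - ball z (\<rho> / 2 ^ Suc k)" for k
  have q: "2 powr - (1 - s) < (1::real)" using \<open>s < 1\<close> powr_less_mono[of "-(1-s)" 0 2] by simp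
  have cov: "S \<inter> ball z \<rho> \<subseteq> (\<Union>k. T k)"
  proof
    fix y assume y: "y \<in> S \<inter> ball z \<rho>"
    \<comment> \<open>The shrinking annuli miss only the centre, which \<open>z \<notin> S\<close>
      excludes.\<close>
    then have d: "dist z y > 0" using \<open>z \<notin> S\<close> by auto
    define P where "P k \<longleftrightarrow> dist z y \<ge> \<rho> / 2 ^ k" for k
    obtain k0 where "\<rho> / dist z y < 2 ^ k0"
      using real_arch_pow[of 2] by auto
    then have k0: "P k0" using d by (simp add: P_def field_simps)
    have n0: "\<not> P 0" using y by (simp add: P_def)
    obtain k where "\<not> P k" "P (Suc k)"
      using k0 n0 by (induction k0) auto
    then have "y \<in> T k" using y by (auto simp: T_def P_def not_less)
    then show "y \<in> (\<Union>k. T k)" by blast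
  qed
  have "emeasure (frac_measure s z) (T k) \<le>
     ennreal ((2 powr (real DIM('a) + s) * A * \<rho> powr (1 - s)) * (2 powr - (1 - s)) ^ k)" for k
  proof -
    have "emeasure (frac_measure s z) (T k) \<le>
        ennreal ((\<rho> / 2 ^ Suc k) powr - (real DIM('a) + s) * (A * (\<rho> / 2 ^ k) ^ (DIM('a) + 1)))"
      unfolding T_def
    proof (rule frac_measure_annulus[OF S])
      have "\<rho> * 1 \<le> \<rho> * 2 ^ k" using \<open>0 < \<rho>\<close> by (intro mult_left_mono one_le_power) auto
      then show "measure lebesgue (S \<inter> ball z (\<rho> / 2 ^ k)) \<le> A * (\<rho> / 2 ^ k) ^ (DIM('a) + 1)"
        using \<open>0 < \<rho>\<close> by (intro le) (simp_all add: field_simps)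
    qed (use assms in auto)
    also have "(\<rho> / 2 ^ Suc k) powr - (real DIM('a) + s) * (A * (\<rho> / 2 ^ k) ^ (DIM('a) + 1))
       = (2 powr (real DIM('a) + s) * A * \<rho> powr (1 - s)) * (2 powr - (1 - s)) ^ k"
    proof -
      define u where "u = \<rho> / 2 ^ k"
      have u: "u > 0" using \<open>0 < \<rho>\<close> by (simp add: u_def)
      have "(u / 2) powr - (real DIM('a) + s) = u powr - (real DIM('a) + s) * 2 powr (real DIM('a) + s)"
        using u by (simp only: powr_minus_divide powr_divide) (simp add: field_simps)
      moreover have "u powr - (real DIM('a) + s) * u ^ (DIM('a) + 1) = u powr (1 - s)"
        using u powr_add[of u "- (real DIM('a) + s)" "real (DIM('a) + 1)"] powr_realpow[of u "DIM('a) + 1"]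
        by simp
      ultimately have "(u / 2) powr - (real DIM('a) + s) * (A * u ^ (DIM('a) + 1))
          = 2 powr (real DIM('a) + s) * A * u powr (1 - s)"
        by (metis (no_types, lifting) mult.assoc mult.commute)
      moreover have "u powr (1 - s) = \<rho> powr (1 - s) * (2 powr - (1 - s)) ^ k"
      proof -
        have "(2 powr - (1 - s)) ^ k = inverse ((2 ^ k) powr (1 - s))"
          by (simp only: two_power_powr powr_minus power_inverse)
        then show ?thesis unfolding u_def using \<open>0 < \<rho>\<close> by (simp add: powr_divide field_simps)
      qed
      ultimately show ?thesis by (simp add: u_def mult_ac)
    qed
    finally show ?thesis .
  qed
  then have *: "emeasure (frac_measure s z) (S \<inter> ball z \<rho>) \<le>
      ennreal ((2 powr (real DIM('a) + s) * A * \<rho> powr (1 - s)) / (1 - 2 powr - (1 - s)))"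
    using assms q by (intro emeasure_le_geometric[OF cov]) (auto simp: T_def intro!: sets.Diff sets.Int S)
  show "S \<inter> ball z \<rho> \<in> fmeasurable (frac_measure s z)"
    using S by (intro fmeasurableI_bound[OF _ *]) auto
  show "measure (frac_measure s z) (S \<inter> ball z \<rho>)
      \<le> 2 powr (real DIM('a) + s) / (1 - 2 powr - (1 - s)) * A * \<rho> powr (1 - s)"
    using measure_le_of_emeasure[OF *] assms q by simp
qed

section \<open>Principal values\<close>

lemma measure_lebesgue_ball:
  fixes z :: "'a::euclidean_space"
  assumes "0 \<le> r"
  shows "measure lebesgue (ball z r) = unit_ball_vol (real DIM('a)) * r ^ DIM('a)"
  using content_ball[OF assms, of z] by (simp add: measure_completion)

text \<open>The point reflection scales every coordinate by -1, so its Jacobian has absolute value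
  1.\<close>

lemma reflection_lebesgue:
  fixes z :: "'a::euclidean_space"
  shows "(\<lambda>y. 2 *\<^sub>R z - y) \<in> lebesgue \<rightarrow>\<^sub>M lebesgue"
    and "distr lebesgue lebesgue (\<lambda>y. 2 *\<^sub>R z - y) = lebesgue"
proof -
  have eq: "2 *\<^sub>R z + (\<Sum>j\<in>Basis. (- 1 * (x \<bullet> j)) *\<^sub>R j) = 2 *\<^sub>R z - x" for x
    by (simp add: sum_negf euclidean_representation)
  show "(\<lambda>y. 2 *\<^sub>R z - y) \<in> lebesgue \<rightarrow>\<^sub>M lebesgue"
    using lebesgue_affine_measurable[of "\<lambda>_::'a. -1" "2 *\<^sub>R z"] by (simp only: eq)
  have "distr lebesgue lebesgue (\<lambda>y. 2 *\<^sub>R z - y) =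
      density (distr lebesgue lebesgue (\<lambda>x. 2 *\<^sub>R z + (\<Sum>j\<in>Basis. (- 1 * (x \<bullet> j)) *\<^sub>R j)))
        (\<lambda>_. ennreal (\<Prod>j\<in>(Basis::'a set). \<bar>- 1\<bar>))"
    unfolding eq by (simp add: density_1)
  also have "\<dots> = lebesgue"
    by (rule lebesgue_affine_euclidean[symmetric]) simp
  finally show "distr lebesgue lebesgue (\<lambda>y. 2 *\<^sub>R z - y) = lebesgue" .
qed

text \<open>The reflection preserves Lebesgue measure and the distance to \<open>z\<close>, hence
  also the weight.\<close>

lemma emeasure_frac_measure_reflect:
  fixes z :: "'a::euclidean_space"
  assumes S: "S \<in> sets lebesgue"
  shows "(\<lambda>y. 2 *\<^sub>R z - y) -` S \<in> sets lebesgue"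
    and "emeasure (frac_measure s z) ((\<lambda>y. 2 *\<^sub>R z - y) -` S) = emeasure (frac_measure s z) S"
proof -
  show m: "(\<lambda>y. 2 *\<^sub>R z - y) -` S \<in> sets lebesgue"
    using measurable_sets[OF reflection_lebesgue(1) S, of z] by (simp add: space_completion)
  define g where "g y = ennreal (norm (z - y) powr - (real DIM('a) + s)) * indicator S y" for y
  have g: "g \<in> borel_measurable lebesgue" unfolding g_def using S by measurable
  have "emeasure (frac_measure s z) S = (\<integral>\<^sup>+y. g y \<partial>distr lebesgue lebesgue (\<lambda>y. 2 *\<^sub>R z - y))"
    unfolding reflection_lebesgue(2) g_def by (rule emeasure_frac_measure[OF S])
  also have "\<dots> = (\<integral>\<^sup>+y. g (2 *\<^sub>R z - y) \<partial>lebesgue)"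
    using g reflection_lebesgue(1)[of z] by (intro nn_integral_distr) auto
  also have "\<dots> = emeasure (frac_measure s z) ((\<lambda>y. 2 *\<^sub>R z - y) -` S)"
  proof -
    have "norm (z - (2 *\<^sub>R z - y)) = norm (z - y)" for y
      using norm_minus_commute[of y z] by (simp add: scaleR_2)
    then show ?thesis unfolding emeasure_frac_measure[OF m] g_def
      by (intro nn_integral_cong) (simp add: indicator_def)
  qed
  finally show "emeasure (frac_measure s z) ((\<lambda>y. 2 *\<^sub>R z - y) -` S) = emeasure (frac_measure s z) S" ..
qed

lemma frac_measure_fmeasurable_far:
  fixes z :: "'a::euclidean_space"
  assumes "S \<in> sets lebesgue" "0 < s" "0 < \<rho>" 
  shows "S - ball z \<rho> \<in> fmeasurable (frac_measure s z)"
proof (rule frac_measure_far(1)[OF assms])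
  show "0 \<le> unit_ball_vol (real DIM('a))" by simp
  show "measure lebesgue (S \<inter> ball z r) \<le> unit_ball_vol (real DIM('a)) * r ^ DIM('a)" if "\<rho> \<le> r" for r
  proof -
    have "measure lebesgue (S \<inter> ball z r) \<le> measure lebesgue (ball z r)"
      using assms by (intro measure_mono_fmeasurable) (auto simp: sets.Int)
    also have "\<dots> = unit_ball_vol (real DIM('a)) * r ^ DIM('a)"
      using that assms by (intro measure_lebesgue_ball) simp
    finally show ?thesis .
  qed
qed

lemma closed_sets_lebesgue: "closed S \<Longrightarrow> S \<in> sets lebesgue"
  and open_sets_lebesgue: "open S \<Longrightarrow> S \<in> sets lebesgue" for S :: "'a::euclidean_space set"
  by (auto intro: sets_completionI_sets)

lemma sets_halfspaces [simp]:
  fixes z \<nu> :: "'a::euclidean_space"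
  shows "{y. (y - z) \<bullet> \<nu> < c} \<in> sets lebesgue" "{y. (y - z) \<bullet> \<nu> \<le> c} \<in> sets lebesgue"
    "{y. c < (y - z) \<bullet> \<nu>} \<in> sets lebesgue" "{y. c \<le> (y - z) \<bullet> \<nu>} \<in> sets lebesgue"
    "{y. y \<bullet> \<nu> < c} \<in> sets lebesgue" "{y. y \<bullet> \<nu> \<le> c} \<in> sets lebesgue"
    "{y. c < y \<bullet> \<nu>} \<in> sets lebesgue" "{y. c \<le> y \<bullet> \<nu>} \<in> sets lebesgue"
  by (auto intro!: closed_sets_lebesgue open_sets_lebesgue open_Collect_less closed_Collect_le
      continuous_intros)

lemma null_sets_hyperplane:
  fixes \<nu> :: "'a::euclidean_space"
  assumes "\<nu> \<noteq> 0"
  shows "{y. y \<bullet> \<nu> = c} \<in> null_sets lebesgue" "{y. (y - z) \<bullet> \<nu> = c} \<in> null_sets lebesgue"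
proof -
  show *: "{y. y \<bullet> \<nu> = c} \<in> null_sets lebesgue" for c
    using negligible_hyperplane[of \<nu> c] assms by (simp add: negligible_iff_null_sets inner_commute)
  have "{y. (y - z) \<bullet> \<nu> = c} = {y. y \<bullet> \<nu> = c + z \<bullet> \<nu>}"
    by (auto simp: inner_diff_left algebra_simps)
  then show "{y. (y - z) \<bullet> \<nu> = c} \<in> null_sets lebesgue" using * by simp
qed

text \<open>Reflection across \<open>z\<close> exchanges the two sides of a hyperplane through \<open>z\<close>, so only the
  deviation of \<open>F\<close> from a half-space contributes to its curvature.\<close>

lemma measure_frac_halfspace_symmetric:
  fixes z \<nu> :: "'a::euclidean_space"
  assumes "\<nu> \<noteq> 0"
  shows "measure (frac_measure s z) (- {y. (y - z) \<bullet> \<nu> < 0} - ball z \<epsilon>) =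
    measure (frac_measure s z) ({y. (y - z) \<bullet> \<nu> < 0} - ball z \<epsilon>)"
proof -
  let ?T = "{y. (y - z) \<bullet> \<nu> < 0}"
  have sets: "?T - ball z \<epsilon> \<in> sets lebesgue" "- ?T - ball z \<epsilon> \<in> sets lebesgue"
    by (auto intro!: sets.Diff)
  have v: "(\<lambda>y. 2 *\<^sub>R z - y) -` (?T - ball z \<epsilon>) = {y. 0 < (y - z) \<bullet> \<nu>} - ball z \<epsilon>"
  proof -
    have "(2 *\<^sub>R z - y - z) \<bullet> \<nu> = - ((y - z) \<bullet> \<nu>)" for y by (simp add: scaleR_2 inner_diff_left)
    moreover have "dist z (2 *\<^sub>R z - y) = dist z y" for y
      by (simp add: dist_norm scaleR_2 norm_minus_commute)
    ultimately show ?thesis by auto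
  qed
  have "measure (frac_measure s z) ((\<lambda>y. 2 *\<^sub>R z - y) -` (?T - ball z \<epsilon>)) =
      measure (frac_measure s z) (?T - ball z \<epsilon>)"
    using emeasure_frac_measure_reflect(2)[OF sets(1), where z = z and s = s] by (simp add: measure_def)
  moreover have "measure (frac_measure s z) ({y. 0 < (y - z) \<bullet> \<nu>} - ball z \<epsilon>) =
      measure (frac_measure s z) (- ?T - ball z \<epsilon>)"
  proof (rule measure_eq_AE)
    show "AE y in frac_measure s z. (y \<in> {y. 0 < (y - z) \<bullet> \<nu>} - ball z \<epsilon>) = (y \<in> - ?T - ball z \<epsilon>)"
      by (rule AE_I'[OF null_sets_frac_measure[OF null_sets_hyperplane(2)[OF assms, of z 0]]]) auto
  qed (auto intro!: sets.Diff)
  ultimately show ?thesis unfolding v by simp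
qed

text \<open>Off the ball all masses are finite, and \<open>T\<close> and \<open>- T\<close> weigh
  the same. Splitting \<open>F\<close>, \<open>- F\<close>, \<open>T\<close> and \<open>- T\<close>
  along each other cancels the common parts and leaves twice the deviation of \<open>F\<close> from
  \<open>T\<close>. The right-hand side can stay finite as \<epsilon> tends to 0, although both
  terms on the left may blow up. Any normal \<nu> is allowed, which later permits a comparison with
  a horizontal plane instead of the tangent plane.\<close>

lemma frac_measure_balance:
  fixes z \<nu> :: "'a::euclidean_space"
  assumes F: "F \<in> sets lebesgue" and "\<nu> \<noteq> 0" "0 < s" "0 < \<epsilon>"
  defines "T \<equiv> {y. (y - z) \<bullet> \<nu> < 0}"
  shows "measure (frac_measure s z) (- F - ball z \<epsilon>) - measure (frac_measure s z) (F - ball z \<epsilon>)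
    = 2 * (measure (frac_measure s z) (T - F - ball z \<epsilon>) - measure (frac_measure s z) (F - T - ball z \<epsilon>))"
proof -
  let ?m = "measure (frac_measure s z)"
  have T: "T \<in> sets lebesgue" by (simp add: T_def)
  have fm: "S - ball z \<epsilon> \<in> fmeasurable (frac_measure s z)" if "S \<in> sets lebesgue" for S
    using frac_measure_fmeasurable_far[OF that] assms by simp
  have split: "?m (S - ball z \<epsilon>) = ?m ((S \<inter> T) - ball z \<epsilon>) + ?m ((S - T) - ball z \<epsilon>)"
    if "S \<in> sets lebesgue" for S
  proof -
    have "?m ((S \<inter> T - ball z \<epsilon>) \<union> (S - T - ball z \<epsilon>)) = ?m ((S \<inter> T) - ball z \<epsilon>) + ?m ((S - T) - ball z \<epsilon>)"
      using that T fm by (intro measure_Union) (auto simp: fmeasurableD2 sets.Diff sets.Int)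
    moreover have "(S \<inter> T - ball z \<epsilon>) \<union> (S - T - ball z \<epsilon>) = S - ball z \<epsilon>" by auto
    ultimately show ?thesis by simp
  qed
  have split': "?m (S - ball z \<epsilon>) = ?m ((S \<inter> F) - ball z \<epsilon>) + ?m ((S - F) - ball z \<epsilon>)"
    if "S \<in> sets lebesgue" for S
  proof -
    have "?m ((S \<inter> F - ball z \<epsilon>) \<union> (S - F - ball z \<epsilon>)) = ?m ((S \<inter> F) - ball z \<epsilon>) + ?m ((S - F) - ball z \<epsilon>)"
      using that F fm by (intro measure_Union) (auto simp: fmeasurableD2 sets.Diff sets.Int)
    moreover have "(S \<inter> F - ball z \<epsilon>) \<union> (S - F - ball z \<epsilon>) = S - ball z \<epsilon>" by auto
    ultimately show ?thesis by simp
  qed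
  have "?m (- T - ball z \<epsilon>) = ?m (T - ball z \<epsilon>)"
    unfolding T_def by (rule measure_frac_halfspace_symmetric[OF assms(2)])
  moreover note split[OF F] split[of "- F"] split'[OF T] split'[of "- T"]
  moreover have "- F \<inter> T = T - F" "- T \<inter> F = F - T" "T \<inter> F = F \<inter> T" "- F - T = - T - F" by auto
  ultimately show ?thesis using F T by simp
qed

text \<open>Continuity from below: the sets increase to \<open>S - {z}\<close> as \<epsilon>
  decreases, and the centre is null. It is enough to test decreasing sequences; the right end 1 of
  the interval is arbitrary.\<close>

lemma measure_frac_Diff_ball_tendsto:
  fixes z :: "'a::euclidean_space"
  assumes S: "S \<in> fmeasurable (frac_measure s z)"
  shows "((\<lambda>\<epsilon>. measure (frac_measure s z) (S - ball z \<epsilon>)) \<longlongrightarrow> measure (frac_measure s z) S) (at_right 0)"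
proof (rule tendsto_at_right_sequentially[of 0 1])
  fix e :: "nat \<Rightarrow> real"
  assume e: "\<And>n. 0 < e n" "decseq e" "e \<longlonglongrightarrow> 0"
  have Sl: "S \<in> sets lebesgue" using fmeasurableD[OF S] by simp
  have un: "(\<Union>n. S - ball z (e n)) = S - {z}"
  proof -
    have "\<exists>n. e n \<le> dist z y" if "y \<noteq> z" for y
      using order_tendstoD(2)[OF e(3), of "dist z y"] that
      by (metis dist_commute eventually_at_top_linorder less_imp_le order_refl zero_less_dist_iff)
    then have "x \<noteq> z \<Longrightarrow> \<not> (\<forall>n. dist z x < e n)" for x by (meson not_less)
    then show ?thesis using e(1) by (auto, metis)
  qed
  have zn: "{z} \<in> null_sets (frac_measure s z)"
    by (rule null_sets_frac_measure) (simp add: flip: negligible_iff_null_sets)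
  have "(\<lambda>n. measure (frac_measure s z) (S - ball z (e n))) \<longlonglongrightarrow> measure (frac_measure s z) (\<Union>n. S - ball z (e n))"
  proof (rule Lim_measure_incseq)
    show "incseq (\<lambda>n. S - ball z (e n))"
      using e(2) by (force simp: incseq_def decseq_def dest: less_le_trans)
    show "emeasure (frac_measure s z) (\<Union>n. S - ball z (e n)) \<noteq> \<infinity>"
      unfolding un using S Sl emeasure_Diff_null_set[OF zn, of S] fmeasurableD2[OF S] by simp
  qed (use Sl in \<open>auto intro!: sets.Diff\<close>)
  then show "(\<lambda>n. measure (frac_measure s z) (S - ball z (e n))) \<longlonglongrightarrow> measure (frac_measure s z) S"
    unfolding un using measure_Diff_null_set[OF _ zn, of S] Sl by simp
qed simp

lemma frac_curvature_integral:
  fixes z :: "'a::euclidean_space"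
  assumes F: "F \<in> sets lebesgue" and "0 < s" "0 < \<epsilon>"
  shows "(LINT y : - ball z \<epsilon> | lebesgue.
       (indicat_real (- F) y - indicat_real F y) / norm (z - y) powr (real DIM('a) + s))
    = measure (frac_measure s z) (- F - ball z \<epsilon>) - measure (frac_measure s z) (F - ball z \<epsilon>)"
proof -
  let ?M = "frac_measure s z"
  define k where "k y = norm (z - y) powr - (real DIM('a) + s)" for y
  define f where "f y = indicat_real (- F - ball z \<epsilon>) y - indicat_real (F - ball z \<epsilon>) y" for y
  have k: "k \<in> borel_measurable lebesgue" unfolding k_def by measurable
  have fm: "F - ball z \<epsilon> \<in> fmeasurable ?M" "- F - ball z \<epsilon> \<in> fmeasurable ?M"
    using frac_measure_fmeasurable_far[of F] frac_measure_fmeasurable_far[of "- F"] assms by auto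
  have sl: "F - ball z \<epsilon> \<in> sets lebesgue" "- F - ball z \<epsilon> \<in> sets lebesgue"
    using F by (auto intro!: sets.Diff)
  have f: "f \<in> borel_measurable lebesgue" unfolding f_def using sl by measurable
  have "(LINT y : - ball z \<epsilon> | lebesgue.
       (indicat_real (- F) y - indicat_real F y) / norm (z - y) powr (real DIM('a) + s)) =
      (\<integral>y. k y *\<^sub>R f y \<partial>lebesgue)"
    unfolding set_lebesgue_integral_def
    by (intro Bochner_Integration.integral_cong refl)
      (simp only: k_def f_def powr_minus_divide, simp add: indicator_def)
  also have "\<dots> = (\<integral>y. f y \<partial>?M)"
    unfolding frac_measure_def using f k
    by (subst integral_density) (auto simp: k_def)
  also have "\<dots> = (\<integral>y. indicat_real (- F - ball z \<epsilon>) y \<partial>?M) - (\<integral>y. indicat_real (F - ball z \<epsilon>) y \<partial>?M)"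
    unfolding f_def using fm
    by (intro Bochner_Integration.integral_diff integrable_real_indicator)
      (auto simp: fmeasurable_def)
  finally show ?thesis by simp
qed

text \<open>The cancellation of the principal value takes place before the limit, in
  \<open>frac_measure_balance\<close>; afterwards both masses converge separately.\<close>

lemma frac_curvature_tendsto:
  fixes z \<nu> :: "'a::euclidean_space"
  assumes F: "F \<in> sets lebesgue" and "\<nu> \<noteq> 0" "0 < s"
  defines "T \<equiv> {y. (y - z) \<bullet> \<nu> < 0}"
  assumes fin: "T - F \<in> fmeasurable (frac_measure s z)" "F - T \<in> fmeasurable (frac_measure s z)"
  shows "((\<lambda>\<epsilon>. LINT y : - ball z \<epsilon> | lebesgue.
       (indicat_real (- F) y - indicat_real F y) / norm (z - y) powr (real DIM('a) + s)) \<longlongrightarrow>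
     2 * (measure (frac_measure s z) (T - F) - measure (frac_measure s z) (F - T))) (at_right 0)"
proof -
  have "((\<lambda>\<epsilon>. 2 * (measure (frac_measure s z) (T - F - ball z \<epsilon>) - measure (frac_measure s z) (F - T - ball z \<epsilon>))) \<longlongrightarrow>
     2 * (measure (frac_measure s z) (T - F) - measure (frac_measure s z) (F - T))) (at_right 0)"
    by (intro tendsto_intros measure_frac_Diff_ball_tendsto fin)
  then show ?thesis
  proof (rule tendsto_cong[THEN iffD1, rotated])
    show "\<forall>\<^sub>F \<epsilon> in at_right 0. 2 * (measure (frac_measure s z) (T - F - ball z \<epsilon>) - measure (frac_measure s z) (F - T - ball z \<epsilon>))
      = (LINT y : - ball z \<epsilon> | lebesgue.
       (indicat_real (- F) y - indicat_real F y) / norm (z - y) powr (real DIM('a) + s))"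
      using eventually_at_right_less[of 0]
    proof eventually_elim
      case (elim \<epsilon>)
      show ?case
        using frac_curvature_integral[OF F, of s \<epsilon> z] frac_measure_balance[OF F, of \<nu> s \<epsilon> z] elim assms(2,3)
        by (simp add: T_def)
    qed
  qed
qed

text \<open>\<open>Lim\<close> is a definite description and can be evaluated only once convergence
  is known. The second equation uses the same limit with the sign of the integrand reversed.\<close>

lemma frac_mean_curv_eq:
  fixes z \<nu> :: "'a::euclidean_space"
  assumes F: "F \<in> sets lebesgue" and "\<nu> \<noteq> 0" "0 < s"
  defines "T \<equiv> {y. (y - z) \<bullet> \<nu> < 0}"
  assumes fin: "T - F \<in> fmeasurable (frac_measure s z)" "F - T \<in> fmeasurable (frac_measure s z)"
  shows "frac_mean_curv s F z = 2 * (measure (frac_measure s z) (T - F) - measure (frac_measure s z) (F - T))"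
    and "frac_mean_curv s (- F) z = - frac_mean_curv s F z"
proof -
  note lim = frac_curvature_tendsto[OF assms(1-3), where z = z, folded T_def, OF fin]
  show 1: "frac_mean_curv s F z = 2 * (measure (frac_measure s z) (T - F) - measure (frac_measure s z) (F - T))"
    unfolding frac_mean_curv_def by (rule tendsto_Lim[OF _ lim]) simp
  have "(\<lambda>\<epsilon>. LINT y : - ball z \<epsilon> | lebesgue.
       (indicat_real (- (- F)) y - indicat_real (- F) y) / norm (z - y) powr (real DIM('a) + s))
    = (\<lambda>\<epsilon>. - (LINT y : - ball z \<epsilon> | lebesgue.
       (indicat_real (- F) y - indicat_real F y) / norm (z - y) powr (real DIM('a) + s)))"
    unfolding set_lebesgue_integral_def Bochner_Integration.integral_minus[symmetric]
    by (intro ext Bochner_Integration.integral_cong refl) (simp add: diff_divide_distrib right_diff_distrib)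
  then show "frac_mean_curv s (- F) z = - frac_mean_curv s F z"
    unfolding 1 unfolding frac_mean_curv_def
    by (intro tendsto_Lim) (simp, simp only: tendsto_minus[OF lim])
qed

section \<open>Slabs\<close>

text \<open>Disjoint translates stand in for an integration along one direction; both slabs and
  graphs of functions are measured this way.\<close>

lemma measure_packing:
  fixes S B :: "'a::euclidean_space set" and v :: "nat \<Rightarrow> 'a"
  assumes S: "S \<in> fmeasurable lebesgue" and B: "B \<in> fmeasurable lebesgue"
    and disj: "\<And>j k x y. j < k \<Longrightarrow> k < m \<Longrightarrow> x \<in> S \<Longrightarrow> y \<in> S \<Longrightarrow> v j + x \<noteq> v k + y"
    and sub: "\<And>k x. k < m \<Longrightarrow> x \<in> S \<Longrightarrow> v k + x \<in> B"
  shows "real m * measure lebesgue S \<le> measure lebesgue B"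
proof -
  define T where "T k = (\<lambda>y. v k + y) ` S" for k
  have T: "T k \<in> fmeasurable lebesgue" "measure lebesgue (T k) = measure lebesgue S" for k
    unfolding T_def using S by (auto simp: measurable_translation measure_translation)
  have "real m * measure lebesgue S = (\<Sum>k<m. measure lebesgue (T k))" by (simp add: T(2))
  also have "\<dots> = measure lebesgue (\<Union>k<m. T k)"
  proof (rule measure_UNION'[symmetric])
    have "T j \<inter> T k = {}" if "j < k" "k < m" for j k
      using disj[OF that] by (auto simp: T_def)
    then show "pairwise (\<lambda>i j. disjnt (T i) (T j)) {..<m}"
      unfolding pairwise_def disjnt_def by (metis Int_commute lessThan_iff nat_neq_iff)
  qed (use T in auto)
  also have "\<dots> \<le> measure lebesgue B"
    using T(1) sub B by (intro measure_mono_fmeasurable sets.finite_UN) (auto simp: T_def intro: fmeasurableD)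
  finally show ?thesis .
qed

text \<open>About \<open>r / h\<close> disjoint translates along \<open>e\<close> of the slab piece
  fit into \<open>ball z (2 * r)\<close>. Doubling the radius costs \<open>2 ^ DIM('a)\<close>,
  rounding \<open>r / h\<close> down costs another factor 2. For \<open>h > r\<close> the volume of
  the ball is already good enough.\<close>

lemma measure_slab_le:
  fixes z e :: "'a::euclidean_space"
  assumes e: "norm e = 1" and "0 < h" "0 < r"
  shows "measure lebesgue ({y. a \<le> y \<bullet> e \<and> y \<bullet> e < a + h} \<inter> ball z r)
    \<le> 2 ^ (DIM('a) + 1) * unit_ball_vol (real DIM('a)) * h * r ^ (DIM('a) - 1)"
proof -
  let ?V = "unit_ball_vol (real DIM('a))"
  define S where "S = {y. a \<le> y \<bullet> e \<and> y \<bullet> e < a + h} \<inter> ball z r"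
  have "{y. a \<le> y \<bullet> e \<and> y \<bullet> e < a + h} = {y. a \<le> y \<bullet> e} \<inter> {y. y \<bullet> e < a + h}" by auto
  then have S: "S \<in> fmeasurable lebesgue" unfolding S_def by (auto intro!: sets.Int)
  have pow: "r ^ DIM('a) = r * r ^ (DIM('a) - 1)"
    using DIM_positive[where 'a='a] power_Suc[of r "DIM('a) - 1"] by simp
  show ?thesis
  proof (cases "h \<le> r")
    case False
    have "measure lebesgue S \<le> measure lebesgue (ball z r)"
      using S unfolding S_def by (intro measure_mono_fmeasurable) auto
    also have "\<dots> = ?V * r ^ DIM('a)" using assms by (intro measure_lebesgue_ball) auto
    also have "\<dots> = ?V * r * r ^ (DIM('a) - 1)" unfolding pow by (rule mult.assoc[symmetric])
    also have "\<dots> \<le> (2 ^ (DIM('a) + 1) * ?V) * h * r ^ (DIM('a) - 1)"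
    proof (intro mult_right_mono mult_mono)
      show "?V \<le> 2 ^ (DIM('a) + 1) * ?V"
        using mult_right_mono[of 1 "2 ^ (DIM('a) + 1)" ?V] one_le_power[of "2::real" "DIM('a) + 1"] by simp
    qed (use False assms in auto)
    finally show ?thesis by (simp only: S_def)
  next
    case True
    define m where "m = nat \<lfloor>r / h\<rfloor>"
    have rh: "1 \<le> r / h" using True assms by simp
    have m: "real m \<le> r / h" "r / h < real m + 1" "1 \<le> real m"
      unfolding m_def using rh by (auto simp: le_nat_iff le_floor_iff of_nat_nat)
    then have m2: "r / h \<le> 2 * real m" by linarith
    have mh: "real m * h \<le> r" using m(1) assms by (simp add: field_simps)
    have ee: "e \<bullet> e = 1" using e by (simp add: norm_eq_1)
    have "real m * measure lebesgue S \<le> measure lebesgue (ball z (2 * r))"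
    proof (rule measure_packing[OF S, where v = "\<lambda>k. (real k * h) *\<^sub>R e"])
      fix j k :: nat and x y assume jk: "j < k" "k < m" and xy: "x \<in> S" "y \<in> S"
      show "(real j * h) *\<^sub>R e + x \<noteq> (real k * h) *\<^sub>R e + y"
      proof
        assume "(real j * h) *\<^sub>R e + x = (real k * h) *\<^sub>R e + y"
        then have "((real j * h) *\<^sub>R e + x) \<bullet> e = ((real k * h) *\<^sub>R e + y) \<bullet> e" by simp
        then have "real j * h + x \<bullet> e = real k * h + y \<bullet> e" by (simp add: inner_add_left ee)
        moreover have "(real j + 1) * h \<le> real k * h"
          using jk assms by (intro mult_right_mono) auto
        ultimately show False using xy by (auto simp: S_def algebra_simps)
      qed
    next
      fix k y assume k: "k < m" and y: "y \<in> S"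
      have "real k * h \<le> real m * h" using k assms by (intro mult_right_mono) auto
      then have "real k * h \<le> r" using mh by linarith
      then have "norm ((real k * h) *\<^sub>R e) \<le> r" using mh assms e by simp
      moreover have "norm (z - y) < r" using y by (simp add: S_def dist_norm)
      moreover have "norm (z - ((real k * h) *\<^sub>R e + y)) \<le> norm (z - y) + norm ((real k * h) *\<^sub>R e)"
        using norm_triangle_ineq4[of "z - y" "(real k * h) *\<^sub>R e"] by (simp add: algebra_simps)
      ultimately show "(real k * h) *\<^sub>R e + y \<in> ball z (2 * r)" by (simp add: dist_norm)
    qed simp
    also have "\<dots> = 2 ^ DIM('a) * ?V * (r * r ^ (DIM('a) - 1))"
      using measure_lebesgue_ball[of "2 * r" z] assms by (simp add: power_mult_distrib pow)
    finally have "real m * measure lebesgue S \<le> 2 ^ DIM('a) * ?V * (r * r ^ (DIM('a) - 1))" .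
    moreover have "r / h * measure lebesgue S \<le> 2 * (real m * measure lebesgue S)"
      using mult_right_mono[OF m2, of "measure lebesgue S"] by (simp add: mult_ac)
    ultimately have "r / h * measure lebesgue S \<le> 2 ^ (DIM('a) + 1) * ?V * (r * r ^ (DIM('a) - 1))"
      by simp
    then have "r * measure lebesgue S \<le> r * (2 ^ (DIM('a) + 1) * ?V * h * r ^ (DIM('a) - 1))"
      using assms by (simp add: field_simps)
    then have "measure lebesgue S \<le> 2 ^ (DIM('a) + 1) * ?V * h * r ^ (DIM('a) - 1)"
      using assms by (simp only: mult_le_cancel_left_pos)
    then show ?thesis by (simp only: S_def)
  qed
qed

text \<open>For radii \<open>r \<ge> \<rho>\<close> a volume of order \<open>h * r ^ (N - 1)\<close>
  is at most one of order \<open>(h / \<rho>) * r ^ N\<close>, with \<open>N\<close> the dimension,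
  so the slab counts as a set of density \<open>h / \<rho>\<close> in the far-field
  estimate.\<close>

lemma measure_frac_slab_le:
  fixes z e :: "'a::euclidean_space"
  assumes e: "norm e = 1" and "0 < h" "0 < \<rho>" "0 < s"
  shows "measure (frac_measure s z) ({y. a \<le> y \<bullet> e \<and> y \<bullet> e < a + h} - ball z \<rho>)
    \<le> 2 ^ DIM('a) / (1 - 2 powr - s) * (2 ^ (DIM('a) + 1) * unit_ball_vol (real DIM('a))) * (h / \<rho>) * \<rho> powr - s"
proof -
  let ?C = "2 ^ (DIM('a) + 1) * unit_ball_vol (real DIM('a))"
  have eq: "{y. a \<le> y \<bullet> e \<and> y \<bullet> e < a + h} = {y. a \<le> y \<bullet> e} \<inter> {y. y \<bullet> e < a + h}" by auto
  have "measure (frac_measure s z) ({y. a \<le> y \<bullet> e \<and> y \<bullet> e < a + h} - ball z \<rho>)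
    \<le> 2 ^ DIM('a) / (1 - 2 powr - s) * (?C * (h / \<rho>)) * \<rho> powr - s"
  proof (rule frac_measure_far(2))
    fix r assume r: "\<rho> \<le> r"
    have "r ^ DIM('a) = r * r ^ (DIM('a) - 1)"
      using DIM_positive[where 'a='a] power_Suc[of r "DIM('a) - 1"] by simp
    moreover have "?C * h * (\<rho> * r ^ (DIM('a) - 1)) \<le> ?C * h * (r * r ^ (DIM('a) - 1))"
      using r assms by (intro mult_left_mono mult_right_mono) auto
    ultimately have "?C * h * r ^ (DIM('a) - 1) \<le> ?C * (h / \<rho>) * r ^ DIM('a)"
      using assms by (simp add: field_simps)
    then show "measure lebesgue ({y. a \<le> y \<bullet> e \<and> y \<bullet> e < a + h} \<inter> ball z r) \<le> ?C * (h / \<rho>) * r ^ DIM('a)"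
      using measure_slab_le[OF e, of h r a z] assms r by linarith
  qed (use assms eq in \<open>auto intro!: sets.Int\<close>)
  then show ?thesis by (simp only: mult.assoc)
qed

text \<open>The reverse of packing: if \<open>D < R\<close>, translates of the slab piece by
  multiples of \<open>2 * D\<close> cover \<open>ball z (R / 2)\<close>, and at most
  \<open>3 * R / D\<close> of them are used. The piece is cut off at radius \<open>2 * R\<close>
  because the translations have length up to \<open>R / 2 + D\<close>. If \<open>R \<le> D\<close>,
  the slab contains \<open>ball z R\<close>.\<close>

lemma measure_slab_ge:
  fixes z e :: "'a::euclidean_space"
  assumes e: "norm e = 1" and "0 < D" "0 < R"
  shows "unit_ball_vol (real DIM('a)) / (3 * 2 ^ DIM('a)) * min (D / R) 1 * R ^ DIM('a)
    \<le> measure lebesgue ({y. - D \<le> (y - z) \<bullet> e \<and> (y - z) \<bullet> e < D} \<inter> ball z (2 * R))"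
proof -
  let ?V = "unit_ball_vol (real DIM('a))"
  define S where "S = {y. - D \<le> (y - z) \<bullet> e \<and> (y - z) \<bullet> e < D} \<inter> ball z (2 * R)"
  have ee: "e \<bullet> e = 1" using e by (simp add: norm_eq_1)
  have "{y. - D \<le> (y - z) \<bullet> e \<and> (y - z) \<bullet> e < D} = {y. - D \<le> (y - z) \<bullet> e} \<inter> {y. (y - z) \<bullet> e < D}"
    by auto
  then have S: "S \<in> fmeasurable lebesgue" unfolding S_def by (auto intro!: sets.Int)
  have cs: "\<bar>(y - z) \<bullet> e\<bar> \<le> norm (y - z)" for y
    using Cauchy_Schwarz_ineq2[of "y - z" e] e by simp
  have two: "(1::real) \<le> 3 * 2 ^ DIM('a)"
    using one_le_power[of "2::real" "DIM('a)"] by linarith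
  show ?thesis
  proof (cases "R \<le> D")
    case True
    have "?V / (3 * 2 ^ DIM('a)) * min (D / R) 1 * R ^ DIM('a) \<le> ?V * 1 * R ^ DIM('a)"
    proof (intro mult_right_mono mult_mono)
      show "?V / (3 * 2 ^ DIM('a)) \<le> ?V"
        using mult_left_mono[OF two, of ?V] two by (simp add: divide_le_eq)
    qed (use assms in auto)
    also have "\<dots> = measure lebesgue (ball z R)" using measure_lebesgue_ball[of R z] assms by simp
    also have "\<dots> \<le> measure lebesgue S"
    proof (rule measure_mono_fmeasurable[OF _ _ S])
      show "ball z R \<subseteq> S"
      proof
        fix y assume "y \<in> ball z R"
        then have "norm (y - z) < R" by (simp add: dist_norm norm_minus_commute)
        moreover from this have "- D \<le> (y - z) \<bullet> e" "(y - z) \<bullet> e < D" using cs[of y] True by linarith+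
        ultimately show "y \<in> S" using \<open>0 < R\<close>
          by (simp add: S_def dist_norm norm_minus_commute)
      qed
    qed auto
    finally show ?thesis by (simp only: S_def)
  next
    case False
    define m where "m = \<lfloor>R / (4 * D) + 1 / 2\<rfloor>"
    have m0: "0 \<le> m" using assms by (simp add: m_def)
    have m: "real_of_int m \<le> R / (4 * D) + 1 / 2" unfolding m_def by linarith
    define T where "T k = (\<lambda>y. (2 * D * real_of_int k) *\<^sub>R e + y) ` S" for k
    have T: "T k \<in> fmeasurable lebesgue" "measure lebesgue (T k) = measure lebesgue S" for k
      unfolding T_def using S by (auto simp: measurable_translation measure_translation)
    have sub: "ball z (R / 2) \<subseteq> (\<Union>k\<in>{-m..m}. T k)"
    proof
      fix x assume x: "x \<in> ball z (R / 2)"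
      then have nx: "norm (x - z) < R / 2" by (simp add: dist_norm norm_minus_commute)
      define k where "k = \<lfloor>((x - z) \<bullet> e + D) / (2 * D)\<rfloor>"
      have "real_of_int k \<le> ((x - z) \<bullet> e + D) / (2 * D)" "((x - z) \<bullet> e + D) / (2 * D) < real_of_int k + 1"
        unfolding k_def by linarith+
      then have k: "2 * D * real_of_int k \<le> (x - z) \<bullet> e + D" "(x - z) \<bullet> e + D < 2 * D * real_of_int k + 2 * D"
        using assms by (simp_all add: field_simps)
      have absk: "\<bar>2 * D * real_of_int k\<bar> \<le> R / 2 + D" using k cs[of x] nx by linarith
      then have "\<bar>real_of_int k\<bar> \<le> R / (4 * D) + 1 / 2"
        using assms by (simp add: abs_mult field_simps)
      then have "k \<in> {-m..m}" unfolding m_def by (auto simp: le_floor_iff minus_le_iff)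
      moreover have "x - (2 * D * real_of_int k) *\<^sub>R e \<in> S"
      proof -
        have "norm (z - (x - (2 * D * real_of_int k) *\<^sub>R e)) \<le> norm (x - z) + norm ((2 * D * real_of_int k) *\<^sub>R e)"
          using norm_triangle_ineq4[of "(2 * D * real_of_int k) *\<^sub>R e" "x - z"] by (simp add: algebra_simps)
        also have "\<dots> < R / 2 + (R / 2 + D)" using nx absk e by simp
        also have "\<dots> \<le> 2 * R" using False by simp
        finally have "norm (z - (x - (2 * D * real_of_int k) *\<^sub>R e)) < 2 * R" .
        moreover have "(x - (2 * D * real_of_int k) *\<^sub>R e - z) \<bullet> e = (x - z) \<bullet> e - 2 * D * real_of_int k"
          by (simp add: inner_diff_left ee)
        ultimately show ?thesis using k by (simp add: S_def dist_norm)
      qed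
      then have "x \<in> T k" unfolding T_def
        by (intro image_eqI[of _ _ "x - (2 * D * real_of_int k) *\<^sub>R e"]) auto
      ultimately show "x \<in> (\<Union>k\<in>{-m..m}. T k)" by blast
    qed
    have "?V * (R / 2) ^ DIM('a) = measure lebesgue (ball z (R / 2))"
      using measure_lebesgue_ball[of "R / 2" z] assms by simp
    also have "\<dots> \<le> measure lebesgue (\<Union>k\<in>{-m..m}. T k)"
      using T sub by (intro measure_mono_fmeasurable fmeasurable.finite_UN) auto
    also have "\<dots> \<le> (\<Sum>k\<in>{-m..m}. measure lebesgue (T k))"
      using T by (intro measure_UNION_le) (auto intro: fmeasurableD)
    also have "\<dots> = (2 * real_of_int m + 1) * measure lebesgue S"
      using m0 by (simp add: T(2))
    also have "\<dots> \<le> (3 * R / D) * measure lebesgue S"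
    proof (rule mult_right_mono)
      have "1 \<le> R / D" using False assms by simp
      moreover have "R / (4 * D) = R / D / 4" by simp
      moreover have "3 * R / D = 3 * (R / D)" by simp
      ultimately show "2 * real_of_int m + 1 \<le> 3 * R / D" using m by linarith
    qed simp
    finally have "?V * (R / 2) ^ DIM('a) \<le> (3 * R / D) * measure lebesgue S" .
    then have "?V / (3 * 2 ^ DIM('a)) * (D / R) * R ^ DIM('a) \<le> measure lebesgue S"
      using assms by (simp add: field_simps)
    moreover have "min (D / R) 1 = D / R" using False assms by simp
    ultimately show ?thesis by (simp only: S_def)
  qed
qed

text \<open>Moving the centre by \<open>3 * R\<close> in a direction orthogonal to \<open>e\<close>
  changes no heights, and \<open>ball z' (2 * R)\<close> lies at distances between \<open>R\<close>
  and \<open>5 * R\<close> from \<open>z\<close>. There the weight is at least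
  \<open>(5 * R) powr - (N + s)\<close>, with \<open>N\<close> the dimension. The orthogonal
  direction exists because the dimension is at least 2.\<close>

lemma measure_frac_slab_ge:
  assumes "2 \<le> DIM('a::euclidean_space)" "0 < s"
  shows "\<exists>c>0. \<forall>(z::'a) e D R. norm e = 1 \<longrightarrow> 0 < D \<longrightarrow> 0 < R \<longrightarrow>
     c * min (D / R) 1 * R powr - s
       \<le> measure (frac_measure s z) ({y. - D \<le> (y - z) \<bullet> e \<and> (y - z) \<bullet> e < D} - ball z R)"
proof (intro exI conjI allI impI)
  let ?V = "unit_ball_vol (real DIM('a))"
  define c where "c = ?V / (3 * 2 ^ DIM('a)) * 5 powr - (real DIM('a) + s)"
  show "c > 0" by (simp add: c_def)
  fix z e :: 'a and D R :: real
  assume e: "norm e = 1" and D: "0 < D" and R: "0 < R"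
  obtain u0 where u0: "u0 \<noteq> 0" "orthogonal e u0" using orthogonal_to_vector_exists[OF assms(1)] by blast
  define u where "u = u0 /\<^sub>R norm u0"
  have u: "norm u = 1" "u \<bullet> e = 0" using u0 by (auto simp: u_def orthogonal_def inner_commute)
  define z' where "z' = z + (3 * R) *\<^sub>R u"
  define S where "S = {y. - D \<le> (y - z') \<bullet> e \<and> (y - z') \<bullet> e < D} \<inter> ball z' (2 * R)"
  have "{y. - D \<le> (y - z') \<bullet> e \<and> (y - z') \<bullet> e < D} = {y. - D \<le> (y - z') \<bullet> e} \<inter> {y. (y - z') \<bullet> e < D}"
    by auto
  then have S: "S \<in> sets lebesgue" unfolding S_def by (auto intro!: sets.Int)
  then have Sf: "S \<in> fmeasurable lebesgue" using fmeasurable_Int_ball[OF S, of z' "2 * R"] by (simp add: S_def)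
  have "{y. - D \<le> (y - z) \<bullet> e \<and> (y - z) \<bullet> e < D} = {y. - D \<le> (y - z) \<bullet> e} \<inter> {y. (y - z) \<bullet> e < D}"
    by auto
  then have big: "{y. - D \<le> (y - z) \<bullet> e \<and> (y - z) \<bullet> e < D} - ball z R \<in> fmeasurable (frac_measure s z)"
    using assms R by (intro frac_measure_fmeasurable_far) (auto intro!: sets.Int)
  have inner: "(y - z') \<bullet> e = (y - z) \<bullet> e" for y
    by (simp add: z'_def inner_diff_left inner_add_left u)
  have far: "R < norm (y - z) \<and> norm (y - z) < 5 * R" if "y \<in> S" for y
  proof -
    have "norm (y - z') < 2 * R" using that by (simp add: S_def dist_norm norm_minus_commute)
    moreover have "norm (z' - z) = 3 * R" using R u by (simp add: z'_def)
    moreover have "norm (y - z) \<le> norm (y - z') + norm (z' - z)"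
      using norm_triangle_ineq[of "y - z'" "z' - z"] by simp
    moreover have "norm (z' - z) \<le> norm (y - z) + norm (y - z')"
      using norm_triangle_ineq[of "y - z" "z' - y"] by (simp add: norm_minus_commute)
    ultimately show ?thesis by linarith
  qed
  have sub: "S \<subseteq> {y. - D \<le> (y - z) \<bullet> e \<and> (y - z) \<bullet> e < D} - ball z R"
    using far by (fastforce simp: S_def inner dist_norm norm_minus_commute)
  have "c * min (D / R) 1 * R powr - s = (5 * R) powr - (real DIM('a) + s) * (?V / (3 * 2 ^ DIM('a)) * min (D / R) 1 * R ^ DIM('a))"
  proof -
    have "(5 * R) powr - (real DIM('a) + s) * R ^ DIM('a) = 5 powr - (real DIM('a) + s) * (R powr - (real DIM('a) + s) * R ^ DIM('a))"
      using R by (simp add: powr_mult)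
    also have "R powr - (real DIM('a) + s) * R ^ DIM('a) = R powr - s"
      using R powr_add[of R "- (real DIM('a) + s)" "real DIM('a)"] powr_realpow[of R "DIM('a)"] by simp
    finally show ?thesis by (simp add: c_def mult_ac)
  qed
  also have "\<dots> \<le> (5 * R) powr - (real DIM('a) + s) * measure lebesgue S"
    unfolding S_def using D R e by (intro mult_left_mono measure_slab_ge) auto
  also have "\<dots> \<le> measure (frac_measure s z) S"
  proof -
    have "ennreal ((5 * R) powr - (real DIM('a) + s)) * emeasure lebesgue S \<le> emeasure (frac_measure s z) S"
      using far R assms by (intro emeasure_frac_measure_ge[OF S]) (force simp: norm_minus_commute)+
    moreover have "S \<in> fmeasurable (frac_measure s z)"
      using sub big S by (auto intro: fmeasurableI2)
    ultimately show ?thesis using Sf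
      by (simp add: emeasure_eq_measure2 ennreal_mult[symmetric])
  qed
  also have "\<dots> \<le> measure (frac_measure s z) ({y. - D \<le> (y - z) \<bullet> e \<and> (y - z) \<bullet> e < D} - ball z R)"
    using sub big S by (intro measure_mono_fmeasurable) auto
  finally show "c * min (D / R) 1 * R powr - s
       \<le> measure (frac_measure s z) ({y. - D \<le> (y - z) \<bullet> e \<and> (y - z) \<bullet> e < D} - ball z R)" .
qed

section \<open>Normalized representatives\<close>

lemma measure_Int_ball_le:
  fixes x :: "'a::euclidean_space"
  assumes "F \<in> sets lebesgue"
  shows "measure lebesgue (F \<inter> ball x r) \<le> measure lebesgue (ball x r)"
  using assms by (intro measure_mono_fmeasurable sets.Int) auto

text \<open>\<open>measure\<close> also vanishes on sets of infinite measure; inside a ball this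
  cannot happen, so measure zero really means null.\<close>

lemma mt_exterior_iff:
  fixes F :: "'a::euclidean_space set"
  assumes "F \<in> sets lebesgue"
  shows "x \<in> mt_exterior F \<longleftrightarrow> (\<exists>r>0. F \<inter> ball x r \<in> null_sets lebesgue)"
proof -
  have "F \<inter> ball x r \<in> fmeasurable lebesgue" for r using assms by blast
  then have "measure lebesgue (F \<inter> ball x r) = 0 \<longleftrightarrow> F \<inter> ball x r \<in> null_sets lebesgue" for r
    by (simp add: null_sets_def fmeasurableD emeasure_eq_measure2)
  then show ?thesis unfolding mt_exterior_def by auto
qed

lemma mt_interior_iff:
  fixes F :: "'a::euclidean_space set"
  assumes "F \<in> sets lebesgue"
  shows "x \<in> mt_interior F \<longleftrightarrow> (\<exists>r>0. ball x r - F \<in> null_sets lebesgue)"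
proof -
  have "measure lebesgue (F \<inter> ball x r) = measure lebesgue (ball x r) \<longleftrightarrow> ball x r - F \<in> null_sets lebesgue" for r
  proof -
    have fm: "ball x r - F \<in> fmeasurable lebesgue"
      using assms by (intro fmeasurable_Diff) auto
    have "measure lebesgue (ball x r - (F \<inter> ball x r)) = measure lebesgue (ball x r) - measure lebesgue (F \<inter> ball x r)"
      using assms by (intro measurable_measure_Diff sets.Int) auto
    moreover have "ball x r - (F \<inter> ball x r) = ball x r - F" by auto
    ultimately have "measure lebesgue (ball x r - F) = measure lebesgue (ball x r) - measure lebesgue (F \<inter> ball x r)"
      by metis
    moreover have "measure lebesgue (ball x r - F) = 0 \<longleftrightarrow> ball x r - F \<in> null_sets lebesgue"
      using fm by (simp add: null_sets_def fmeasurableD emeasure_eq_measure2)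
    ultimately show ?thesis by linarith
  qed
  then show ?thesis unfolding mt_interior_def by auto
qed

lemma mt_interior_Compl:
  fixes F :: "'a::euclidean_space set"
  assumes "F \<in> sets lebesgue"
  shows "mt_interior (- F) = mt_exterior F" "mt_exterior (- F) = mt_interior F"
proof -
  have "ball x r - - F = F \<inter> ball x r" "- F \<inter> ball x r = ball x r - F" for x :: 'a and r by auto
  then show "mt_interior (- F) = mt_exterior F" "mt_exterior (- F) = mt_interior F"
    using assms by (auto simp: mt_interior_iff mt_exterior_iff)
qed

lemma mt_boundary_eq:
  fixes F :: "'a::euclidean_space set"
  assumes "F \<in> sets lebesgue"
  shows "mt_boundary F = - (mt_interior F \<union> mt_exterior F)"
  unfolding mt_boundary_def mt_interior_def mt_exterior_def
  using measure_Int_ball_le[OF assms] by (auto simp: less_le zero_less_measure_iff)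

lemma normalized_Compl:
  fixes F :: "'a::euclidean_space set"
  assumes "normalized F"
  shows "normalized (- F)"
  using assms mt_boundary_eq[of F] mt_boundary_eq[of "- F"]
  unfolding normalized_def by (auto simp: mt_interior_Compl frontier_complement)

lemma open_mt_exterior:
  fixes F :: "'a::euclidean_space set"
  assumes F: "F \<in> sets lebesgue"
  shows "open (mt_exterior F)"
  unfolding open_contains_ball
proof
  fix x assume "x \<in> mt_exterior F"
  then obtain r where r: "0 < r" "F \<inter> ball x r \<in> null_sets lebesgue"
    using mt_exterior_iff[OF F] by blast
  have "ball x r \<subseteq> mt_exterior F"
  proof
    fix y assume y: "y \<in> ball x r"
    then obtain e where e: "0 < e" "ball y e \<subseteq> ball x r" by (meson open_ball open_contains_ball)
    have "F \<inter> ball y e \<in> null_sets lebesgue"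
      by (rule null_sets_subset[OF r(2)]) (use F e in \<open>auto intro!: sets.Int\<close>)
    then show "y \<in> mt_exterior F" using mt_exterior_iff[OF F] e by blast
  qed
  then show "\<exists>e>0. ball x e \<subseteq> mt_exterior F" using r by blast
qed

lemma open_mt_interior:
  fixes F :: "'a::euclidean_space set"
  assumes "F \<in> sets lebesgue"
  shows "open (mt_interior F)"
  using open_mt_exterior[of "- F"] assms by (simp add: mt_interior_Compl)

text \<open>Each point of the exterior has a ball that meets \<open>F\<close> in a null set, and
  negligibility is a local property.\<close>

lemma null_sets_Int_mt_exterior:
  fixes F :: "'a::euclidean_space set"
  assumes F: "F \<in> sets lebesgue"
  shows "F \<inter> mt_exterior F \<in> null_sets lebesgue"
  unfolding negligible_iff_null_sets[symmetric]
proof (subst locally_negligible_alt, intro ballI)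
  fix x assume x: "x \<in> F \<inter> mt_exterior F"
  then obtain r where r: "0 < r" "F \<inter> ball x r \<in> null_sets lebesgue"
    using mt_exterior_iff[OF F] by blast
  show "\<exists>U. openin (top_of_set (F \<inter> mt_exterior F)) U \<and> x \<in> U \<and> negligible U"
  proof (intro exI conjI)
    show "openin (top_of_set (F \<inter> mt_exterior F)) ((F \<inter> mt_exterior F) \<inter> ball x r)"
      by (simp add: openin_open_Int)
    show "negligible ((F \<inter> mt_exterior F) \<inter> ball x r)"
      by (rule negligible_subset[of "F \<inter> ball x r"]) (use r in \<open>auto simp: negligible_iff_null_sets\<close>)
  qed (use x r in auto)
qed

lemma mt_interior_Diff_null:
  fixes F :: "'a::euclidean_space set"
  assumes "F \<in> sets lebesgue"
  shows "mt_interior F - F \<in> null_sets lebesgue"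
proof -
  have "mt_interior F - F = - F \<inter> mt_exterior (- F)" using assms by (auto simp: mt_interior_Compl)
  then show ?thesis using null_sets_Int_mt_exterior[of "- F"] assms by simp
qed

lemma mt_exterior_mono_ae:
  fixes A B :: "'a::euclidean_space set"
  assumes "A \<in> sets lebesgue" "B \<in> sets lebesgue" "ae_subset A B"
  shows "mt_exterior B \<subseteq> mt_exterior A"
proof
  fix x assume "x \<in> mt_exterior B"
  then obtain r where r: "0 < r" "B \<inter> ball x r \<in> null_sets lebesgue" using mt_exterior_iff assms by blast
  have "A \<inter> ball x r \<in> null_sets lebesgue"
    by (rule null_sets_subset[OF null_sets.Un[OF r(2)]])
      (use assms in \<open>auto simp: ae_subset_def intro!: sets.Int\<close>)
  then show "x \<in> mt_exterior A" using mt_exterior_iff assms r by blast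
qed

lemma mt_interior_mono_ae:
  fixes A B :: "'a::euclidean_space set"
  assumes "A \<in> sets lebesgue" "B \<in> sets lebesgue" "ae_subset A B"
  shows "mt_interior A \<subseteq> mt_interior B"
proof -
  have "- B - - A = A - B" by auto
  then show ?thesis using mt_exterior_mono_ae[of "- B" "- A"] assms
    by (simp add: mt_interior_Compl ae_subset_def)
qed

text \<open>Test sets can be glued together without regard to null sets and normalized afterwards by
  this operation.\<close>

definition mt_rep :: "'a::euclidean_space set \<Rightarrow> 'a set" where
  "mt_rep F = (F \<union> mt_interior F) - mt_exterior F"

text \<open>The set agrees almost everywhere with \<open>F\<close>, so both have the same measure
  theoretic interior and exterior. These are disjoint and open; by construction they become the
  topological interiors of the new set and of its complement, so the frontier is what is
  left.\<close>

lemma mt_rep: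
  fixes F :: "'a::euclidean_space set"
  assumes F: "F \<in> sets lebesgue"
  shows "mt_rep F \<in> sets lebesgue" "ae_subset F (mt_rep F)" "ae_subset (mt_rep F) F"
    and "frontier (mt_rep F) = mt_boundary F" "normalized (mt_rep F)"
proof -
  note io = open_mt_interior[OF F] open_mt_exterior[OF F]
  show m: "mt_rep F \<in> sets lebesgue"
    unfolding mt_rep_def using F open_sets_lebesgue[OF io(1)] open_sets_lebesgue[OF io(2)] by (intro sets.Diff sets.Un)
  have "F - mt_rep F \<subseteq> F \<inter> mt_exterior F" "mt_rep F - F \<subseteq> mt_interior F - F" by (auto simp: mt_rep_def)
  then show ae: "ae_subset F (mt_rep F)" "ae_subset (mt_rep F) F"
    unfolding ae_subset_def
    using null_sets_subset[OF null_sets_Int_mt_exterior[OF F]] null_sets_subset[OF mt_interior_Diff_null[OF F]] m F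
    by (auto intro: sets.Diff)
  have int: "mt_interior (mt_rep F) = mt_interior F" and ext: "mt_exterior (mt_rep F) = mt_exterior F"
    using mt_interior_mono_ae mt_exterior_mono_ae ae m F by blast+
  have disj: "mt_interior F \<inter> mt_exterior F = {}"
    unfolding mt_interior_def mt_exterior_def
  proof (safe)
    fix x :: 'a and r t :: real
    assume a: "measure lebesgue (F \<inter> ball x r) = measure lebesgue (ball x r)" "0 < r"
      "measure lebesgue (F \<inter> ball x t) = 0" "0 < t"
    then have "x \<in> mt_interior F" "x \<in> mt_exterior F" by (auto simp: mt_interior_def mt_exterior_def)
    then obtain u v where u: "0 < u" "ball x u - F \<in> null_sets lebesgue" "0 < v" "F \<inter> ball x v \<in> null_sets lebesgue"
      using mt_interior_iff[OF F] mt_exterior_iff[OF F] by meson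
    have "ball x (min u v) \<in> null_sets lebesgue"
      by (rule null_sets_subset[OF null_sets.Un[OF u(2,4)]]) auto
    then have "measure lebesgue (ball x (min u v)) = 0" by (simp add: measure_eq_0_null_sets)
    then show "x \<in> {}" using u by simp
  qed
  have bd: "mt_boundary (mt_rep F) = mt_boundary F" using mt_boundary_eq m F int ext by metis
  have "frontier (mt_rep F) = - (interior (mt_rep F) \<union> interior (- mt_rep F))"
    by (auto simp: frontier_def closure_interior)
  also have "interior (mt_rep F) = mt_interior F"
  proof
    show "mt_interior F \<subseteq> interior (mt_rep F)"
      using io disj by (intro interior_maximal) (auto simp: mt_rep_def)
    show "interior (mt_rep F) \<subseteq> mt_interior F"
    proof
      fix x assume "x \<in> interior (mt_rep F)"
      then obtain e where "0 < e" "ball x e \<subseteq> mt_rep F" by (meson mem_interior)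
      then have "ball x e - mt_rep F = {}" by auto
      then have "ball x e - mt_rep F \<in> null_sets lebesgue" by (simp only: null_sets.empty_sets)
      then have "x \<in> mt_interior (mt_rep F)" using mt_interior_iff[OF m] \<open>0 < e\<close> by blast
      then show "x \<in> mt_interior F" by (simp add: int)
    qed
  qed
  also have "interior (- mt_rep F) = mt_exterior F"
  proof
    show "mt_exterior F \<subseteq> interior (- mt_rep F)"
      using io by (intro interior_maximal) (auto simp: mt_rep_def)
    show "interior (- mt_rep F) \<subseteq> mt_exterior F"
    proof
      fix x assume "x \<in> interior (- mt_rep F)"
      then obtain e where "0 < e" "ball x e \<subseteq> - mt_rep F" by (meson mem_interior)
      then have "mt_rep F \<inter> ball x e = {}" by auto
      then have "mt_rep F \<inter> ball x e \<in> null_sets lebesgue" by (simp only: null_sets.empty_sets)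
      then have "x \<in> mt_exterior (mt_rep F)" using mt_exterior_iff[OF m] \<open>0 < e\<close> by blast
      then show "x \<in> mt_exterior F" by (simp add: ext)
    qed
  qed
  finally show fr: "frontier (mt_rep F) = mt_boundary F" by (simp add: mt_boundary_eq[OF F])
  show "normalized (mt_rep F)"
    unfolding normalized_def fr bd int ext using m disj by (auto simp: mt_rep_def)
qed

section \<open>Paraboloids as test sets\<close>

text \<open>The difference of squares is the squared length of the part of \<open>y - z\<close>
  tangential to the plane with normal \<nu>. The coefficient \<open>1 / r\<close> is twice that of
  the paraboloid osculating a sphere of radius \<open>r\<close>; this extra bending puts the set
  inside the touching ball near \<open>z\<close>.\<close>

definition paraboloid :: "'a::euclidean_space \<Rightarrow> 'a \<Rightarrow> real \<Rightarrow> 'a set" where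
  "paraboloid z \<nu> r = {y. (y - z) \<bullet> \<nu> + ((norm (y - z))\<^sup>2 - ((y - z) \<bullet> \<nu>)\<^sup>2) / r < 0}"

lemma open_paraboloid: "open (paraboloid z \<nu> r)"
  unfolding paraboloid_def divide_inverse by (intro open_Collect_less continuous_intros)

lemma tangential_nonneg:
  fixes w \<nu> :: "'a::euclidean_space"
  assumes "norm \<nu> = 1"
  shows "0 \<le> (norm w)\<^sup>2 - (w \<bullet> \<nu>)\<^sup>2"
  using Cauchy_Schwarz_ineq[of w \<nu>] assms by (simp add: power2_norm_eq_inner norm_eq_1)

text \<open>Moving along \<nu> does not change the tangential part. Later uses apply this as
  Pythagoras' theorem with \<open>e\<close> in the role of \<nu>.\<close>

lemma tangential_shift:
  fixes w \<nu> :: "'a::euclidean_space"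
  assumes "norm \<nu> = 1"
  shows "(norm (w + t *\<^sub>R \<nu>))\<^sup>2 - ((w + t *\<^sub>R \<nu>) \<bullet> \<nu>)\<^sup>2 = (norm w)\<^sup>2 - (w \<bullet> \<nu>)\<^sup>2"
proof -
  have "\<nu> \<bullet> \<nu> = 1" using assms by (simp add: norm_eq_1)
  then have "(norm (w + t *\<^sub>R \<nu>))\<^sup>2 = (norm w)\<^sup>2 + 2 * t * (w \<bullet> \<nu>) + t\<^sup>2"
    "((w + t *\<^sub>R \<nu>) \<bullet> \<nu>)\<^sup>2 = (w \<bullet> \<nu> + t)\<^sup>2"
    unfolding power2_norm_eq_inner
    by (simp_all add: inner_add_left inner_add_right inner_commute[of \<nu> w] power2_eq_square distrib_left)
  then show ?thesis by (simp add: power2_sum)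
qed

lemma paraboloid_subset_halfspace:
  fixes z \<nu> :: "'a::euclidean_space"
  assumes "norm \<nu> = 1" "0 < r"
  shows "paraboloid z \<nu> r \<subseteq> {y. (y - z) \<bullet> \<nu> < 0}"
proof
  fix y assume "y \<in> paraboloid z \<nu> r"
  moreover have "0 \<le> ((norm (y - z))\<^sup>2 - ((y - z) \<bullet> \<nu>)\<^sup>2) / r"
    using tangential_nonneg[OF assms(1)] assms by simp
  ultimately show "y \<in> {y. (y - z) \<bullet> \<nu> < 0}" by (simp add: paraboloid_def)
qed

text \<open>With \<open>w = y - z\<close>, multiply the defining inequality by \<open>r\<close> and
  add \<open>(w \<bullet> \<nu>) * (r + w \<bullet> \<nu>) < 0\<close>, valid because
  \<open>- r < w \<bullet> \<nu> < 0\<close>. The result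
  \<open>2 * r * (w \<bullet> \<nu>) + (norm w)\<^sup>2 < 0\<close> says that \<open>y\<close> lies
  in the ball.\<close>

lemma paraboloid_subset_ball:
  fixes z \<nu> :: "'a::euclidean_space"
  assumes "norm \<nu> = 1" "0 < r"
  shows "paraboloid z \<nu> r \<inter> ball z r \<subseteq> ball (z - r *\<^sub>R \<nu>) r"
proof
  fix y assume y: "y \<in> paraboloid z \<nu> r \<inter> ball z r"
  define w where "w = y - z"
  have nn: "\<nu> \<bullet> \<nu> = 1" using assms by (simp add: norm_eq_1)
  have neg: "w \<bullet> \<nu> < 0" using paraboloid_subset_halfspace[OF assms] y by (auto simp: w_def)
  have "norm w < r" using y by (simp add: w_def dist_norm norm_minus_commute)
  then have "- r < w \<bullet> \<nu>" using Cauchy_Schwarz_ineq2[of w \<nu>] assms by simp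
  then have "(w \<bullet> \<nu>) * (r + w \<bullet> \<nu>) < 0" using neg by (intro mult_neg_pos) auto
  moreover have "r * (w \<bullet> \<nu>) + ((norm w)\<^sup>2 - (w \<bullet> \<nu>)\<^sup>2) < 0"
  proof -
    have "w \<bullet> \<nu> + ((norm w)\<^sup>2 - (w \<bullet> \<nu>)\<^sup>2) / r < 0" using y by (simp add: paraboloid_def w_def)
    then have "r * (w \<bullet> \<nu> + ((norm w)\<^sup>2 - (w \<bullet> \<nu>)\<^sup>2) / r) < 0" using assms by (intro mult_pos_neg)
    then show ?thesis using assms by (simp add: distrib_left)
  qed
  ultimately have "2 * r * (w \<bullet> \<nu>) + (norm w)\<^sup>2 < 0" by (simp add: power2_eq_square algebra_simps)
  moreover have "(norm (w + r *\<^sub>R \<nu>))\<^sup>2 = (norm w)\<^sup>2 + 2 * r * (w \<bullet> \<nu>) + r\<^sup>2"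
  proof -
    have "(w + r *\<^sub>R \<nu>) \<bullet> \<nu> = w \<bullet> \<nu> + r" by (simp add: inner_add_left nn)
    then have "(norm (w + r *\<^sub>R \<nu>))\<^sup>2 - (w \<bullet> \<nu> + r)\<^sup>2 = (norm w)\<^sup>2 - (w \<bullet> \<nu>)\<^sup>2"
      using tangential_shift[OF assms(1), of w r] by metis
    then show ?thesis by (simp only: power2_sum) (simp add: algebra_simps)
  qed
  ultimately have "(norm (w + r *\<^sub>R \<nu>))\<^sup>2 < r\<^sup>2" by linarith
  then have "norm (w + r *\<^sub>R \<nu>) < r" using assms by (simp add: power_less_imp_less_base)
  moreover have "norm (w + r *\<^sub>R \<nu>) = dist (z - r *\<^sub>R \<nu>) y"
  proof -
    have "y - (z - r *\<^sub>R \<nu>) = w + r *\<^sub>R \<nu>" by (simp add: w_def)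
    then show ?thesis by (metis dist_commute dist_norm)
  qed
  ultimately show "y \<in> ball (z - r *\<^sub>R \<nu>) r" by simp
qed

text \<open>The defining function grows with unit speed along \<nu>. Hence at each of its zeros both
  signs occur arbitrarily near, on nonempty open and therefore non-null sets.\<close>

lemma mt_boundary_paraboloid:
  fixes z \<nu> :: "'a::euclidean_space"
  assumes "norm \<nu> = 1" "0 < r" "0 < \<delta>" and F: "F \<in> sets lebesgue" "F \<inter> ball z \<delta> = paraboloid z \<nu> r \<inter> ball z \<delta>"
  shows "mt_boundary F \<inter> ball z \<delta> =
    {y \<in> ball z \<delta>. (y - z) \<bullet> \<nu> + ((norm (y - z))\<^sup>2 - ((y - z) \<bullet> \<nu>)\<^sup>2) / r = 0}"
proof -
  define \<phi> where "\<phi> y = (y - z) \<bullet> \<nu> + ((norm (y - z))\<^sup>2 - ((y - z) \<bullet> \<nu>)\<^sup>2) / r" for y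
  have nn: "\<nu> \<bullet> \<nu> = 1" using assms by (simp add: norm_eq_1)
  have cont: "continuous_on UNIV \<phi>" unfolding \<phi>_def divide_inverse by (intro continuous_intros)
  have shift: "\<phi> (y + t *\<^sub>R \<nu>) = \<phi> y + t" for y t
  proof -
    have e: "y + t *\<^sub>R \<nu> - z = (y - z) + t *\<^sub>R \<nu>" by simp
    have "(norm (y + t *\<^sub>R \<nu> - z))\<^sup>2 - ((y + t *\<^sub>R \<nu> - z) \<bullet> \<nu>)\<^sup>2 = (norm (y - z))\<^sup>2 - ((y - z) \<bullet> \<nu>)\<^sup>2"
      unfolding e by (rule tangential_shift[OF assms(1)])
    then show ?thesis unfolding \<phi>_def e by (simp add: inner_add_left nn)
  qed
  have on: "open {y \<in> ball z \<delta>. \<phi> y < 0}" "open {y \<in> ball z \<delta>. 0 < \<phi> y}"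
    using open_Int[OF open_ball open_Collect_less[OF cont continuous_on_const[of UNIV 0]], of z \<delta>]
      open_Int[OF open_ball open_Collect_less[OF continuous_on_const[of UNIV 0] cont], of z \<delta>]
    by (simp_all only: Int_def mem_Collect_eq)
  have inF: "y \<in> F \<longleftrightarrow> \<phi> y < 0" if "y \<in> ball z \<delta>" for y
    using that F(2) unfolding paraboloid_def \<phi>_def by blast
  have "{y \<in> ball z \<delta>. \<phi> y < 0} \<subseteq> mt_interior F"
  proof
    fix y assume "y \<in> {y \<in> ball z \<delta>. \<phi> y < 0}"
    then obtain e where e: "0 < e" "ball y e \<subseteq> {y \<in> ball z \<delta>. \<phi> y < 0}" using on(1) open_contains_ball by blast
    then have "ball y e - F = {}" using inF by blast
    then have "ball y e - F \<in> null_sets lebesgue" by (simp only: null_sets.empty_sets)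
    then show "y \<in> mt_interior F" using mt_interior_iff[OF F(1)] e by blast
  qed
  moreover have "{y \<in> ball z \<delta>. 0 < \<phi> y} \<subseteq> mt_exterior F"
  proof
    fix y assume "y \<in> {y \<in> ball z \<delta>. 0 < \<phi> y}"
    then obtain e where e: "0 < e" "ball y e \<subseteq> {y \<in> ball z \<delta>. 0 < \<phi> y}" using on(2) open_contains_ball by blast
    then have "F \<inter> ball y e = {}" using inF by force
    then have "F \<inter> ball y e \<in> null_sets lebesgue" by (simp only: null_sets.empty_sets)
    then show "y \<in> mt_exterior F" using mt_exterior_iff[OF F(1)] e by blast
  qed
  moreover have "y \<notin> mt_interior F \<and> y \<notin> mt_exterior F" if y: "y \<in> ball z \<delta>" "\<phi> y = 0" for y
  proof -
    have nonnull: "U \<notin> null_sets lebesgue" if "open U" "U \<noteq> {}" for U :: "'a set"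
      using that open_not_negligible negligible_iff_null_sets by blast
    have near: "\<exists>t>0. y + t *\<^sub>R \<nu> \<in> ball y e \<inter> ball z \<delta> \<and> y + (- t) *\<^sub>R \<nu> \<in> ball y e \<inter> ball z \<delta>" if "0 < e" for e
    proof -
      have "open (ball y e \<inter> ball z \<delta>)" "y \<in> ball y e \<inter> ball z \<delta>" using y that by auto
      then obtain e' where e': "0 < e'" "ball y e' \<subseteq> ball y e \<inter> ball z \<delta>" by (rule openE)
      have "y + (e' / 2) *\<^sub>R \<nu> \<in> ball y e'" "y + (- (e' / 2)) *\<^sub>R \<nu> \<in> ball y e'"
        using e'(1) assms(1) by (auto simp: dist_norm)
      from this[THEN subsetD[OF e'(2)]] show ?thesis using e'(1) by (intro exI[of _ "e' / 2"] conjI) auto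
    qed
    have "y \<notin> mt_interior F"
    proof
      assume "y \<in> mt_interior F"
      then obtain e where e: "0 < e" "ball y e - F \<in> null_sets lebesgue" using mt_interior_iff[OF F(1)] by blast
      obtain t where t: "0 < t" "y + t *\<^sub>R \<nu> \<in> ball y e \<inter> ball z \<delta>" using near[OF e(1)] by blast
      have "open (ball y e \<inter> {y \<in> ball z \<delta>. 0 < \<phi> y})" using on by (intro open_Int) auto
      moreover have "y + t *\<^sub>R \<nu> \<in> ball y e \<inter> {y \<in> ball z \<delta>. 0 < \<phi> y}" using t shift y by simp
      moreover have "ball y e \<inter> {y \<in> ball z \<delta>. 0 < \<phi> y} \<subseteq> ball y e - F" using inF by force
      ultimately show False
        using nonnull null_sets_subset[OF e(2)] open_sets_lebesgue by blast
    qed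
    moreover have "y \<notin> mt_exterior F"
    proof
      assume "y \<in> mt_exterior F"
      then obtain e where e: "0 < e" "F \<inter> ball y e \<in> null_sets lebesgue" using mt_exterior_iff[OF F(1)] by blast
      obtain t where t: "0 < t" "y + (- t) *\<^sub>R \<nu> \<in> ball y e \<inter> ball z \<delta>" using near[OF e(1)] by blast
      have "open (ball y e \<inter> {y \<in> ball z \<delta>. \<phi> y < 0})" using on by (intro open_Int) auto
      moreover have "y + (- t) *\<^sub>R \<nu> \<in> ball y e \<inter> {y \<in> ball z \<delta>. \<phi> y < 0}" using t shift[of y "- t"] y by simp
      moreover have "ball y e \<inter> {y \<in> ball z \<delta>. \<phi> y < 0} \<subseteq> F \<inter> ball y e" using inF by force
      ultimately show False
        using nonnull null_sets_subset[OF e(2)] open_sets_lebesgue by blast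
    qed
    ultimately show ?thesis by blast
  qed
  moreover have "y \<in> {y \<in> ball z \<delta>. \<phi> y < 0} \<or> y \<in> {y \<in> ball z \<delta>. 0 < \<phi> y} \<or> \<phi> y = 0"
    if "y \<in> ball z \<delta>" for y using that by auto
  ultimately have "mt_boundary F \<inter> ball z \<delta> = {y \<in> ball z \<delta>. \<phi> y = 0}"
    unfolding mt_boundary_eq[OF F(1)] by blast
  then show ?thesis by (simp only: \<phi>_def)
qed

text \<open>Solved for \<open>y \<bullet> \<nu>\<close>, the equation exhibits a quadratic
  polynomial in the tangential variable, centred at the projection \<open>p\<close> of
  \<open>z\<close>; its second derivatives are constant.\<close>

lemma Ck_hypersurface_near_paraboloid:
  fixes z \<nu> :: "'a::euclidean_space"
  assumes "norm \<nu> = 1" "0 < r" "0 < \<delta>"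
    and M: "M \<inter> ball z \<delta> = {y \<in> ball z \<delta>. (y - z) \<bullet> \<nu> + ((norm (y - z))\<^sup>2 - ((y - z) \<bullet> \<nu>)\<^sup>2) / r = 0}"
  shows "Ck_hypersurface_near 2 M z"
proof -
  define p where "p = z - (z \<bullet> \<nu>) *\<^sub>R \<nu>"
  define g where "g x = z \<bullet> \<nu> - ((x - p) \<bullet> (x - p)) / r" for x
  have nn: "\<nu> \<bullet> \<nu> = 1" using assms by (simp add: norm_eq_1)
  have "GDERIV g x :> (- 2 / r) *\<^sub>R (x - p)" for x
    unfolding g_def gderiv_def using assms(2)
    by (auto intro!: derivative_eq_intros simp: inner_commute divide_inverse algebra_simps)
  moreover have "GDERIV (\<lambda>x. ((- 2 / r) *\<^sub>R (x - p)) \<bullet> b) x :> (- 2 / r) *\<^sub>R b" for x b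
    unfolding gderiv_def using assms(2)
    by (auto intro!: derivative_eq_intros simp: inner_commute)
  ultimately have ck: "Ck_on 2 g UNIV"
    unfolding numeral_2_eq_2 Ck_on.simps
    by (intro exI[of _ "\<lambda>x. (- 2 / r) *\<^sub>R (x - p)"] conjI ballI exI[of _ "\<lambda>_. (- 2 / r) *\<^sub>R b" for b])
      (assumption | rule continuous_on_const | blast)+
  have key: "((y - z) \<bullet> \<nu> + ((norm (y - z))\<^sup>2 - ((y - z) \<bullet> \<nu>)\<^sup>2) / r = 0) \<longleftrightarrow> y \<bullet> \<nu> = g (y - (y \<bullet> \<nu>) *\<^sub>R \<nu>)" for y
  proof -
    define w where "w = y - z"
    have e: "y - (y \<bullet> \<nu>) *\<^sub>R \<nu> - p = w - (w \<bullet> \<nu>) *\<^sub>R \<nu>"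
      by (simp add: p_def w_def inner_diff_left algebra_simps)
    have "(w - (w \<bullet> \<nu>) *\<^sub>R \<nu>) \<bullet> \<nu> = 0" by (simp add: inner_diff_left nn)
    then have "(y - (y \<bullet> \<nu>) *\<^sub>R \<nu> - p) \<bullet> (y - (y \<bullet> \<nu>) *\<^sub>R \<nu> - p) = (norm w)\<^sup>2 - (w \<bullet> \<nu>)\<^sup>2"
      unfolding e using tangential_shift[OF assms(1), of w "- (w \<bullet> \<nu>)"] by (simp add: power2_norm_eq_inner)
    then have "g (y - (y \<bullet> \<nu>) *\<^sub>R \<nu>) = z \<bullet> \<nu> - ((norm w)\<^sup>2 - (w \<bullet> \<nu>)\<^sup>2) / r"
      by (simp only: g_def)
    moreover have "y \<bullet> \<nu> = w \<bullet> \<nu> + z \<bullet> \<nu>" by (simp add: w_def inner_diff_left)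
    ultimately show ?thesis unfolding w_def by linarith
  qed
  show ?thesis unfolding Ck_hypersurface_near_def
    using ck M assms by (intro exI[of _ "ball z \<delta>"] exI[of _ \<nu>] exI[of _ g]) (simp add: key)
qed

section \<open>The contact inequality\<close>

text \<open>The disjunction makes both viscosity inequalities instances of this notion, the second one
  for the complement; it is harmless because the two curvatures are opposite to each other
  whenever the principal value exists.\<close>

definition supersolution_at :: "real \<Rightarrow> 'a::euclidean_space set \<Rightarrow> 'a \<Rightarrow> bool" where
  "supersolution_at s G z \<longleftrightarrow>
     (\<forall>F. normalized F \<and> ae_subset F G \<and> z \<in> frontier F \<and> Ck_hypersurface_near 2 (frontier F) z \<longrightarrow>
        0 \<le> frac_mean_curv s F z \<or> frac_mean_curv s (- F) z \<le> 0)"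

lemma visc_nonneg_supersolution: "visc_nonneg_at s E z \<Longrightarrow> supersolution_at s E z"
  by (auto simp: visc_nonneg_at_def supersolution_at_def)

lemma visc_nonpos_supersolution:
  fixes E :: "'a::euclidean_space set"
  assumes "visc_nonpos_at s E z"
  shows "supersolution_at s (- E) z"
  unfolding supersolution_at_def
proof (intro allI impI disjI2)
  fix F :: "'a set"
  assume F: "normalized F \<and> ae_subset F (- E) \<and> z \<in> frontier F \<and> Ck_hypersurface_near 2 (frontier F) z"
  have "E - - F = F - - E" by auto
  then have "ae_subset E (- F)" using F by (simp add: ae_subset_def)
  moreover have "normalized (- F)" using F normalized_Compl by blast
  ultimately show "frac_mean_curv s (- F) z \<le> 0"
    using F assms by (simp add: visc_nonpos_at_def frontier_complement)
qed

text \<open>Within distance \<open>t\<close> of \<open>z\<close> the gap lies in a slab of width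
  \<open>t\<^sup>2 / r\<close>. This gives the extra power of \<open>t\<close> that makes the
  singular weight integrable at the contact point.\<close>

lemma measure_halfspace_Diff_paraboloid:
  fixes z \<nu> :: "'a::euclidean_space"
  assumes \<nu>: "norm \<nu> = 1" and r: "0 < r" and t: "0 < t"
  shows "measure lebesgue (({y. (y - z) \<bullet> \<nu> < 0} - paraboloid z \<nu> r) \<inter> ball z t)
    \<le> 2 ^ (DIM('a) + 1) * unit_ball_vol (real DIM('a)) / r * t ^ (DIM('a) + 1)"
proof -
  have h: "0 < t\<^sup>2 / r" using r t by simp
  let ?S = "{y. z \<bullet> \<nu> - t\<^sup>2 / r \<le> y \<bullet> \<nu> \<and> y \<bullet> \<nu> < (z \<bullet> \<nu> - t\<^sup>2 / r) + t\<^sup>2 / r}"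
  have eq: "?S = {y. z \<bullet> \<nu> - t\<^sup>2 / r \<le> y \<bullet> \<nu>} \<inter> {y. y \<bullet> \<nu> < (z \<bullet> \<nu> - t\<^sup>2 / r) + t\<^sup>2 / r}" by auto
  have "measure lebesgue (({y. (y - z) \<bullet> \<nu> < 0} - paraboloid z \<nu> r) \<inter> ball z t)
     \<le> measure lebesgue (?S \<inter> ball z t)"
  proof (rule measure_mono_fmeasurable)
    show "({y. (y - z) \<bullet> \<nu> < 0} - paraboloid z \<nu> r) \<inter> ball z t \<subseteq> ?S \<inter> ball z t"
    proof
      fix y assume y: "y \<in> ({y. (y - z) \<bullet> \<nu> < 0} - paraboloid z \<nu> r) \<inter> ball z t"
      have "norm (y - z) < t" using y by (simp add: dist_norm norm_minus_commute)
      then have "(norm (y - z))\<^sup>2 \<le> t\<^sup>2" by (intro power_mono) auto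
      moreover have "0 \<le> ((y - z) \<bullet> \<nu>)\<^sup>2" by simp
      ultimately have "(norm (y - z))\<^sup>2 - ((y - z) \<bullet> \<nu>)\<^sup>2 \<le> t\<^sup>2" by linarith
      then have "((norm (y - z))\<^sup>2 - ((y - z) \<bullet> \<nu>)\<^sup>2) / r \<le> t\<^sup>2 / r" using r by (simp add: divide_right_mono)
      moreover have "0 \<le> (y - z) \<bullet> \<nu> + ((norm (y - z))\<^sup>2 - ((y - z) \<bullet> \<nu>)\<^sup>2) / r" "(y - z) \<bullet> \<nu> < 0"
        using y by (auto simp: paraboloid_def)
      moreover have "(y - z) \<bullet> \<nu> = y \<bullet> \<nu> - z \<bullet> \<nu>" by (simp add: inner_diff_left)
      ultimately have "z \<bullet> \<nu> - t\<^sup>2 / r \<le> y \<bullet> \<nu>" "y \<bullet> \<nu> < (z \<bullet> \<nu> - t\<^sup>2 / r) + t\<^sup>2 / r" by linarith+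
      then show "y \<in> ?S \<inter> ball z t" using y by blast
    qed
    show "({y. (y - z) \<bullet> \<nu> < 0} - paraboloid z \<nu> r) \<inter> ball z t \<in> sets lebesgue"
      by (intro sets.Int sets.Diff sets_halfspaces open_sets_lebesgue open_paraboloid) auto
    have "?S \<in> sets lebesgue" unfolding eq by (intro sets.Int sets_halfspaces)
    then show "?S \<inter> ball z t \<in> fmeasurable lebesgue" by blast
  qed
  also have "\<dots> \<le> 2 ^ (DIM('a) + 1) * unit_ball_vol (real DIM('a)) * (t\<^sup>2 / r) * t ^ (DIM('a) - 1)"
    by (rule measure_slab_le[OF \<nu> h t])
  also have "t ^ (DIM('a) + 1) = t\<^sup>2 * t ^ (DIM('a) - 1)"
    using DIM_positive[where 'a='a] by (simp flip: power_add)
  then have "2 ^ (DIM('a) + 1) * unit_ball_vol (real DIM('a)) * (t\<^sup>2 / r) * t ^ (DIM('a) - 1)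
     = 2 ^ (DIM('a) + 1) * unit_ball_vol (real DIM('a)) / r * t ^ (DIM('a) + 1)"
    by (simp add: field_simps)
  finally show ?thesis .
qed

text \<open>The test set replaces \<open>G\<close> in a small ball around the contact point by a paraboloid
  inside the touching ball.\<close>

lemma contact_inequality_annulus:
  fixes z \<nu> :: "'a::euclidean_space"
  assumes s: "0 < s" "s < 1" and G: "G \<in> sets lebesgue" and super: "supersolution_at s G z"
    and \<nu>: "norm \<nu> = 1" and ballG: "ball (z - r *\<^sub>R \<nu>) r \<subseteq> G"
    and \<delta>: "0 < \<delta>" "\<delta> < \<rho>" "\<rho> \<le> r"
  defines "T \<equiv> {y. (y - z) \<bullet> \<nu> < 0}"
  shows "2 * measure (frac_measure s z) ((G - T) \<inter> ball z \<rho> - ball z \<delta>) + measure (frac_measure s z) (G - ball z \<rho>)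
    \<le> 2 * (2 powr (real DIM('a) + s) / (1 - 2 powr - (1 - s)) *
        (2 ^ (DIM('a) + 1) * unit_ball_vol (real DIM('a)) / r) * \<rho> powr (1 - s))
      + measure (frac_measure s z) (- G - ball z \<rho>)"
proof -
  let ?M = "frac_measure s z" and ?m = "measure (frac_measure s z)"
  define P where "P = paraboloid z \<nu> r"
  define F where "F = (G - ball z \<delta>) \<union> (P \<inter> ball z \<delta>)"
  have r: "0 < r" using \<delta> by simp
  have P: "P \<in> sets lebesgue" unfolding P_def by (intro open_sets_lebesgue open_paraboloid)
  have T: "T \<in> sets lebesgue" unfolding T_def by simp
  have F: "F \<in> sets lebesgue" unfolding F_def using G P by (intro sets.Un sets.Diff sets.Int) auto
  have PT: "P \<subseteq> T" unfolding P_def T_def by (rule paraboloid_subset_halfspace[OF \<nu> r])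
  have PG: "P \<inter> ball z \<rho> \<subseteq> G"
    using paraboloid_subset_ball[OF \<nu> r, of z] ballG \<delta> unfolding P_def by fastforce
  have TP: "(T - P) \<inter> ball z t \<in> fmeasurable ?M"
    "?m ((T - P) \<inter> ball z t) \<le> 2 powr (real DIM('a) + s) / (1 - 2 powr - (1 - s)) *
        (2 ^ (DIM('a) + 1) * unit_ball_vol (real DIM('a)) / r) * t powr (1 - s)" if "0 < t" for t
  proof -
    have *: "T - P \<in> sets lebesgue" "z \<notin> T - P" using T P by (auto simp: T_def intro: sets.Diff)
    have **: "0 \<le> 2 ^ (DIM('a) + 1) * unit_ball_vol (real DIM('a)) / r" using r by simp
    note measure_halfspace_Diff_paraboloid[OF \<nu> r, where z = z, folded T_def P_def]
    note near = frac_measure_near[OF *(1) s that ** *(2) this]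
    show "(T - P) \<inter> ball z t \<in> fmeasurable ?M"
      "?m ((T - P) \<inter> ball z t) \<le> 2 powr (real DIM('a) + s) / (1 - 2 powr - (1 - s)) *
        (2 ^ (DIM('a) + 1) * unit_ball_vol (real DIM('a)) / r) * t powr (1 - s)"
      by (rule near; assumption)+
  qed
  have far: "S - ball z t \<in> fmeasurable ?M" if "S \<in> sets lebesgue" "0 < t" for S t
    using frac_measure_fmeasurable_far[OF that(1) s(1) that(2)] .
  \<comment> \<open>Near \<open>z\<close> the set \<open>F\<close> is the paraboloid
    \<open>P\<close>, whose gap to \<open>T\<close> has finite mass; moreover \<open>P\<close> is
    contained in \<open>T\<close>, so \<open>F - T\<close> stays away from the singularity
    altogether.\<close>
  have fin1: "T - F \<in> fmeasurable ?M"
  proof (rule fmeasurableI2)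
    show "(T - P) \<inter> ball z \<delta> \<union> (T - ball z \<delta>) \<in> fmeasurable ?M"
      using TP(1) far T \<delta> by (intro fmeasurable.Un) auto
    show "T - F \<subseteq> (T - P) \<inter> ball z \<delta> \<union> (T - ball z \<delta>)" by (auto simp: F_def)
  qed (use T F in \<open>auto intro: sets.Diff\<close>)
  have fin2: "F - T \<in> fmeasurable ?M"
  proof (rule fmeasurableI2)
    show "F - ball z \<delta> \<in> fmeasurable ?M" using far F \<delta> by auto
    show "F - T \<subseteq> F - ball z \<delta>" using PT by (auto simp: F_def)
  qed (use T F in \<open>auto intro: sets.Diff\<close>)
  define F' where "F' = mt_rep F"
  note rep = mt_rep[OF F, folded F'_def]
  have bd: "frontier F' \<inter> ball z \<delta> = {y \<in> ball z \<delta>. (y - z) \<bullet> \<nu> + ((norm (y - z))\<^sup>2 - ((y - z) \<bullet> \<nu>)\<^sup>2) / r = 0}"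
    unfolding rep(4) using \<nu> r \<delta> F by (intro mt_boundary_paraboloid) (auto simp: F_def P_def)
  have "z \<in> frontier F' \<inter> ball z \<delta>" unfolding bd using \<delta> by simp
  moreover have "Ck_hypersurface_near 2 (frontier F') z"
    using Ck_hypersurface_near_paraboloid[OF \<nu> r \<delta>(1) bd] .
  moreover have "ae_subset F' G"
  proof -
    have "F - G = {}" using PG \<delta> by (auto simp: F_def)
    then have "F' - G \<subseteq> F' - F" by auto
    then show ?thesis
      using rep(3) null_sets_subset[of "F' - F" lebesgue "F' - G"] rep(1) G
      by (auto simp: ae_subset_def intro: sets.Diff)
  qed
  ultimately have curv: "0 \<le> frac_mean_curv s F' z \<or> frac_mean_curv s (- F') z \<le> 0"
    using super rep(5) unfolding supersolution_at_def by blast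
  have ae: "AE y in ?M. y \<in> F' \<longleftrightarrow> y \<in> F"
  proof (rule AE_I')
    show "(F - F') \<union> (F' - F) \<in> null_sets ?M"
      using rep(2,3) unfolding ae_subset_def by (intro null_sets_frac_measure null_sets.Un)
  qed auto
  have fin': "T - F' \<in> fmeasurable ?M" "?m (T - F') = ?m (T - F)"
    "F' - T \<in> fmeasurable ?M" "?m (F' - T) = ?m (F - T)"
  proof -
    have e: "emeasure ?M (T - F') = emeasure ?M (T - F)" "emeasure ?M (F' - T) = emeasure ?M (F - T)"
      by (rule emeasure_eq_AE; use ae T F rep(1) in \<open>auto intro: sets.Diff\<close>)+
    then show "T - F' \<in> fmeasurable ?M" "?m (T - F') = ?m (T - F)"
      "F' - T \<in> fmeasurable ?M" "?m (F' - T) = ?m (F - T)"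
      using fin1 fin2 T F rep(1) by (auto simp: fmeasurable_def measure_def intro: sets.Diff)
  qed
  have "\<nu> \<noteq> 0" using \<nu> by auto
  note eqs = frac_mean_curv_eq[OF rep(1) \<open>\<nu> \<noteq> 0\<close> s(1), where z = z, folded T_def, OF fin'(1,3)]
  have main: "?m (F - T) \<le> ?m (T - F)" using curv unfolding eqs fin' by auto
  have split: "?m S = ?m (S \<inter> ball z \<rho>) + ?m (S - ball z \<rho>)" if "S \<in> fmeasurable ?M" for S
  proof -
    have S: "S \<inter> ball z \<rho> \<in> fmeasurable ?M" "S - ball z \<rho> \<in> fmeasurable ?M"
      using that fmeasurableD[OF that] by (auto intro!: fmeasurableI2[OF that] sets.Int sets.Diff)
    have "?m ((S \<inter> ball z \<rho>) \<union> (S - ball z \<rho>)) = ?m (S \<inter> ball z \<rho>) + ?m (S - ball z \<rho>)"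
      using S by (intro measure_Union) (auto simp: fmeasurableD2 dest: fmeasurableD)
    moreover have "(S \<inter> ball z \<rho>) \<union> (S - ball z \<rho>) = S" by auto
    ultimately show ?thesis by simp
  qed
  have b1: "?m ((T - F) \<inter> ball z \<rho>) \<le> ?m ((T - P) \<inter> ball z \<rho>)"
  proof (rule measure_mono_fmeasurable)
    show "(T - F) \<inter> ball z \<rho> \<subseteq> (T - P) \<inter> ball z \<rho>" using PG by (auto simp: F_def)
  qed (use TP(1) \<delta> T F in \<open>auto intro!: sets.Int sets.Diff\<close>)
  have b2: "?m ((G - T) \<inter> ball z \<rho> - ball z \<delta>) \<le> ?m ((F - T) \<inter> ball z \<rho>)"
  proof (rule measure_mono_fmeasurable)
    show "(G - T) \<inter> ball z \<rho> - ball z \<delta> \<subseteq> (F - T) \<inter> ball z \<rho>" by (auto simp: F_def)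
    show "(G - T) \<inter> ball z \<rho> - ball z \<delta> \<in> sets ?M"
      using T G by (simp only: sets_frac_measure) (intro sets.Int sets.Diff sets_lebesgue_ball)
    show "(F - T) \<inter> ball z \<rho> \<in> fmeasurable ?M"
      by (rule fmeasurableI2[OF fin2]) (use T F in \<open>auto intro!: sets.Int sets.Diff\<close>)
  qed
  have "\<And>y. y \<in> ball z \<delta> \<Longrightarrow> y \<in> ball z \<rho>" using \<delta> by auto
  then have out: "F - ball z \<rho> = G - ball z \<rho>" "- F - ball z \<rho> = - G - ball z \<rho>" by (auto simp: F_def)
  \<comment> \<open>The half-space is needed only near \<open>z\<close>. Beyond
    \<open>ball z \<rho>\<close> the balance is undone, so that the far field is expressed by
    \<open>G\<close> and \<open>- G\<close> alone.\<close>
  have "?m (- F - ball z \<rho>) - ?m (F - ball z \<rho>) = 2 * (?m (T - F - ball z \<rho>) - ?m (F - T - ball z \<rho>))"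
    using frac_measure_balance[OF F \<open>\<nu> \<noteq> 0\<close> s(1), of \<rho> z] \<delta> by (simp add: T_def)
  moreover have "?m ((T - P) \<inter> ball z \<rho>) \<le> 2 powr (real DIM('a) + s) / (1 - 2 powr - (1 - s)) *
        (2 ^ (DIM('a) + 1) * unit_ball_vol (real DIM('a)) / r) * \<rho> powr (1 - s)"
    using TP(2)[of \<rho>] \<delta> by simp
  ultimately show ?thesis
    using main split[OF fin1] split[OF fin2] b1 b2 unfolding out by argo
qed

lemma le_of_le_add_power:
  fixes a b k :: real
  assumes "0 < \<rho>" "0 < n" "\<And>\<delta>. 0 < \<delta> \<Longrightarrow> \<delta> < \<rho> \<Longrightarrow> a \<le> b + k * \<delta> ^ n"
  shows "a \<le> b"
proof (rule tendsto_lowerbound)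
  show "((\<lambda>\<delta>. b + k * \<delta> ^ n) \<longlongrightarrow> b) (at_right 0)"
    using assms(2) by (auto intro!: tendsto_eq_intros)
  show "\<forall>\<^sub>F \<delta> in at_right 0. a \<le> b + k * \<delta> ^ n"
    using assms(1,3) by (auto simp: eventually_at_right)
qed simp

text \<open>The size \<delta> of the modified region is sent to 0. On \<open>ball z \<rho>\<close>
  the weight is replaced by its lower bound \<open>\<rho> powr - (N + s)\<close>, with
  \<open>N\<close> the dimension, so excising \<open>ball z \<delta>\<close> costs only a multiple
  of \<open>\<delta> ^ N\<close>. The constant depends on neither \<open>G\<close> nor the contact
  ball.\<close>

lemma contact_inequality:
  assumes s: "0 < s" "s < 1"
  shows "\<exists>C>0. \<forall>(G::'a::euclidean_space set) z \<nu> r \<rho>. G \<in> sets lebesgue \<longrightarrow> supersolution_at s G z \<longrightarrow>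
    norm \<nu> = 1 \<longrightarrow> ball (z - r *\<^sub>R \<nu>) r \<subseteq> G \<longrightarrow> 0 < \<rho> \<longrightarrow> \<rho> \<le> r \<longrightarrow>
    2 * \<rho> powr - (real DIM('a) + s) * measure lebesgue ((G - {y. (y - z) \<bullet> \<nu> < 0}) \<inter> ball z \<rho>)
      + measure (frac_measure s z) (G - ball z \<rho>)
    \<le> C / r * \<rho> powr (1 - s) + measure (frac_measure s z) (- G - ball z \<rho>)"
proof (intro exI conjI allI impI)
  define C where "C = 2 * (2 powr (real DIM('a) + s) / (1 - 2 powr - (1 - s)) *
        (2 ^ (DIM('a) + 1) * unit_ball_vol (real DIM('a))))"
  have "2 powr - (1 - s) < (1::real)" using s powr_less_mono[of "- (1 - s)" 0 2] by simp
  then show "0 < C" by (simp add: C_def)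
  fix G :: "'a set" and z \<nu> :: 'a and r \<rho> :: real
  assume G: "G \<in> sets lebesgue" and super: "supersolution_at s G z" and \<nu>: "norm \<nu> = 1"
    and ballG: "ball (z - r *\<^sub>R \<nu>) r \<subseteq> G" and \<rho>: "0 < \<rho>" "\<rho> \<le> r"
  let ?m = "measure (frac_measure s z)" and ?S = "(G - {y. (y - z) \<bullet> \<nu> < 0}) \<inter> ball z \<rho>"
  let ?V = "unit_ball_vol (real DIM('a))" and ?e = "\<rho> powr - (real DIM('a) + s)"
  have S: "?S \<in> sets lebesgue" using G by (intro sets.Int sets.Diff sets_halfspaces) auto
  have Sf: "?S \<in> fmeasurable lebesgue" using G by (intro fmeasurable_Int_ball sets.Diff) auto
  show "2 * ?e * measure lebesgue ?S + ?m (G - ball z \<rho>) \<le> C / r * \<rho> powr (1 - s) + ?m (- G - ball z \<rho>)"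
  proof (rule le_of_le_add_power[OF \<rho>(1) DIM_positive[where 'a='a], where k = "2 * ?e * ?V"])
    fix \<delta> assume \<delta>: "0 < \<delta>" "\<delta> < \<rho>"
    have Sd: "?S - ball z \<delta> \<in> fmeasurable lebesgue" using Sf by (intro fmeasurable.Diff) auto
    have "?e * measure lebesgue (?S - ball z \<delta>) \<le> ?m (?S - ball z \<delta>)"
    proof -
      have "ennreal ?e * emeasure lebesgue (?S - ball z \<delta>) \<le> emeasure (frac_measure s z) (?S - ball z \<delta>)"
        using \<delta> S s by (intro emeasure_frac_measure_ge) (auto simp: dist_norm intro!: sets.Diff)
      moreover have "?S - ball z \<delta> \<in> fmeasurable (frac_measure s z)"
        using frac_measure_fmeasurable_far[OF S s(1) \<delta>(1)] .
      ultimately show ?thesis using Sd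
        by (simp add: emeasure_eq_measure2 ennreal_mult[symmetric])
    qed
    moreover have "measure lebesgue ?S \<le> measure lebesgue (?S - ball z \<delta>) + ?V * \<delta> ^ DIM('a)"
    proof -
      have "measure lebesgue ?S \<le> measure lebesgue ((?S - ball z \<delta>) \<union> ball z \<delta>)"
        using Sd S by (intro measure_mono_fmeasurable fmeasurable.Un) auto
      also have "\<dots> \<le> measure lebesgue (?S - ball z \<delta>) + measure lebesgue (ball z \<delta>)"
        using Sd by (intro measure_Un_le) (auto dest: fmeasurableD)
      also have "measure lebesgue (ball z \<delta>) = ?V * \<delta> ^ DIM('a)"
        using \<delta> by (intro measure_lebesgue_ball) simp
      finally show ?thesis .
    qed
    then have "?e * measure lebesgue ?S \<le> ?e * (measure lebesgue (?S - ball z \<delta>) + ?V * \<delta> ^ DIM('a))"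
      by (intro mult_left_mono) auto
    moreover note contact_inequality_annulus[OF s G super \<nu> ballG \<delta> \<rho>(2)]
    ultimately show "2 * ?e * measure lebesgue ?S + ?m (G - ball z \<rho>)
       \<le> C / r * \<rho> powr (1 - s) + ?m (- G - ball z \<rho>) + 2 * ?e * ?V * \<delta> ^ DIM('a)"
      by (simp add: C_def algebra_simps)
  qed
qed

section \<open>Large-scale flatness\<close>

lemma frontier_halfspace_le:
  fixes e :: "'a::euclidean_space"
  assumes "E \<subseteq> {y. y \<bullet> e \<le> b}" "z \<in> frontier E"
  shows "z \<bullet> e \<le> b"
proof -
  have "closed {y. y \<bullet> e \<le> b}" by (intro closed_Collect_le continuous_intros)
  then have "closure E \<subseteq> {y. y \<bullet> e \<le> b}" using assms(1) by (simp add: closure_minimal)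
  then show ?thesis using assms(2) by (auto simp: frontier_def)
qed

lemma connected_disjoint_frontier:
  assumes "connected S" "S \<inter> frontier T = {}"
  shows "S \<subseteq> T \<or> S \<inter> T = {}"
  using connected_Int_frontier[OF assms(1), of T] assms(2) by blast

text \<open>A large ball outside \<open>E\<close>, pushed along \<open>- e\<close> towards the almost extremal point \<open>p\<close>,
  touches \<open>E\<close> at a point \<open>z\<close> where the contact inequality applies to the complement.\<close>

lemma flat_near_extremal_point:
  assumes s: "0 < s" "s < 1"
  shows "\<exists>C>0. \<forall>(E::'a::euclidean_space set) e b p \<epsilon> \<rho>. E \<in> sets lebesgue \<longrightarrow> norm e = 1 \<longrightarrow>
    E \<subseteq> {y. y \<bullet> e \<le> b} \<longrightarrow> (\<forall>z\<in>frontier E. supersolution_at s (- E) z) \<longrightarrow>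
    p \<in> frontier E \<longrightarrow> 0 < \<epsilon> \<longrightarrow> b - \<epsilon> \<le> p \<bullet> e \<longrightarrow> 16 * \<epsilon> \<le> \<rho> \<longrightarrow>
    measure lebesgue (({y. y \<bullet> e < b} - E) \<inter> ball p (\<rho> / 4)) \<le> C * \<epsilon> * \<rho> ^ (DIM('a) - 1)"
proof -
  obtain C where C: "0 < C" and contact: "\<And>(G::'a set) z \<nu> r \<rho>. G \<in> sets lebesgue \<Longrightarrow> supersolution_at s G z \<Longrightarrow>
    norm \<nu> = 1 \<Longrightarrow> ball (z - r *\<^sub>R \<nu>) r \<subseteq> G \<Longrightarrow> 0 < \<rho> \<Longrightarrow> \<rho> \<le> r \<Longrightarrow>
    2 * \<rho> powr - (real DIM('a) + s) * measure lebesgue ((G - {y. (y - z) \<bullet> \<nu> < 0}) \<inter> ball z \<rho>)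
      + measure (frac_measure s z) (G - ball z \<rho>)
    \<le> C / r * \<rho> powr (1 - s) + measure (frac_measure s z) (- G - ball z \<rho>)"
    using contact_inequality[OF s, where 'a='a] by blast
  define K1 where "K1 = 2 ^ (DIM('a) + 1) * unit_ball_vol (real DIM('a))"
  define K2 where "K2 = 2 ^ DIM('a) / (1 - 2 powr - s) * (2 ^ (DIM('a) + 1) * unit_ball_vol (real DIM('a)))"
  have "2 powr - s < (1::real)" using s powr_less_mono[of "- s" 0 2] by simp
  then have K: "0 < K1" "0 < K2" by (simp_all add: K1_def K2_def)
  show ?thesis
  proof (intro exI[of _ "8 * C + 2 * K2 + 5 * K1"] conjI allI impI)
    show "0 < 8 * C + 2 * K2 + 5 * K1" using C K by simp
    fix E :: "'a set" and e p :: 'a and b \<epsilon> \<rho> :: real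
    assume E: "E \<in> sets lebesgue" and e: "norm e = 1" and EH: "E \<subseteq> {y. y \<bullet> e \<le> b}"
      and super: "\<forall>z\<in>frontier E. supersolution_at s (- E) z"
      and p: "p \<in> frontier E" "b - \<epsilon> \<le> p \<bullet> e" and \<epsilon>: "0 < \<epsilon>" "16 * \<epsilon> \<le> \<rho>"
    have ee: "e \<bullet> e = 1" using e by (simp add: norm_eq_1)
    \<comment> \<open>The normalization \<open>L * \<epsilon> = \<rho>\<^sup>2 / 8\<close> keeps the
      contact point within \<open>\<rho> / 2\<close> of \<open>p\<close>, and
      \<open>16 * \<epsilon> \<le> \<rho>\<close> makes the ball larger than the scale
      \<rho>.\<close>
    define L where "L = \<rho>\<^sup>2 / (8 * \<epsilon>)"
    define c where "c = p + L *\<^sub>R e"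
    have \<rho>: "0 < \<rho>" using \<epsilon> by simp
    have "16 * \<epsilon> * \<rho> \<le> \<rho> * \<rho>" using \<epsilon> \<rho> by (intro mult_right_mono) auto
    then have L: "2 * \<rho> \<le> L" "L * \<epsilon> = \<rho>\<^sup>2 / 8" using \<epsilon> by (simp_all add: L_def field_simps power2_eq_square)
    obtain z where z: "z \<in> frontier E" "\<And>y. y \<in> frontier E \<Longrightarrow> dist c z \<le> dist c y"
      using distance_attains_inf[of "frontier E" c] p by blast
    define r where "r = dist c z"
    have rL: "r \<le> L"
      using z(2)[OF p(1)] e L \<rho> by (simp add: r_def c_def dist_norm)
    have zb: "z \<bullet> e \<le> b" using frontier_halfspace_le[OF EH z(1)] .
    have pb: "p \<bullet> e \<le> b" using frontier_halfspace_le[OF EH p(1)] .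
    have ce: "c \<bullet> e = p \<bullet> e + L" by (simp add: c_def inner_add_left ee)
    have cz: "(c - z) \<bullet> e = p \<bullet> e + L - z \<bullet> e" by (simp add: inner_diff_left ce)
    have "\<bar>(c - z) \<bullet> e\<bar> \<le> r" using Cauchy_Schwarz_ineq2[of "c - z" e] e by (simp add: r_def dist_norm)
    then have rge: "L - \<epsilon> \<le> r" and zd: "b - \<epsilon> \<le> z \<bullet> e" using cz zb p(2) rL by linarith+
    have r: "0 < r" "\<rho> \<le> r" "L / 2 \<le> r" using rge L \<epsilon> by linarith+
    have ball: "ball c r \<subseteq> - E"
    proof -
      have "ball c r \<inter> frontier E = {}" using z(2) by (force simp: r_def)
      moreover have "c \<in> ball c r" "c \<notin> E" using r EH ce p(2) L \<epsilon> by auto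
      ultimately show ?thesis using connected_disjoint_frontier[of "ball c r" E, OF connected_ball] by blast
    qed
    define \<nu> where "\<nu> = (z - c) /\<^sub>R r"
    have "norm (z - c) = r" by (simp add: r_def dist_norm norm_minus_commute)
    then have \<nu>: "norm \<nu> = 1" "z - r *\<^sub>R \<nu> = c" using r by (simp_all add: \<nu>_def)
    define v where "v = z - p"
    have zc: "z - c = v - L *\<^sub>R e" by (simp add: v_def c_def)
    \<comment> \<open>Pythagoras relative to \<open>e\<close>: the ball has radius at most
      \<open>L\<close>, and \<open>z\<close> lies at most \<epsilon> above \<open>p\<close>, so
      \<open>z\<close> is confined to a flat cap of the ball around \<open>c\<close> through
      \<open>p\<close>, of squared width at most \<open>2 * L * \<epsilon>\<close>.\<close>
    have nv: "norm v \<le> \<rho> / 2"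
    proof -
      have "(norm v)\<^sup>2 = (norm (z - c))\<^sup>2 + 2 * L * ((z - c) \<bullet> e) + L\<^sup>2"
      proof -
        have v: "v = (z - c) + L *\<^sub>R e" by (simp add: zc)
        have "((z - c) + L *\<^sub>R e) \<bullet> e = (z - c) \<bullet> e + L" by (simp add: inner_add_left ee)
        then have "(norm v)\<^sup>2 - ((z - c) \<bullet> e + L)\<^sup>2 = (norm (z - c))\<^sup>2 - ((z - c) \<bullet> e)\<^sup>2"
          using tangential_shift[OF e, of "z - c" L] v by metis
        then show ?thesis by (simp only: power2_sum) (simp add: algebra_simps)
      qed
      also have "norm (z - c) = r" by fact
      also have "(z - c) \<bullet> e = - ((c - z) \<bullet> e)" by (simp add: inner_diff_left)
      also have "r\<^sup>2 + 2 * L * - ((c - z) \<bullet> e) + L\<^sup>2 \<le> L\<^sup>2 + 2 * L * (\<epsilon> - L) + L\<^sup>2"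
      proof -
        have "r\<^sup>2 \<le> L\<^sup>2" using rL r(1) by (intro power_mono) linarith+
        moreover have "- ((c - z) \<bullet> e) \<le> \<epsilon> - L" using cz zb p(2) by linarith
        then have "2 * L * - ((c - z) \<bullet> e) \<le> 2 * L * (\<epsilon> - L)" using L(1) \<rho> by (intro mult_left_mono) linarith+
        ultimately show ?thesis by linarith
      qed
      also have "\<dots> = 2 * (L * \<epsilon>)" by (simp add: power2_eq_square algebra_simps)
      also have "\<dots> = (\<rho> / 2)\<^sup>2" unfolding L(2) by (simp add: power2_eq_square)
      finally have "(norm v)\<^sup>2 \<le> (\<rho> / 2)\<^sup>2" .
      then show ?thesis by (rule power2_le_imp_le) (use \<rho> in linarith)
    qed
    let ?H = "{y. y \<bullet> e < b}" and ?T = "{y. (y - z) \<bullet> \<nu> < 0}" and ?m = "measure (frac_measure s z)"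
    let ?Te = "{y. (y - z) \<bullet> e < 0}"
    let ?S5 = "{y. b - 5 * \<epsilon> \<le> y \<bullet> e \<and> y \<bullet> e < (b - 5 * \<epsilon>) + 5 * \<epsilon>}"
    let ?S2 = "{y. z \<bullet> e \<le> y \<bullet> e \<and> y \<bullet> e < z \<bullet> e + 2 * \<epsilon>}"
    have S5eq: "?S5 = {y. b - 5 * \<epsilon> \<le> y \<bullet> e} \<inter> {y. y \<bullet> e < (b - 5 * \<epsilon>) + 5 * \<epsilon>}"
      and S2eq: "?S2 = {y. z \<bullet> e \<le> y \<bullet> e} \<inter> {y. y \<bullet> e < z \<bullet> e + 2 * \<epsilon>}" by auto
    have S5: "?S5 \<in> sets lebesgue" unfolding S5eq by (intro sets.Int sets_halfspaces)
    have S2: "?S2 \<in> sets lebesgue" unfolding S2eq by (intro sets.Int sets_halfspaces)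
    \<comment> \<open>The normal \<nu> is only nearly \<open>- e\<close>. Its tilt costs at most
      \<open>4 * \<epsilon>\<close> in height on \<open>ball z \<rho>\<close>, and \<open>z\<close>
      itself has depth at most \<epsilon>; what the contact inequality does not see thus lies in a
      slab of width \<open>5 * \<epsilon>\<close>.\<close>
    have incl: "(?H - E) \<inter> ball p (\<rho> / 4) \<subseteq> (- E - ?T) \<inter> ball z \<rho> \<union> ?S5 \<inter> ball z \<rho>"
    proof
      fix y assume y: "y \<in> (?H - E) \<inter> ball p (\<rho> / 4)"
      have "dist z y \<le> dist z p + dist p y" by (rule dist_triangle)
      then have yz: "dist z y < \<rho>" using y nv \<rho> by (simp add: v_def dist_norm)
      have "y \<in> ?S5" if "y \<in> ?T"
      proof -
        have "(y - z) \<bullet> \<nu> < 0" using that by simp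
        then have "(y - z) \<bullet> (z - c) < 0" using r(1) by (simp add: \<nu>_def mult_less_0_iff)
        then have "(y - z) \<bullet> v < L * ((y - z) \<bullet> e)" unfolding zc by (simp add: inner_diff_right)
        moreover have "- (\<rho> * (\<rho> / 2)) \<le> (y - z) \<bullet> v"
        proof -
          have "\<bar>(y - z) \<bullet> v\<bar> \<le> norm (y - z) * norm v" by (rule Cauchy_Schwarz_ineq2)
          also have "\<dots> \<le> \<rho> * (\<rho> / 2)"
            using yz nv \<rho> by (intro mult_mono) (auto simp: dist_norm norm_minus_commute)
          finally show ?thesis by linarith
        qed
        moreover have "\<rho> * (\<rho> / 2) = L * (4 * \<epsilon>)" using L(2) by (simp add: power2_eq_square)
        ultimately have "L * (- 4 * \<epsilon>) < L * ((y - z) \<bullet> e)" by simp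
        then have "- 4 * \<epsilon> < (y - z) \<bullet> e" using L \<rho> by (simp only: mult_less_cancel_left_pos)
        then show ?thesis using zd y by (simp add: inner_diff_left)
      qed
      then show "y \<in> (- E - ?T) \<inter> ball z \<rho> \<union> ?S5 \<inter> ball z \<rho>" using y yz by auto
    qed
    have fin: "(- E - ?T) \<inter> ball z \<rho> \<in> fmeasurable lebesgue" "?S5 \<inter> ball z \<rho> \<in> fmeasurable lebesgue"
      using E S5 by (auto intro!: fmeasurable_Int_ball sets.Diff)
    have "measure lebesgue ((?H - E) \<inter> ball p (\<rho> / 4))
       \<le> measure lebesgue ((- E - ?T) \<inter> ball z \<rho> \<union> ?S5 \<inter> ball z \<rho>)"
      using incl fin E by (intro measure_mono_fmeasurable fmeasurable.Un sets.Int sets.Diff sets_halfspaces) auto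
    also have "\<dots> \<le> measure lebesgue ((- E - ?T) \<inter> ball z \<rho>) + measure lebesgue (?S5 \<inter> ball z \<rho>)"
      using fin by (intro measure_Un_le fmeasurableD)
    also have "measure lebesgue (?S5 \<inter> ball z \<rho>) \<le> 5 * K1 * \<epsilon> * \<rho> ^ (DIM('a) - 1)"
      using measure_slab_le[OF e _ \<rho>, of "5 * \<epsilon>" "b - 5 * \<epsilon>" z] \<epsilon> by (simp add: K1_def mult_ac)
    also have "measure lebesgue ((- E - ?T) \<inter> ball z \<rho>) \<le> (8 * C + 2 * K2) * \<epsilon> * \<rho> ^ (DIM('a) - 1)"
    proof -
      have "e \<noteq> 0" using e by auto
      \<comment> \<open>The far field is balanced against the horizontal half-space through
        \<open>z\<close>. Only the part of \<open>E\<close> above \<open>z\<close> contributes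
        unfavourably. It has height at most \<epsilon>; the width \<open>2 * \<epsilon>\<close>
        makes the half-open slab contain the top level too.\<close>
      have "2 * \<rho> powr - (real DIM('a) + s) * measure lebesgue ((- E - ?T) \<inter> ball z \<rho>) + ?m (- E - ball z \<rho>)
        \<le> C / r * \<rho> powr (1 - s) + ?m (- (- E) - ball z \<rho>)"
        using super z(1) E \<nu> ball \<rho> r by (intro contact) auto
      moreover have "?m (- E - ball z \<rho>) - ?m (E - ball z \<rho>)
          = 2 * (?m (?Te - E - ball z \<rho>) - ?m (E - ?Te - ball z \<rho>))"
        using frac_measure_balance[OF E \<open>e \<noteq> 0\<close> s(1) \<rho>] .
      moreover have "?m (E - ?Te - ball z \<rho>) \<le> ?m (?S2 - ball z \<rho>)"
      proof (rule measure_mono_fmeasurable)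
        show "E - ?Te - ball z \<rho> \<subseteq> ?S2 - ball z \<rho>" using EH zd \<epsilon> by (force simp: inner_diff_left)
        show "E - ?Te - ball z \<rho> \<in> sets (frac_measure s z)"
          unfolding sets_frac_measure using E by (intro sets.Diff sets_halfspaces sets_lebesgue_ball)
      qed (use frac_measure_fmeasurable_far[OF S2 s(1) \<rho>] in auto)
      moreover have "?m (?S2 - ball z \<rho>) \<le> K2 * (2 * \<epsilon> / \<rho>) * \<rho> powr - s"
        using measure_frac_slab_le[OF e _ \<rho> s(1), of "2 * \<epsilon>" z "z \<bullet> e"] \<epsilon> by (simp only: K2_def)
      moreover have "0 \<le> ?m (?Te - E - ball z \<rho>)" by simp
      moreover have "- (- E) = E" by simp
      ultimately have "2 * \<rho> powr - (real DIM('a) + s) * measure lebesgue ((- E - ?T) \<inter> ball z \<rho>)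
         \<le> C / r * \<rho> powr (1 - s) + 2 * (K2 * (2 * \<epsilon> / \<rho>) * \<rho> powr - s)" by (simp only:) argo
      also have "C / r * \<rho> powr (1 - s) \<le> C * (16 * \<epsilon> / \<rho>\<^sup>2) * \<rho> powr (1 - s)"
      proof (rule mult_right_mono)
        have "C / r \<le> C / (L / 2)" using C r L \<rho> by (intro divide_left_mono) auto
        also have "\<dots> = C * (16 * \<epsilon> / \<rho>\<^sup>2)" using \<rho> \<epsilon> by (simp add: L_def)
        finally show "C / r \<le> C * (16 * \<epsilon> / \<rho>\<^sup>2)" .
      qed simp
      also have "\<rho> powr (1 - s) = \<rho> * \<rho> powr - s" using \<rho> powr_add[of \<rho> 1 "- s"] by simp
      finally have *: "2 * \<rho> powr - (real DIM('a) + s) * measure lebesgue ((- E - ?T) \<inter> ball z \<rho>)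
         \<le> (16 * C + 4 * K2) * \<epsilon> / \<rho> * \<rho> powr - s"
        using \<rho> by (simp add: field_simps power2_eq_square)
      define X where "X = measure lebesgue ((- E - ?T) \<inter> ball z \<rho>)"
      have "\<rho> ^ DIM('a) = \<rho> * \<rho> ^ (DIM('a) - 1)"
        using DIM_positive[where 'a='a] power_Suc[of \<rho> "DIM('a) - 1"] by simp
      moreover have "\<rho> powr - (real DIM('a) + s) * \<rho> ^ DIM('a) = \<rho> powr - s"
        using \<rho> powr_add[of \<rho> "- (real DIM('a) + s)" "real DIM('a)"] powr_realpow[of \<rho> "DIM('a)"] by simp
      ultimately have ps: "\<rho> powr - s = \<rho> powr - (real DIM('a) + s) * (\<rho> * \<rho> ^ (DIM('a) - 1))" by simp
      have "\<rho> powr - (real DIM('a) + s) * (2 * X) \<le> \<rho> powr - (real DIM('a) + s) * ((16 * C + 4 * K2) * \<epsilon> * \<rho> ^ (DIM('a) - 1))"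
        using * \<rho> unfolding ps X_def[symmetric] by (simp add: mult_ac)
      then have "2 * X \<le> (16 * C + 4 * K2) * \<epsilon> * \<rho> ^ (DIM('a) - 1)"
        using \<rho> by (simp only: mult_le_cancel_left_pos powr_gt_zero)
      then show ?thesis by (simp add: X_def algebra_simps)
    qed
    finally show "measure lebesgue ((?H - E) \<inter> ball p (\<rho> / 4)) \<le> (8 * C + 2 * K2 + 5 * K1) * \<epsilon> * \<rho> ^ (DIM('a) - 1)"
      by (simp add: algebra_simps)
  qed
qed

text \<open>The factor \<eta> is arbitrary because \<epsilon> is. The almost extremal point
  \<open>p\<close> may run off to infinity as \<epsilon> shrinks, but for fixed \<epsilon> its
  distance from \<open>q\<close> only enlarges \<open>R0\<close>: from then on
  \<open>ball q r\<close> lies in \<open>ball p (2 * r)\<close>.\<close>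

lemma flat_at_infinity:
  fixes E :: "'a::euclidean_space set"
  assumes s: "0 < s" "s < 1" and E: "E \<in> sets lebesgue" and e: "norm e = 1"
    and EH: "E \<subseteq> {y. y \<bullet> e \<le> b}" and super: "\<And>z. z \<in> frontier E \<Longrightarrow> supersolution_at s (- E) z"
    and sup: "\<And>\<epsilon>. 0 < \<epsilon> \<Longrightarrow> \<exists>p\<in>frontier E. b - \<epsilon> \<le> p \<bullet> e" and "0 < \<eta>"
  shows "\<exists>R0>0. \<forall>r\<ge>R0. measure lebesgue (({y. y \<bullet> e < b} - E) \<inter> ball q r) \<le> \<eta> * r ^ (DIM('a) - 1)"
proof -
  obtain C where C: "0 < C" and flat: "\<And>(E::'a set) e b p \<epsilon> \<rho>. E \<in> sets lebesgue \<Longrightarrow> norm e = 1 \<Longrightarrow>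
    E \<subseteq> {y. y \<bullet> e \<le> b} \<Longrightarrow> (\<forall>z\<in>frontier E. supersolution_at s (- E) z) \<Longrightarrow>
    p \<in> frontier E \<Longrightarrow> 0 < \<epsilon> \<Longrightarrow> b - \<epsilon> \<le> p \<bullet> e \<Longrightarrow> 16 * \<epsilon> \<le> \<rho> \<Longrightarrow>
    measure lebesgue (({y. y \<bullet> e < b} - E) \<inter> ball p (\<rho> / 4)) \<le> C * \<epsilon> * \<rho> ^ (DIM('a) - 1)"
    using flat_near_extremal_point[OF s, where 'a='a] by blast
  define \<epsilon> where "\<epsilon> = \<eta> / (C * 8 ^ (DIM('a) - 1))"
  have \<epsilon>: "0 < \<epsilon>" using \<open>0 < \<eta>\<close> C by (simp add: \<epsilon>_def)
  obtain p where p: "p \<in> frontier E" "b - \<epsilon> \<le> p \<bullet> e" using sup[OF \<epsilon>] by blast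
  let ?A = "{y. y \<bullet> e < b} - E"
  have A: "?A \<in> sets lebesgue" using E by (intro sets.Diff sets_halfspaces)
  show ?thesis
  proof (intro exI[of _ "2 * \<epsilon> + dist p q"] conjI allI impI)
    show "0 < 2 * \<epsilon> + dist p q" using \<epsilon> by (intro add_pos_nonneg) auto
    fix r assume r: "2 * \<epsilon> + dist p q \<le> r"
    have "ball q r \<subseteq> ball p (8 * r / 4)"
    proof
      fix y assume "y \<in> ball q r"
      then show "y \<in> ball p (8 * r / 4)" using dist_triangle[of p y q] r \<epsilon> by simp
    qed
    then have "measure lebesgue (?A \<inter> ball q r) \<le> measure lebesgue (?A \<inter> ball p (8 * r / 4))"
      using A by (intro measure_mono_fmeasurable fmeasurable_Int_ball sets.Int) auto
    also have "\<dots> \<le> C * \<epsilon> * (8 * r) ^ (DIM('a) - 1)"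
      using E e EH super p \<epsilon> r zero_le_dist[of p q] by (intro flat) (auto simp del: zero_le_dist)
    also have "\<dots> = \<eta> * r ^ (DIM('a) - 1)"
      using C by (simp add: \<epsilon>_def power_mult_distrib)
    finally show "measure lebesgue (?A \<inter> ball q r) \<le> \<eta> * r ^ (DIM('a) - 1)" .
  qed
qed

section \<open>No interior contact in the flat regime\<close>

text \<open>Balanced against the horizontal plane through \<open>z\<close>, the contact inequality
  bounds the mass of \<open>E\<close> above \<open>z\<close> by the curvature error plus the mass of
  \<open>H - E\<close> below, where \<open>H = {y. y \<bullet> e < b}\<close>. But \<open>E\<close>
  nearly fills the slab between \<open>z\<close> and the top, whose mass is at least of order
  \<open>min (D / R) 1 * R powr - s\<close> with \<open>D = b - z \<bullet> e\<close>. The two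
  conditions on \<open>R\<close> make the curvature error small against each entry of this
  minimum.\<close>

lemma no_interior_contact:
  assumes s: "0 < s" "s < 1" and dim: "2 \<le> DIM('a::euclidean_space)"
  shows "\<exists>C\<ge>1. \<exists>\<theta>>0. \<forall>(E::'a set) e b z c r R. E \<in> sets lebesgue \<longrightarrow> norm e = 1 \<longrightarrow>
    supersolution_at s E z \<longrightarrow> ball c r \<subseteq> E \<longrightarrow> dist c z = r \<longrightarrow> z \<bullet> e < b \<longrightarrow>
    0 < R \<longrightarrow> C * R \<le> r \<longrightarrow> C * R\<^sup>2 \<le> (b - z \<bullet> e) * r \<longrightarrow>
    \<not> (\<forall>\<rho>\<ge>R. measure lebesgue (({y. y \<bullet> e < b} - E) \<inter> ball z \<rho>)
         \<le> \<theta> * min ((b - z \<bullet> e) / R) 1 * \<rho> ^ DIM('a))"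
proof -
  obtain C where C: "0 < C" and contact: "\<And>(G::'a set) z \<nu> r \<rho>. G \<in> sets lebesgue \<Longrightarrow> supersolution_at s G z \<Longrightarrow>
    norm \<nu> = 1 \<Longrightarrow> ball (z - r *\<^sub>R \<nu>) r \<subseteq> G \<Longrightarrow> 0 < \<rho> \<Longrightarrow> \<rho> \<le> r \<Longrightarrow>
    2 * \<rho> powr - (real DIM('a) + s) * measure lebesgue ((G - {y. (y - z) \<bullet> \<nu> < 0}) \<inter> ball z \<rho>)
      + measure (frac_measure s z) (G - ball z \<rho>)
    \<le> C / r * \<rho> powr (1 - s) + measure (frac_measure s z) (- G - ball z \<rho>)"
    using contact_inequality[OF s, where 'a='a] by blast
  obtain k where k: "0 < k" and slab: "\<And>(z::'a) e D R. norm e = 1 \<Longrightarrow> 0 < D \<Longrightarrow> 0 < R \<Longrightarrow>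
     k * min (D / R) 1 * R powr - s
       \<le> measure (frac_measure s z) ({y. - D \<le> (y - z) \<bullet> e \<and> (y - z) \<bullet> e < D} - ball z R)"
    using measure_frac_slab_ge[OF dim s(1)] by blast
  define K where "K = 2 ^ DIM('a) / (1 - 2 powr - s)"
  have "2 powr - s < (1::real)" using s powr_less_mono[of "- s" 0 2] by simp
  then have K: "0 < K" by (simp add: K_def)
  \<comment> \<open>The mass of \<open>H - E\<close> enters four times, so this \<theta> makes it
    cost a quarter of the slab term; \<open>4 * C / k\<close> makes the curvature error cost another
    quarter. Half of the slab term survives.\<close>
  define C2 where "C2 = max 1 (4 * C / k)"
  define \<theta> where "\<theta> = k / (16 * K)"
  have C2: "1 \<le> C2" "4 * C / k \<le> C2" by (simp_all add: C2_def)
  have \<theta>: "0 < \<theta>" "4 * (K * \<theta>) = k / 4" using k K by (simp_all add: \<theta>_def)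
  show ?thesis
  proof (rule exI[of _ C2], rule conjI[OF C2(1)], rule exI[of _ \<theta>], rule conjI[OF \<theta>(1)], intro allI impI notI)
    fix E :: "'a set" and e z c :: 'a and b r R :: real
    assume E: "E \<in> sets lebesgue" and e: "norm e = 1" and super: "supersolution_at s E z"
      and ball: "ball c r \<subseteq> E" "dist c z = r" and zb: "z \<bullet> e < b" and R: "0 < R"
      and CR: "C2 * R \<le> r" "C2 * R\<^sup>2 \<le> (b - z \<bullet> e) * r"
      and small: "\<forall>\<rho>\<ge>R. measure lebesgue (({y. y \<bullet> e < b} - E) \<inter> ball z \<rho>)
         \<le> \<theta> * min ((b - z \<bullet> e) / R) 1 * \<rho> ^ DIM('a)"
    define D where "D = b - z \<bullet> e"
    define \<mu> where "\<mu> = min (D / R) 1"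
    have D: "0 < D" using zb by (simp add: D_def)
    have \<mu>: "0 < \<mu>" using D R by (simp add: \<mu>_def)
    let ?m = "measure (frac_measure s z)" and ?A = "{y. y \<bullet> e < b} - E" and ?Te = "{y. (y - z) \<bullet> e < 0}"
    have A: "?A \<in> sets lebesgue" using E by (intro sets.Diff sets_halfspaces)
    have far: "S - ball z R \<in> fmeasurable (frac_measure s z)" if "S \<in> sets lebesgue" for S
      using frac_measure_fmeasurable_far[OF that s(1) R] .
    have "R \<le> C2 * R" using C2 R by simp
    then have r: "R \<le> r" "0 < r" using CR R by linarith+
    have "e \<noteq> 0" using e by auto
    define P where "P = {y. 0 \<le> (y - z) \<bullet> e} \<inter> {y. (y - z) \<bullet> e < D}"
    have P: "P \<in> sets lebesgue" unfolding P_def by (intro sets.Int sets_halfspaces)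
    define \<nu> where "\<nu> = (z - c) /\<^sub>R r"
    have "norm (z - c) = r" using ball(2) by (simp add: dist_norm norm_minus_commute)
    then have \<nu>: "norm \<nu> = 1" "z - r *\<^sub>R \<nu> = c" using r by (simp_all add: \<nu>_def)
    have "2 * R powr - (real DIM('a) + s) * measure lebesgue ((E - {y. (y - z) \<bullet> \<nu> < 0}) \<inter> ball z R) + ?m (E - ball z R)
       \<le> C / r * R powr (1 - s) + ?m (- E - ball z R)"
      using E super \<nu> ball R r by (intro contact) auto
    moreover have "0 \<le> 2 * R powr - (real DIM('a) + s) * measure lebesgue ((E - {y. (y - z) \<bullet> \<nu> < 0}) \<inter> ball z R)"
      by (intro mult_nonneg_nonneg) auto
    moreover have "?m (- E - ball z R) - ?m (E - ball z R)
          = 2 * (?m (?Te - E - ball z R) - ?m (E - ?Te - ball z R))"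
      using frac_measure_balance[OF E \<open>e \<noteq> 0\<close> s(1) R] .
    moreover have "?m (?Te - E - ball z R) \<le> ?m (?A - ball z R)"
    proof (rule measure_mono_fmeasurable)
      show "?Te - E - ball z R \<subseteq> ?A - ball z R" using zb by (force simp: inner_diff_left)
    qed (use far[OF A] E in \<open>auto intro!: sets.Diff\<close>)
    moreover have "?m (P - ball z R) \<le> ?m (E - ?Te - ball z R) + ?m (?A - ball z R)"
    proof -
      have "?m (P - ball z R) \<le> ?m ((E - ?Te - ball z R) \<union> (?A - ball z R))"
      proof (rule measure_mono_fmeasurable)
        show "P - ball z R \<subseteq> (E - ?Te - ball z R) \<union> (?A - ball z R)"
          by (auto simp: P_def D_def inner_diff_left)
        show "(E - ?Te - ball z R) \<union> (?A - ball z R) \<in> fmeasurable (frac_measure s z)"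
          using E A by (intro fmeasurable.Un far sets.Diff sets_halfspaces)
      qed (use P in \<open>auto intro!: sets.Diff\<close>)
      also have "\<dots> \<le> ?m (E - ?Te - ball z R) + ?m (?A - ball z R)"
        using E A by (intro measure_Un_le) (auto intro!: sets.Diff)
      finally show ?thesis .
    qed
    \<comment> \<open>The lower bound is for the two-sided slab; up to a null hyperplane its lower
      half is the reflection of \<open>P - ball z R\<close>.\<close>
    moreover have "k * \<mu> * R powr - s \<le> 2 * ?m (P - ball z R)"
    proof -
      define Q where "Q = (\<lambda>y. 2 *\<^sub>R z - y) -` (P - ball z R)"
      have PR: "P - ball z R \<in> sets lebesgue" using P by (intro sets.Diff) auto
      have Q: "Q \<in> sets lebesgue" "?m Q = ?m (P - ball z R)"
        using emeasure_frac_measure_reflect[OF PR, where z = z] by (simp_all add: Q_def measure_def)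
      have Qeq: "Q = {y. - D < (y - z) \<bullet> e \<and> (y - z) \<bullet> e \<le> 0} - ball z R"
      proof -
        have "(2 *\<^sub>R z - y - z) \<bullet> e = - ((y - z) \<bullet> e)" for y by (simp add: scaleR_2 inner_diff_left)
        moreover have "dist z (2 *\<^sub>R z - y) = dist z y" for y
          by (simp add: dist_norm scaleR_2 norm_minus_commute)
        ultimately show ?thesis unfolding Q_def P_def by auto
      qed
      have "k * \<mu> * R powr - s \<le> ?m ({y. - D \<le> (y - z) \<bullet> e \<and> (y - z) \<bullet> e < D} - ball z R)"
        unfolding \<mu>_def using slab e D R by blast
      also have "\<dots> = ?m ((P - ball z R) \<union> Q)"
      proof (rule measure_eq_AE)
        show "AE y in frac_measure s z. (y \<in> {y. - D \<le> (y - z) \<bullet> e \<and> (y - z) \<bullet> e < D} - ball z R)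
            = (y \<in> (P - ball z R) \<union> Q)"
          by (rule AE_I'[OF null_sets_frac_measure[OF null_sets_hyperplane(2)[OF \<open>e \<noteq> 0\<close>, of z "- D"]]])
            (use D in \<open>auto simp: Qeq P_def\<close>)
        have "{y. - D \<le> (y - z) \<bullet> e \<and> (y - z) \<bullet> e < D} = {y. - D \<le> (y - z) \<bullet> e} \<inter> {y. (y - z) \<bullet> e < D}" by auto
        then show "{y. - D \<le> (y - z) \<bullet> e \<and> (y - z) \<bullet> e < D} - ball z R \<in> sets (frac_measure s z)"
          unfolding sets_frac_measure by (simp only:) (intro sets.Diff sets.Int sets_halfspaces sets_lebesgue_ball)
      qed (use PR Q in auto)
      also have "\<dots> \<le> ?m (P - ball z R) + ?m Q"
        using PR Q by (intro measure_Un_le) auto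
      finally show ?thesis using Q(2) by simp
    qed
    moreover have "?m (?A - ball z R) \<le> K * (\<theta> * \<mu>) * R powr - s"
      unfolding K_def using small \<theta> \<mu>
      by (intro frac_measure_far(2)[OF A s(1) R]) (auto simp: \<mu>_def D_def)
    ultimately have "k * \<mu> * R powr - s \<le> C / r * R powr (1 - s) + 4 * (K * (\<theta> * \<mu>) * R powr - s)" by argo
    also have "4 * (K * (\<theta> * \<mu>) * R powr - s) = (k / 4) * \<mu> * R powr - s"
      unfolding \<theta>(2)[symmetric] by simp
    also have "C / r * R powr (1 - s) \<le> (k / 4) * \<mu> * R powr - s"
    proof -
      have "4 * C / k * R \<le> r" using mult_right_mono[OF C2(2), of R] R CR(1) by simp
      then have 1: "C * R / r \<le> k / 4 * 1" using k r by (simp add: field_simps)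
      have "4 * C / k * R\<^sup>2 \<le> D * r" using mult_right_mono[OF C2(2), of "R\<^sup>2"] R CR(2) by (simp add: D_def)
      then have 2: "C * R / r \<le> k / 4 * (D / R)" using k r R by (simp add: field_simps power2_eq_square)
      have "C * R / r \<le> k / 4 * \<mu>"
        unfolding \<mu>_def by (cases "D / R \<le> 1") (simp_all only: min_absorb1 min_absorb2 1 2 linear not_le less_imp_le)
      then have "C * R / r * R powr - s \<le> k / 4 * \<mu> * R powr - s" by (intro mult_right_mono) auto
      moreover have "R powr (1 - s) = R * R powr - s" using R powr_add[of R 1 "- s"] by simp
      ultimately show ?thesis by simp
    qed
    finally have "k * \<mu> * R powr - s \<le> 1 / 2 * (k * \<mu> * R powr - s)" by simp
    moreover have "0 < k * \<mu> * R powr - s" using k \<mu> R by simp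
    ultimately show False by linarith
  qed
qed

section \<open>Choosing the centre and sliding balls\<close>

text \<open>This is the weak-type maximal function estimate for the indicator of \<open>A\<close>,
  truncated at radius \<open>L\<close>. If every point of \<open>X\<close> had a radius with too
  much of \<open>A\<close>, Vitali's covering lemma would select disjoint such balls whose fivefold
  dilations cover almost all of \<open>X\<close>, contradicting the bound on
  \<open>A\<close>.\<close>

lemma exists_point_low_density:
  fixes A X :: "'a::euclidean_space set"
  assumes A: "A \<in> sets lebesgue" and X: "X \<in> fmeasurable lebesgue" "X \<subseteq> ball p (L / 2)"
    and L: "0 < L" and c: "0 < c"
    and small: "5 ^ DIM('a) * unit_ball_vol (real DIM('a)) / c * measure lebesgue (A \<inter> ball p (2 * L)) < measure lebesgue X"
  shows "\<exists>x\<in>X. \<forall>\<rho>. 0 < \<rho> \<longrightarrow> \<rho> \<le> L \<longrightarrow> measure lebesgue (A \<inter> ball x \<rho>) \<le> c * \<rho> ^ DIM('a)"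
proof (rule ccontr)
  let ?V = "unit_ball_vol (real DIM('a))" and ?\<mu> = "measure lebesgue"
  assume "\<not> ?thesis"
  then have "\<forall>x\<in>X. \<exists>\<rho>. 0 < \<rho> \<and> \<rho> \<le> L \<and> c * \<rho> ^ DIM('a) < ?\<mu> (A \<inter> ball x \<rho>)" by (meson not_le)
  then obtain \<rho> where \<rho>: "\<And>x. x \<in> X \<Longrightarrow> 0 < \<rho> x \<and> \<rho> x \<le> L \<and> c * \<rho> x ^ DIM('a) < ?\<mu> (A \<inter> ball x (\<rho> x))"
    by metis
  \<comment> \<open>The slack in the hypothesis is the measure that may be lost in passing from
    \<open>X\<close> to a compact subset, for which finitely many balls suffice.\<close>
  define g where "g = ?\<mu> X - 5 ^ DIM('a) * ?V / c * ?\<mu> (A \<inter> ball p (2 * L))"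
  have "0 < g" using small by (simp add: g_def)
  obtain T where T: "closed T" "T \<subseteq> X" "X - T \<in> lmeasurable" "emeasure lebesgue (X - T) < ennreal g"
    using sets_lebesgue_inner_closed[OF fmeasurableD[OF X(1)] \<open>0 < g\<close>] .
  have Tf: "T \<in> fmeasurable lebesgue"
    using T by (intro fmeasurableI2[OF X(1)] closed_sets_lebesgue)
  have "?\<mu> (X - T) < g"
    using T(3,4) \<open>0 < g\<close> by (simp add: emeasure_eq_measure2 ennreal_less_iff)
  moreover have "?\<mu> (X - T) = ?\<mu> X - ?\<mu> T"
    using X T Tf by (intro measurable_measure_Diff) (auto dest: fmeasurableD)
  ultimately have Tlow: "5 ^ DIM('a) * ?V / c * ?\<mu> (A \<inter> ball p (2 * L)) < ?\<mu> T" by (simp add: g_def)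
  have "bounded T" using bounded_subset[OF bounded_ball order_trans[OF T(2) X(2)]] .
  then have cT: "compact T" using T(1) by (simp add: compact_eq_bounded_closed)
  have cov: "T \<subseteq> (\<Union>x\<in>X. ball x (\<rho> x))" using T(2) \<rho> by force
  obtain K where K: "K \<subseteq> X" "finite K" "T \<subseteq> (\<Union>x\<in>K. ball x (\<rho> x))"
    using compactE_image[OF cT open_ball cov] .
  have "0 < \<rho> i \<and> \<rho> i \<le> L" if "i \<in> K" for i using \<rho> K that by blast
  then obtain C where C: "countable C" "C \<subseteq> K"
     "pairwise (\<lambda>i j. disjnt (ball i (\<rho> i)) (ball j (\<rho> j))) C"
     "T \<subseteq> (\<Union>i\<in>C. ball i (5 * \<rho> i))"
    using Vitali_covering_lemma_balls[OF K(3), where B = L] by blast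
  have fC: "finite C" using C K finite_subset by blast
  have CX: "i \<in> X" if "i \<in> C" for i using that C K by blast
  have "?\<mu> T \<le> ?\<mu> (\<Union>i\<in>C. ball i (5 * \<rho> i))"
    using C fC Tf by (intro measure_mono_fmeasurable fmeasurable.finite_UN) (auto dest: fmeasurableD)
  also have "\<dots> \<le> (\<Sum>i\<in>C. ?\<mu> (ball i (5 * \<rho> i)))" using fC by (intro measure_UNION_le) auto
  also have "\<dots> \<le> (\<Sum>i\<in>C. 5 ^ DIM('a) * ?V / c * ?\<mu> (A \<inter> ball i (\<rho> i)))"
  proof (rule sum_mono)
    fix i assume "i \<in> C"
    then have i: "0 < \<rho> i" "c * \<rho> i ^ DIM('a) < ?\<mu> (A \<inter> ball i (\<rho> i))" using CX \<rho> by auto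
    have "?\<mu> (ball i (5 * \<rho> i)) = ?V * (5 * \<rho> i) ^ DIM('a)"
      using i by (intro measure_lebesgue_ball) simp
    also have "\<dots> = 5 ^ DIM('a) * ?V / c * (c * \<rho> i ^ DIM('a))" using c by (simp add: power_mult_distrib)
    also have "\<dots> \<le> 5 ^ DIM('a) * ?V / c * ?\<mu> (A \<inter> ball i (\<rho> i))"
      using i c by (intro mult_left_mono) auto
    finally show "?\<mu> (ball i (5 * \<rho> i)) \<le> 5 ^ DIM('a) * ?V / c * ?\<mu> (A \<inter> ball i (\<rho> i))" .
  qed
  also have "\<dots> = 5 ^ DIM('a) * ?V / c * (\<Sum>i\<in>C. ?\<mu> (A \<inter> ball i (\<rho> i)))" by (simp only: sum_distrib_left)
  also have "(\<Sum>i\<in>C. ?\<mu> (A \<inter> ball i (\<rho> i))) = ?\<mu> (\<Union>i\<in>C. A \<inter> ball i (\<rho> i))"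
  proof (rule measure_UNION'[symmetric, OF fC])
    show "pairwise (\<lambda>i j. disjnt (A \<inter> ball i (\<rho> i)) (A \<inter> ball j (\<rho> j))) C"
      using C(3) by (force simp: pairwise_def disjnt_def)
  qed (use A in blast)
  finally have "?\<mu> T \<le> 5 ^ DIM('a) * ?V / c * ?\<mu> (\<Union>i\<in>C. A \<inter> ball i (\<rho> i))" .
  moreover have "?\<mu> (\<Union>i\<in>C. A \<inter> ball i (\<rho> i)) \<le> ?\<mu> (A \<inter> ball p (2 * L))"
  proof (rule measure_mono_fmeasurable)
    show "(\<Union>i\<in>C. A \<inter> ball i (\<rho> i)) \<subseteq> A \<inter> ball p (2 * L)"
    proof
      fix y assume "y \<in> (\<Union>i\<in>C. A \<inter> ball i (\<rho> i))"
      then obtain i where i: "i \<in> C" and y: "y \<in> A" "y \<in> ball i (\<rho> i)" by blast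
      have "dist p i < L / 2" "\<rho> i \<le> L" using CX[OF i] X(2) \<rho> by auto
      then show "y \<in> A \<inter> ball p (2 * L)" using y L dist_triangle[of p y i] by simp
    qed
    show "(\<Union>i\<in>C. A \<inter> ball i (\<rho> i)) \<in> sets lebesgue" using A fC by (intro sets.finite_UN sets.Int) auto
    show "A \<inter> ball p (2 * L) \<in> fmeasurable lebesgue" using A by blast
  qed
  then have "5 ^ DIM('a) * ?V / c * ?\<mu> (\<Union>i\<in>C. A \<inter> ball i (\<rho> i)) \<le> 5 ^ DIM('a) * ?V / c * ?\<mu> (A \<inter> ball p (2 * L))"
    using c by (intro mult_left_mono) auto
  ultimately show False using Tlow by linarith
qed

text \<open>Translates of the graph along \<omega> are disjoint. For every \<open>m\<close>, a
  bounded piece has \<open>m\<close> disjoint translates inside one fixed ball, so its measure is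
  0.\<close>

lemma negligible_continuous_graph:
  fixes g :: "'a::euclidean_space \<Rightarrow> real"
  assumes g: "continuous_on UNIV g" and \<omega>: "norm \<omega> = 1"
  shows "negligible {y. y \<bullet> \<omega> = g (y - (y \<bullet> \<omega>) *\<^sub>R \<omega>)}"
proof (subst locally_negligible_alt, intro ballI)
  let ?G = "{y. y \<bullet> \<omega> = g (y - (y \<bullet> \<omega>) *\<^sub>R \<omega>)}"
  fix x assume x: "x \<in> ?G"
  have "closed ?G"
    by (intro closed_Collect_eq continuous_on_compose2[OF g] continuous_intros) auto
  then have S: "?G \<inter> ball x 1 \<in> fmeasurable lebesgue"
    by (intro fmeasurable_Int_ball closed_sets_lebesgue)
  have \<omega>\<omega>: "\<omega> \<bullet> \<omega> = 1" using \<omega> by (simp add: norm_eq_1)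
  have bound: "real m * measure lebesgue (?G \<inter> ball x 1) \<le> measure lebesgue (ball x 2)" if "0 < m" for m
  proof (rule measure_packing[OF S, where v = "\<lambda>k. (real k / real m) *\<^sub>R \<omega>"])
    fix j k :: nat and u w assume jk: "j < k" "k < m" and u: "u \<in> ?G \<inter> ball x 1" and w: "w \<in> ?G \<inter> ball x 1"
    show "(real j / real m) *\<^sub>R \<omega> + u \<noteq> (real k / real m) *\<^sub>R \<omega> + w"
    proof
      assume eq: "(real j / real m) *\<^sub>R \<omega> + u = (real k / real m) *\<^sub>R \<omega> + w"
      define a where "a = real k / real m - real j / real m"
      have uw: "u = w + a *\<^sub>R \<omega>" using eq by (simp add: a_def algebra_simps)
      then have ui: "u \<bullet> \<omega> = w \<bullet> \<omega> + a" by (simp add: inner_add_left \<omega>\<omega>)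
      then have "u - (u \<bullet> \<omega>) *\<^sub>R \<omega> = w - (w \<bullet> \<omega>) *\<^sub>R \<omega>" by (simp add: uw algebra_simps)
      then have "u \<bullet> \<omega> = w \<bullet> \<omega>" using u w by simp
      then have "a = 0" using ui by simp
      then show False using jk that by (simp add: a_def field_simps)
    qed
  next
    fix k u assume k: "k < m" and u: "u \<in> ?G \<inter> ball x 1"
    have "norm (x - ((real k / real m) *\<^sub>R \<omega> + u)) \<le> norm (x - u) + norm ((real k / real m) *\<^sub>R \<omega>)"
      using norm_triangle_ineq4[of "x - u" "(real k / real m) *\<^sub>R \<omega>"] by (simp add: algebra_simps)
    moreover have "norm ((real k / real m) *\<^sub>R \<omega>) < 1" using k \<omega> that by simp
    ultimately show "(real k / real m) *\<^sub>R \<omega> + u \<in> ball x 2" using u by (simp add: dist_norm)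
  qed simp
  have "measure lebesgue (?G \<inter> ball x 1) = 0"
  proof (rule ccontr)
    assume "measure lebesgue (?G \<inter> ball x 1) \<noteq> 0"
    then have pos: "0 < measure lebesgue (?G \<inter> ball x 1)" by (simp add: zero_less_measure_iff)
    obtain m where m: "measure lebesgue (ball x 2) < real m * measure lebesgue (?G \<inter> ball x 1)"
      using ex_less_of_nat_mult[OF pos] by blast
    have "m \<noteq> 0"
    proof
      assume "m = 0"
      with m have "measure lebesgue (ball x 2) < 0" by (simp only: of_nat_0 mult_zero_left)
      then show False using measure_nonneg[of lebesgue "ball x 2"] by linarith
    qed
    then show False using bound[of m] m by linarith
  qed
  then have "negligible (?G \<inter> ball x 1)"
    using S by (simp add: negligible_iff_null_sets null_sets_def fmeasurableD emeasure_eq_measure2)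
  then show "\<exists>U. openin (top_of_set ?G) U \<and> x \<in> U \<and> negligible U"
    using x by (intro exI[of _ "?G \<inter> ball x 1"]) (simp add: openin_open_Int)
qed

text \<open>\<open>M\<close> is separate from \<open>B\<close> because the regularity concerns the
  whole frontier \<open>B\<close>, but is known only near the points of the part \<open>M\<close>
  outside a compact set.\<close>

lemma negligible_Ck_hypersurface:
  assumes "\<And>x. x \<in> M \<Longrightarrow> Ck_hypersurface_near 1 B x" "M \<subseteq> B"
  shows "negligible M"
proof (subst locally_negligible_alt, intro ballI)
  fix x assume x: "x \<in> M"
  obtain U \<omega> g where U: "open U" "x \<in> U" "norm \<omega> = 1" "Ck_on 1 g UNIV"
    "B \<inter> U = {y \<in> U. y \<bullet> \<omega> = g (y - (y \<bullet> \<omega>) *\<^sub>R \<omega>)}"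
    using assms(1)[OF x] unfolding Ck_hypersurface_near_def by blast
  obtain G where "\<And>x. GDERIV g x :> G x" using U(4) by auto
  then have "continuous_on UNIV g"
    by (auto intro!: continuous_at_imp_continuous_on has_derivative_continuous simp: gderiv_def)
  then have "negligible {y. y \<bullet> \<omega> = g (y - (y \<bullet> \<omega>) *\<^sub>R \<omega>)}"
    using U(3) by (rule negligible_continuous_graph)
  then have "negligible (M \<inter> U)" by (rule negligible_subset) (use U(5) assms(2) in blast)
  then show "\<exists>V. openin (top_of_set M) V \<and> x \<in> V \<and> negligible V"
    using U x by (intro exI[of _ "M \<inter> U"]) (simp add: openin_open_Int)
qed

text \<open>The balls of radius \<open>t L\<close> around \<open>x + t (p - x)\<close> grow with \<open>t\<close>; the first one to reach
  the frontier touches it from inside.\<close>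

lemma sliding_ball_contact:
  fixes E :: "'a::euclidean_space set"
  assumes x: "x \<in> E" "x \<notin> frontier E" and L: "0 < L" "dist x p \<le> L / 2"
    and q: "q \<in> frontier E" "dist p q \<le> L"
  shows "\<exists>t z. 0 < t \<and> t \<le> 1 \<and> z \<in> frontier E \<and> ball (x + t *\<^sub>R (p - x)) (t * L) \<subseteq> E \<and>
    dist (x + t *\<^sub>R (p - x)) z = t * L"
proof -
  define c where "c t = x + t *\<^sub>R (p - x)" for t
  \<comment> \<open>Pairs of a time and a frontier point reached by then. Every moving ball lies in
    \<open>ball p L\<close>, so cutting with \<open>cball p L\<close> loses nothing and makes the
    set compact; the first contact time is attained.\<close>
  define S where "S = {w \<in> {0..1} \<times> (frontier E \<inter> cball p L). dist (c (fst w)) (snd w) \<le> fst w * L}"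
  have "compact S"
  proof -
    have "closed {w :: real \<times> 'a. dist (c (fst w)) (snd w) \<le> fst w * L}"
      unfolding c_def by (intro closed_Collect_le continuous_intros)
    moreover have "compact ({0..1::real} \<times> (frontier E \<inter> cball p L))"
      by (intro compact_Times closed_Int_compact) auto
    ultimately have "compact (({0..1} \<times> (frontier E \<inter> cball p L)) \<inter> {w. dist (c (fst w)) (snd w) \<le> fst w * L})"
      by (rule compact_Int_closed[rotated])
    then show ?thesis by (simp add: S_def Int_def)
  qed
  moreover have "(1, q) \<in> S" using q L by (simp add: S_def c_def dist_commute)
  then have "S \<noteq> {}" by blast
  moreover have "continuous_on S fst" by (intro continuous_intros)
  ultimately have "\<exists>w\<in>S. \<forall>v\<in>S. fst w \<le> fst v" by (rule continuous_attains_inf)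
  then obtain w where w: "w \<in> S" "\<And>v. v \<in> S \<Longrightarrow> fst w \<le> fst v" by blast
  define t z where "t = fst w" and "z = snd w"
  have t: "0 \<le> t" "t \<le> 1" "z \<in> frontier E" "dist (c t) z \<le> t * L"
    using w(1) by (auto simp: S_def t_def z_def)
  have "t \<noteq> 0" using t x by (auto simp: c_def)
  then have t0: "0 < t" using t by simp
  have ct: "dist (c a) (c b) = \<bar>a - b\<bar> * dist x p" for a b
    by (simp add: c_def dist_norm norm_minus_commute flip: scaleR_diff_left norm_scaleR)
  have disj: "ball (c t) (t * L) \<inter> frontier E = {}"
  proof (rule ccontr)
    assume "ball (c t) (t * L) \<inter> frontier E \<noteq> {}"
    then obtain y where y: "y \<in> frontier E" "dist (c t) y < t * L" by auto
    \<comment> \<open>If \<open>y\<close> lay strictly inside, it would have been reached earlier: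
      going back by \<open>a\<close>, the centre moves by at most \<open>a * L\<close> and the
      radius shrinks by \<open>a * L\<close>, which together do not exceed the slack
      \<open>h\<close>.\<close>
    define h where "h = t * L - dist (c t) y"
    define a where "a = min t (h / (2 * L))"
    have a: "0 < a" "a \<le> t" "a * (2 * L) \<le> h" using y t0 L by (auto simp: a_def h_def min_def field_simps)
    have "dist (c (t - a)) (c t) = a * dist x p" unfolding ct using a by simp
    also have "\<dots> \<le> a * L" using a L by (intro mult_left_mono) auto
    finally have "dist (c (t - a)) y \<le> (t - a) * L"
      using dist_triangle[of "c (t - a)" y "c t"] a by (simp add: h_def algebra_simps)
    moreover have "dist p y \<le> L"
    proof -
      have "dist p (c t) = (1 - t) * dist x p"
        using ct[of 1 t] t by (simp add: c_def)
      also have "\<dots> \<le> (1 - t) * L" using t L by (intro mult_left_mono) auto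
      finally show ?thesis using y dist_triangle[of p y "c t"] by (simp add: algebra_simps)
    qed
    ultimately have "(t - a, y) \<in> S" using a t y by (simp add: S_def)
    then show False using w(2)[of "(t - a, y)"] a by (simp add: t_def)
  qed
  have "x \<in> ball (c t) (t * L)"
  proof -
    have "dist (c t) x = t * dist x p" using ct[of t 0] t by (simp add: c_def)
    also have "\<dots> \<le> t * (L / 2)" using t L by (intro mult_left_mono) auto
    also have "\<dots> < t * L" using t0 L by simp
    finally show ?thesis by simp
  qed
  then have "ball (c t) (t * L) \<subseteq> E"
    using connected_disjoint_frontier[OF connected_ball disj] x by blast
  moreover have "dist (c t) z = t * L" using disj t by force
  ultimately show ?thesis using t t0 unfolding c_def by blast
qed

section \<open>The frontier is flat\<close>

lemma measure_Int_ball_mono: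
  fixes A :: "'a::euclidean_space set"
  assumes "A \<in> sets lebesgue" "r + dist x y \<le> t"
  shows "measure lebesgue (A \<inter> ball x r) \<le> measure lebesgue (A \<inter> ball y t)"
proof (rule measure_mono_fmeasurable)
  show "A \<inter> ball x r \<subseteq> A \<inter> ball y t"
  proof
    fix w assume "w \<in> A \<inter> ball x r"
    then show "w \<in> A \<inter> ball y t" using dist_triangle[of y w x] assms(2) by (simp add: dist_commute)
  qed
qed (use assms in \<open>auto intro!: sets.Int\<close>)

text \<open>A frontier point \<open>q\<close> of positive depth is ruled out by a ball sliding inside \<open>E\<close> from a
  point \<open>x\<close> far below \<open>q\<close>, around which the complement of \<open>E\<close> has small density, towards a
  ball that contains \<open>q\<close>. It touches the frontier at some \<open>z\<close>. If it does so early (\<open>t \<le> 1 / 2\<close>),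
  flatness around \<open>z\<close> is inherited from \<open>x\<close>; if late, then \<open>z\<close> is close to \<open>q\<close>
  and flatness comes from infinity.\<close>

lemma frontier_depth_zero:
  fixes E :: "'a::euclidean_space set"
  assumes s: "0 < s" "s < 1" and dim: "2 \<le> DIM('a)" and E: "E \<in> sets lebesgue" and e: "norm e = 1"
    and EH: "E \<subseteq> {y. y \<bullet> e \<le> b}"
    and inside: "\<And>z. z \<in> frontier E \<Longrightarrow> supersolution_at s E z"
    and outside: "\<And>z. z \<in> frontier E \<Longrightarrow> supersolution_at s (- E) z"
    and sup: "\<And>\<epsilon>. 0 < \<epsilon> \<Longrightarrow> \<exists>p\<in>frontier E. b - \<epsilon> \<le> p \<bullet> e"
    and thick: "0 < \<kappa>" "bounded K" "negligible N"
      "\<And>y \<rho>. y \<in> frontier E \<Longrightarrow> y \<notin> K \<Longrightarrow> y \<notin> N \<Longrightarrow> 0 < \<rho> \<Longrightarrow> \<kappa> * \<rho> ^ DIM('a) \<le> measure lebesgue (ball y \<rho> - E)"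
    and q: "q \<in> frontier E"
  shows "q \<bullet> e = b"
proof (rule ccontr)
  assume "q \<bullet> e \<noteq> b"
  then have qb: "q \<bullet> e < b" using frontier_halfspace_le[OF EH q] by simp
  define d where "d = b - q \<bullet> e"
  have d: "0 < d" using qb by (simp add: d_def)
  let ?n = "DIM('a)" and ?\<mu> = "measure lebesgue" and ?A = "{y. y \<bullet> e < b} - E"
  let ?V = "unit_ball_vol (real DIM('a))"
  have V: "0 < ?V" by simp
  have A: "?A \<in> sets lebesgue" using E by (intro sets.Diff sets_halfspaces)
  have ee: "e \<bullet> e = 1" using e by (simp add: norm_eq_1)
  obtain C \<theta> where C: "1 \<le> C" and \<theta>: "0 < \<theta>" and nc: "\<And>(E::'a set) e b z c r R. E \<in> sets lebesgue \<Longrightarrow> norm e = 1 \<Longrightarrow>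
    supersolution_at s E z \<Longrightarrow> ball c r \<subseteq> E \<Longrightarrow> dist c z = r \<Longrightarrow> z \<bullet> e < b \<Longrightarrow>
    0 < R \<Longrightarrow> C * R \<le> r \<Longrightarrow> C * R\<^sup>2 \<le> (b - z \<bullet> e) * r \<Longrightarrow>
    \<not> (\<forall>\<rho>\<ge>R. measure lebesgue (({y. y \<bullet> e < b} - E) \<inter> ball z \<rho>)
         \<le> \<theta> * min ((b - z \<bullet> e) / R) 1 * \<rho> ^ DIM('a))"
    using no_interior_contact[OF s dim] by blast

  \<comment> \<open>The density threshold at \<open>x\<close>: below \<kappa> it excludes the
    frontier, below the volume of the unit ball it excludes the exterior, and the third bound
    carries it over to an early contact point at distance up to \<open>3 * C * R\<close>.\<close>
  define c0 where "c0 = min (min (\<kappa> / 2) (?V / 2)) (\<theta> / (1 + 3 * C) ^ ?n)"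
  have c0: "0 < c0" "c0 < \<kappa>" "c0 < ?V" "c0 * (1 + 3 * C) ^ ?n \<le> \<theta>"
  proof -
    have p: "0 < (1 + 3 * C) ^ ?n" using C by simp
    show "0 < c0" using thick(1) V \<theta> p by (simp add: c0_def)
    show "c0 < \<kappa>" "c0 < ?V" using thick(1) V by (simp_all add: c0_def min_less_iff_disj)
    have "c0 \<le> \<theta> / (1 + 3 * C) ^ ?n" by (simp add: c0_def)
    then show "c0 * (1 + 3 * C) ^ ?n \<le> \<theta>" using p by (simp add: pos_le_divide_eq)
  qed
  \<comment> \<open>The first bound serves the covering argument and the density at scales beyond
    \<open>L\<close>; the second serves a late contact point, at distance up to
    \<open>6 * C * R\<close> from \<open>q\<close>.\<close>
  define \<eta> where "\<eta> = min (c0 / (2 * 30 ^ ?n)) (\<theta> * min (d / 2) 1 / (1 + 6 * C) ^ ?n)"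
  have \<eta>: "0 < \<eta>" "\<eta> * (2 * 30 ^ ?n) \<le> c0" "\<eta> * (1 + 6 * C) ^ ?n \<le> \<theta> * min (d / 2) 1"
  proof -
    have p: "0 < (1 + 6 * C) ^ ?n" using C by simp
    show "0 < \<eta>" using c0 d \<theta> p by (simp add: \<eta>_def)
    have "\<eta> \<le> c0 / (2 * 30 ^ ?n)" by (simp add: \<eta>_def)
    then show "\<eta> * (2 * 30 ^ ?n) \<le> c0" by (simp add: pos_le_divide_eq)
    have "\<eta> \<le> \<theta> * min (d / 2) 1 / (1 + 6 * C) ^ ?n" unfolding \<eta>_def by (rule min.cobounded2)
    then show "\<eta> * (1 + 6 * C) ^ ?n \<le> \<theta> * min (d / 2) 1" using p by (simp only: pos_le_divide_eq)
  qed
  obtain R0 where R0: "0 < R0" "\<And>r. R0 \<le> r \<Longrightarrow> ?\<mu> (?A \<inter> ball q r) \<le> \<eta> * r ^ (?n - 1)"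
    using flat_at_infinity[OF s E e EH outside sup \<eta>(1)] by blast
  obtain k where k: "0 < k" "\<And>y. y \<in> K \<Longrightarrow> norm y \<le> k" using thick(2) unfolding bounded_pos by blast
  define Q where "Q = \<bar>q \<bullet> e\<bar>"
  have Q: "0 \<le> Q" "q \<bullet> e \<le> Q" by (simp_all add: Q_def)
  define M where "M = max 1 R0"
  \<comment> \<open>\<open>L\<close> is the sum of all lower bounds that will be needed.
    \<open>W\<close> ensures that the late contact scale \<open>R\<close> is at least
    \<open>M\<close>, so that flatness at infinity applies to it.\<close>
  define W where "W = 36 * C\<^sup>2 * M\<^sup>2 / d"
  define L where "L = 1 + R0 + d + W + 2 * (Q + d + k)"
  have M: "1 \<le> M" "R0 \<le> M" by (simp_all add: M_def)
  have "0 \<le> W" using d by (simp add: W_def)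
  then have L: "1 \<le> L" "R0 \<le> L" "d \<le> L" "W \<le> L" "2 * (Q + d + k) < L"
    using d R0(1) Q(1) k(1) by (simp_all add: L_def)
  have L0: "0 < L" using L by simp
  \<comment> \<open>The final ball \<open>ball p L\<close> has its top at depth \<open>d / 2\<close>
    and contains \<open>q\<close> at depth \<open>d\<close>, so contact is forced while all contact
    points keep depth at least \<open>d / 2\<close>.\<close>
  define p where "p = q - (L - d / 2) *\<^sub>R e"
  have "p \<bullet> e = q \<bullet> e - (L - d / 2)" by (simp add: p_def inner_diff_left ee)
  then have pe: "p \<bullet> e = b - L - d / 2" unfolding d_def by argo
  have pq: "dist p q = L - d / 2" using e L d by (simp add: p_def dist_norm)
  have flat: "?\<mu> (?A \<inter> ball y r) \<le> \<eta> * t ^ (?n - 1)" if "r + dist y q \<le> t" "R0 \<le> t" for y r t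
    using measure_Int_ball_mono[OF A that(1)] R0(2)[OF that(2)] by linarith

  have "\<exists>x\<in>ball p (L / 2) - N. \<forall>\<rho>. 0 < \<rho> \<longrightarrow> \<rho> \<le> L \<longrightarrow> ?\<mu> (?A \<inter> ball x \<rho>) \<le> c0 * \<rho> ^ ?n"
  proof (rule exists_point_low_density[OF A _ _ L0 c0(1)])
    have N: "N \<in> null_sets lebesgue" using thick(3) by (simp add: negligible_iff_null_sets)
    show "ball p (L / 2) - N \<in> fmeasurable lebesgue" using N by (intro fmeasurable_Diff) auto
    have "?\<mu> (?A \<inter> ball p (2 * L)) \<le> \<eta> * (3 * L) ^ (?n - 1)"
      using pq L d by (intro flat) auto
    also have "\<dots> \<le> \<eta> * (3 * L) ^ ?n"
      using \<eta> L by (intro mult_left_mono power_increasing) auto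
    finally have "5 ^ ?n * ?V / c0 * ?\<mu> (?A \<inter> ball p (2 * L)) \<le> 5 ^ ?n * ?V / c0 * (\<eta> * (3 * L) ^ ?n)"
      using c0 V by (intro mult_left_mono) auto
    also have "\<dots> = ?V * (L / 2) ^ ?n * (\<eta> * 30 ^ ?n / c0)"
    proof -
      have "(30::real) ^ ?n = 5 ^ ?n * 3 ^ ?n * 2 ^ ?n" by (simp flip: power_mult_distrib)
      then show ?thesis by (simp add: power_mult_distrib power_divide)
    qed
    also have "\<dots> < ?V * (L / 2) ^ ?n * 1"
    proof (intro mult_strict_left_mono)
      show "\<eta> * 30 ^ ?n / c0 < 1" using \<eta>(2) c0(1) by (simp add: divide_less_eq)
    qed (use L0 in simp)
    finally show "5 ^ ?n * ?V / c0 * ?\<mu> (?A \<inter> ball p (2 * L)) < ?\<mu> (ball p (L / 2) - N)"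
      using measure_Diff_null_set[OF _ N, of "ball p (L / 2)"] measure_lebesgue_ball[of "L / 2" p] L0 by simp
  qed auto
  then obtain x where x: "dist p x < L / 2" "x \<notin> N"
    and xsmall: "\<And>\<rho>. 0 < \<rho> \<Longrightarrow> \<rho> \<le> L \<Longrightarrow> ?\<mu> (?A \<inter> ball x \<rho>) \<le> c0 * \<rho> ^ ?n" by auto
  \<comment> \<open>The covering argument reaches radii up to \<open>L\<close>; beyond, flatness
    around \<open>q\<close> takes over.\<close>
  have xgood: "?\<mu> (?A \<inter> ball x \<rho>) \<le> c0 * \<rho> ^ ?n" if "0 < \<rho>" for \<rho>
  proof (cases "\<rho> \<le> L")
    case False
    have "dist x q < 3 * L / 2" using x(1) pq d dist_triangle[of x q p] by (simp add: dist_commute)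
    then have "?\<mu> (?A \<inter> ball x \<rho>) \<le> \<eta> * (3 * \<rho>) ^ (?n - 1)"
      using False L by (intro flat) auto
    also have "\<dots> \<le> \<eta> * (3 * \<rho>) ^ ?n"
      using \<eta> L False by (intro mult_left_mono power_increasing) auto
    also have "\<dots> = \<eta> * 3 ^ ?n * \<rho> ^ ?n" by (simp add: power_mult_distrib)
    also have "\<dots> \<le> c0 * \<rho> ^ ?n"
    proof (intro mult_right_mono)
      have "\<eta> * 3 ^ ?n \<le> \<eta> * 30 ^ ?n" using \<eta>(1) by (intro mult_left_mono power_mono) auto
      moreover have "0 < \<eta> * 30 ^ ?n" using \<eta>(1) by simp
      ultimately show "\<eta> * 3 ^ ?n \<le> c0" using \<eta>(2) by linarith
    qed (use that in simp)
    finally show ?thesis .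
  qed (use xsmall that in auto)
  have proj: "\<bar>(u - v) \<bullet> e\<bar> \<le> dist u v" for u v
    using Cauchy_Schwarz_ineq2[of "u - v" e] e by (simp add: dist_norm)
  have xe: "x \<bullet> e \<le> p \<bullet> e + L / 2" using proj[of x p] x(1) by (simp add: inner_diff_left dist_commute)
  have xH: "ball x (L / 2) \<subseteq> {y. y \<bullet> e < b}"
  proof
    fix y assume "y \<in> ball x (L / 2)"
    then show "y \<in> {y. y \<bullet> e < b}" using proj[of y x] xe pe d by (simp add: inner_diff_left dist_commute)
  qed
  have small_ball: "?\<mu> (ball x \<rho> - E) \<le> c0 * \<rho> ^ ?n" if "0 < \<rho>" "\<rho> \<le> L / 2" for \<rho>
  proof -
    have "ball x \<rho> - E = ?A \<inter> ball x \<rho>" using xH that by force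
    then show ?thesis using xgood[OF that(1)] by simp
  qed
  \<comment> \<open>Because \<open>L > 2 * (Q + d + k)\<close>, the point \<open>x\<close> lies
    below height \<open>- k\<close>, hence below \<open>K\<close>.\<close>
  have xK: "x \<notin> K"
  proof
    assume "x \<in> K"
    then have "norm x \<le> k" using k by blast
    then have "- k \<le> x \<bullet> e" using Cauchy_Schwarz_ineq2[of x e] e by simp
    moreover have "p \<bullet> e \<le> Q + d - L" using pe d Q(2) unfolding d_def by argo
    ultimately show False using xe L(5) d by argo
  qed
  have xF: "x \<notin> frontier E"
  proof
    assume "x \<in> frontier E"
    then have "\<kappa> * (L / 2) ^ ?n \<le> ?\<mu> (ball x (L / 2) - E)" using thick(4) xK x(2) L0 by simp
    also have "\<dots> \<le> c0 * (L / 2) ^ ?n" using L0 by (intro small_ball) simp_all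
    finally show False using c0(2) L0 by (simp add: mult_le_cancel_right)
  qed
  have xE: "x \<in> E"
  proof (rule ccontr)
    assume "x \<notin> E"
    then have "x \<in> interior (- E)" using xF by (auto simp: frontier_def interior_closure closure_def)
    then obtain a where a: "0 < a" "ball x a \<subseteq> - E" by (meson mem_interior)
    define r where "r = min a (L / 2)"
    have r: "0 < r" "r \<le> L / 2" "r \<le> a" using a L0 by (auto simp: r_def)
    have "ball x r - E = ball x r" using a(2) subset_ball[OF r(3), of x] by blast
    then have "?V * r ^ ?n \<le> c0 * r ^ ?n"
      using small_ball[OF r(1,2)] measure_lebesgue_ball[of r x] r by simp
    then show False using c0(3) r by (simp add: mult_le_cancel_right)
  qed

  obtain t z where t: "0 < t" "t \<le> 1" and z: "z \<in> frontier E"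
    and ball: "ball (x + t *\<^sub>R (p - x)) (t * L) \<subseteq> E" "dist (x + t *\<^sub>R (p - x)) z = t * L"
    using sliding_ball_contact[OF xE xF L0 _ q, of p] x(1) pq d by (auto simp: dist_commute)
  define r where "r = t * L"
  define c where "c = x + t *\<^sub>R (p - x)"
  note ball = ball[folded r_def, folded c_def]
  have r0: "0 < r" using t L0 by (simp add: r_def)
  define D where "D = b - z \<bullet> e"
  \<comment> \<open>The highest point of the ball at time \<open>t\<close> bounds the height of
    \<open>z\<close>; the smaller \<open>t\<close>, the deeper the contact.\<close>
  have D: "d / 2 + (1 - t) * (L / 2) \<le> D"
  proof -
    have "c \<bullet> e = p \<bullet> e + (1 - t) * (x \<bullet> e - p \<bullet> e)"
      by (simp add: c_def inner_add_left inner_diff_left algebra_simps)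
    also have "\<dots> \<le> p \<bullet> e + (1 - t) * (L / 2)" using t xe by (intro add_left_mono mult_left_mono) auto
    finally have "z \<bullet> e \<le> p \<bullet> e + (1 - t) * (L / 2) + r"
      using proj[of z c] ball(2) by (simp add: inner_diff_left dist_commute)
    moreover have "r = L - (1 - t) * L" by (simp add: r_def algebra_simps)
    moreover have "(1 - t) * (L / 2) = (1 - t) * L / 2" by simp
    ultimately show ?thesis using pe unfolding D_def by linarith
  qed
  have "0 \<le> (1 - t) * (L / 2)" using t L0 by simp
  then have D0: "d / 2 \<le> D" "0 < D" using D d by linarith+
  then have zb: "z \<bullet> e < b" by (simp add: D_def)
  have no: "\<not> (\<forall>\<rho>\<ge>R. ?\<mu> (?A \<inter> ball z \<rho>) \<le> \<theta> * min (D / R) 1 * \<rho> ^ ?n)"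
    if "0 < R" "C * R \<le> r" "C * R\<^sup>2 \<le> D * r" for R
    using nc[OF E e inside[OF z] ball zb that(1)] that unfolding D_def by blast
  show False
  proof (cases "t \<le> 1 / 2")
    case True
    \<comment> \<open>An early contact is deep compared with \<open>R\<close>, so the minimum is 1
      and small density suffices; it is inherited from \<open>x\<close>, whose distance from
      \<open>z\<close> is at most a multiple of \<open>R\<close>.\<close>
    define R where "R = r / (2 * C)"
    have R: "0 < R" "2 * C * R = r" using C r0 by (simp_all add: R_def)
    have "(1 / 2) * (L / 2) \<le> (1 - t) * (L / 2)" using True L0 by (intro mult_right_mono) auto
    then have DL: "L / 4 \<le> D" using D d by simp
    have rL: "r \<le> L / 2" using mult_right_mono[OF True, of L] L0 by (simp add: r_def)
    have RD: "R \<le> D"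
    proof -
      have "1 * R \<le> C * R" using C R by (intro mult_right_mono) auto
      then show ?thesis using R rL DL by linarith
    qed
    have "C * R\<^sup>2 = r / 2 * R" using R(2) by (simp add: power2_eq_square)
    also have "\<dots> \<le> r * D" using RD R r0 by (intro mult_mono) auto
    finally have CR2: "C * R\<^sup>2 \<le> D * r" by (simp add: mult.commute)
    have "?\<mu> (?A \<inter> ball z \<rho>) \<le> \<theta> * min (D / R) 1 * \<rho> ^ ?n" if \<rho>: "R \<le> \<rho>" for \<rho>
    proof -
      have "dist c x = t * dist p x" using t by (simp add: c_def dist_norm)
      also have "\<dots> \<le> t * (L / 2)" using t x by (intro mult_left_mono) auto
      finally have "dist z x \<le> 3 / 2 * r"
        using dist_triangle[of z x c] ball(2) by (simp add: r_def dist_commute)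
      also have "\<dots> = 3 * C * R" using R(2) by simp
      also have "\<dots> \<le> 3 * C * \<rho>" using \<rho> C by (intro mult_left_mono) auto
      finally have "?\<mu> (?A \<inter> ball z \<rho>) \<le> ?\<mu> (?A \<inter> ball x ((1 + 3 * C) * \<rho>))"
        by (intro measure_Int_ball_mono[OF A]) (simp add: algebra_simps)
      also have "\<dots> \<le> c0 * ((1 + 3 * C) * \<rho>) ^ ?n" using C R \<rho> by (intro xgood mult_pos_pos) auto
      also have "\<dots> = c0 * (1 + 3 * C) ^ ?n * \<rho> ^ ?n" by (simp add: power_mult_distrib)
      also have "\<dots> \<le> \<theta> * \<rho> ^ ?n" using c0(4) R \<rho> by (intro mult_right_mono) auto
      also have "\<theta> * \<rho> ^ ?n = \<theta> * min (D / R) 1 * \<rho> ^ ?n" using RD R by (simp add: min_absorb2)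
      finally show ?thesis .
    qed
    then show False using no[OF R(1) _ CR2] R r0 by auto
  next
    case False
    have rL: "L / 2 \<le> r" using mult_right_mono[of "1 / 2" t L] False L0 by (simp add: r_def)
    have zp: "dist z p \<le> L"
    proof -
      have "c - p = (1 - t) *\<^sub>R (x - p)" by (simp add: c_def algebra_simps)
      then have "dist c p = (1 - t) * dist x p" using t by (simp add: dist_norm)
      also have "\<dots> \<le> (1 - t) * L" using x(1) t L0 by (intro mult_left_mono) (auto simp: dist_commute)
      finally show ?thesis using dist_triangle[of z p c] ball(2)
        by (simp add: r_def dist_commute algebra_simps)
    qed
    have we: "(z - p) \<bullet> e = L + d / 2 - D" by (simp add: inner_diff_left pe D_def)
    \<comment> \<open>\<open>z\<close> lies in the closed ball of radius \<open>L\<close> around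
      \<open>p\<close> at depth \<open>D\<close>, hence in a cap near its top, and \<open>q\<close>
      is on the vertical axis just below the top. Pythagoras bounds the horizontal distance.\<close>
    have zq: "(dist z q)\<^sup>2 \<le> 2 * L * D"
    proof -
      let ?l = "L - d / 2"
      have "z - q = (z - p) - ?l *\<^sub>R e" by (simp add: p_def)
      then have "z - q = (z - p) + (- ?l) *\<^sub>R e" by (simp only: scaleR_minus_left diff_conv_add_uminus)
      then have "(dist z q)\<^sup>2 = (norm ((z - p) + (- ?l) *\<^sub>R e))\<^sup>2" by (simp only: dist_norm)
      also have "\<dots> = (norm (z - p))\<^sup>2 - ((z - p) \<bullet> e)\<^sup>2 + (((z - p) + (- ?l) *\<^sub>R e) \<bullet> e)\<^sup>2"
        using tangential_shift[OF e, of "z - p" "- ?l"] by linarith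
      also have "((z - p) + (- ?l) *\<^sub>R e) \<bullet> e = d - D" by (simp only: inner_add_left we) (simp add: ee)
      also have "(norm (z - p))\<^sup>2 - ((z - p) \<bullet> e)\<^sup>2 + (d - D)\<^sup>2 \<le> L\<^sup>2 - (L + d / 2 - D)\<^sup>2 + (d - D)\<^sup>2"
        unfolding we using zp by (simp add: dist_norm power_mono)
      also have "\<dots> = 2 * L * D - d * (L - 3 / 4 * d) - d * D"
        by (simp add: power2_eq_square field_simps)
      also have "\<dots> \<le> 2 * L * D"
      proof -
        have "0 \<le> d * (L - 3 / 4 * d)" using d L(3) by (intro mult_nonneg_nonneg) auto
        moreover have "0 \<le> d * D" using d D0 by simp
        ultimately show ?thesis by linarith
      qed
      finally show ?thesis .
    qed
    have D5: "D \<le> 5 * r" using proj[of z p] we zp rL L(3) by linarith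
    \<comment> \<open>Up to a constant this is the largest scale with
      \<open>C * R\<^sup>2 \<le> D * r\<close>, and by the previous bound \<open>z\<close> is within
      \<open>6 * C * R\<close> of \<open>q\<close>.\<close>
    define R where "R = sqrt (D * r) / (3 * C)"
    have sq: "0 < sqrt (D * r)" "(sqrt (D * r))\<^sup>2 = D * r" using D0 r0 by simp_all
    have R: "0 < R" "3 * C * R = sqrt (D * r)" using sq C by (simp_all add: R_def)
    have sqR: "9 * (C\<^sup>2 * R\<^sup>2) = D * r"
    proof -
      have "9 * (C\<^sup>2 * R\<^sup>2) = (3 * C * R)\<^sup>2" by (simp add: power_mult_distrib)
      also have "\<dots> = D * r" by (simp only: R(2) sq(2))
      finally show ?thesis .
    qed
    have "sqrt (D * r) \<le> 3 * r"
    proof (rule power2_le_imp_le)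
      have "D * r \<le> 5 * r * r" using D5 r0 by (intro mult_right_mono) auto
      moreover have "(3 * r)\<^sup>2 = 9 * (r * r)" "5 * r * r = 5 * (r * r)" by (simp_all add: power2_eq_square)
      ultimately show "(sqrt (D * r))\<^sup>2 \<le> (3 * r)\<^sup>2" unfolding sq(2) using zero_le_square[of r] by linarith
    qed (use r0 in simp)
    then have CR: "C * R \<le> r" using R(2) by simp
    have "C * R\<^sup>2 \<le> C\<^sup>2 * R\<^sup>2" using C by (intro mult_right_mono) (auto simp: power2_eq_square)
    moreover have "0 \<le> C\<^sup>2 * R\<^sup>2" by simp
    ultimately have CR2: "C * R\<^sup>2 \<le> D * r" using sqR by linarith
    have RM: "M \<le> R"
    proof -
      have "36 * C\<^sup>2 * M\<^sup>2 \<le> L * d" using L(4) d by (simp add: W_def pos_divide_le_eq)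
      also have "L * d = 4 * ((d / 2) * (L / 2))" by simp
      also have "\<dots> \<le> 4 * (D * r)" using D0 rL d L0 by (intro mult_left_mono mult_mono) auto
      also have "\<dots> = 36 * C\<^sup>2 * R\<^sup>2" using sqR by simp
      finally have "M\<^sup>2 \<le> R\<^sup>2" using C by simp
      then show ?thesis by (rule power2_le_imp_le) (use R in simp)
    qed
    have "?\<mu> (?A \<inter> ball z \<rho>) \<le> \<theta> * min (D / R) 1 * \<rho> ^ ?n" if \<rho>: "R \<le> \<rho>" for \<rho>
    proof -
      have \<rho>0: "0 < \<rho>" "1 \<le> \<rho>" using R RM M \<rho> by linarith+
      have "dist z q \<le> 6 * C * R"
      proof (rule power2_le_imp_le)
        have "2 * L * D \<le> 2 * (2 * r) * D" using rL D0 by (intro mult_right_mono mult_left_mono) auto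
        also have "\<dots> = (6 * C * R)\<^sup>2" using sqR by (simp add: power_mult_distrib)
        finally show "(dist z q)\<^sup>2 \<le> (6 * C * R)\<^sup>2" using zq by linarith
      qed (use C R in simp)
      also have "\<dots> \<le> 6 * C * \<rho>" using \<rho> C by (intro mult_left_mono) auto
      finally have zq': "dist z q \<le> 6 * C * \<rho>" .
      have pow: "\<rho> ^ ?n = \<rho> * \<rho> ^ (?n - 1)" using dim by (simp add: power_eq_if)
      have C\<rho>: "0 \<le> 6 * C * \<rho>" using C \<rho>0 by simp
      have "?\<mu> (?A \<inter> ball z \<rho>) \<le> \<eta> * ((1 + 6 * C) * \<rho>) ^ (?n - 1)"
        using zq' C\<rho> \<rho> RM M by (intro flat) (auto simp: distrib_right)
      also have "\<dots> = \<eta> * (1 + 6 * C) ^ (?n - 1) * \<rho> ^ (?n - 1)" by (simp add: power_mult_distrib)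
      also have "\<dots> \<le> \<eta> * (1 + 6 * C) ^ ?n * \<rho> ^ (?n - 1)"
        using \<eta> C \<rho>0 by (intro mult_right_mono mult_left_mono power_increasing) auto
      also have "\<dots> \<le> \<theta> * min (d / 2) 1 * \<rho> ^ (?n - 1)"
        using \<eta>(3) \<rho>0 by (intro mult_right_mono) auto
      \<comment> \<open>At scales \<open>\<rho> \<ge> R\<close> the product
        \<open>min (D / R) 1 * \<rho>\<close> is at least \<open>min D R\<close>. The gain of a full
        power of \<rho> in flatness at infinity thus compensates a small ratio
        \<open>D / R\<close>.\<close>
      also have "\<dots> \<le> \<theta> * (min (D / R) 1 * \<rho>) * \<rho> ^ (?n - 1)"
      proof (intro mult_right_mono mult_left_mono)
        have "min (D / R) 1 * R = min D R" using R by (simp add: min_mult_distrib_right)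
        moreover have "min (D / R) 1 * R \<le> min (D / R) 1 * \<rho>" using \<rho> D0 R by (intro mult_left_mono) auto
        ultimately show "min (d / 2) 1 \<le> min (D / R) 1 * \<rho>" using D0 RM M by linarith
      qed (use \<theta> \<rho>0 in auto)
      also have "\<dots> = \<theta> * min (D / R) 1 * \<rho> ^ ?n" by (simp only: pow mult.assoc)
      finally show ?thesis .
    qed
    then show False using no[OF R(1) CR CR2] by blast
  qed
qed

text \<open>Non-nullity excludes the empty set, which lies in every half-space and whose frontier is
  empty, so that all frontier conditions hold vacuously.\<close>

theorem theorem4p1:
  fixes n :: nat and s :: real and E :: "'a::euclidean_space set"
  assumes "n \<ge> 1" and "DIM('a) = n + 1"
    and "0 < s" and "s < 1"
    and "normalized E"
    and "E \<notin> null_sets lebesgue"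
    and "\<exists>H. halfspace H \<and> ae_subset E H"
    and "visc_zero s E"
    and "thick_complement E \<or> C1_boundary_outside_compact E"
  shows "\<exists>H. halfspace H \<and> ae_equal E H"
proof -
  have E: "E \<in> sets lebesgue" and Eext: "E \<inter> mt_exterior E = {}"
    using assms(5) by (auto simp: normalized_def)
  obtain e a where e: "norm e = 1" and ae: "ae_subset E {x. x \<bullet> e < a}"
    using assms(7) unfolding halfspace_def by blast
  have "e \<noteq> 0" using e by auto
  have ee: "e \<bullet> e = 1" using e by (simp add: norm_eq_1)
  \<comment> \<open>Normalization turns the inclusion modulo null sets into a pointwise one, at the
    price of the closed half-space: a point strictly above the plane would lie in the measure
    theoretic exterior.\<close>
  have Ea: "E \<subseteq> {x. x \<bullet> e \<le> a}"
  proof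
    fix y assume y: "y \<in> E"
    show "y \<in> {x. x \<bullet> e \<le> a}"
    proof (rule ccontr)
      assume "y \<notin> {x. x \<bullet> e \<le> a}"
      then have "y \<in> {x. a < x \<bullet> e}" by simp
      moreover have "open {x. a < x \<bullet> e}" by (intro open_Collect_less continuous_intros)
      ultimately obtain r where r: "0 < r" "ball y r \<subseteq> {x. a < x \<bullet> e}" by (metis openE)
      have "E \<inter> ball y r \<in> null_sets lebesgue"
        by (rule null_sets_subset[of "E - {x. x \<bullet> e < a}"])
          (use ae E r in \<open>auto simp: ae_subset_def intro!: sets.Int\<close>)
      then have "y \<in> mt_exterior E" using mt_exterior_iff[OF E] r by blast
      then show False using y Eext by blast
    qed
  qed
  have high: "\<exists>y. h < y \<bullet> e" for h :: real
    by (rule exI[of _ "(h + 1) *\<^sub>R e"]) (simp add: ee)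
  have "frontier E \<noteq> {}"
  proof
    assume "frontier E = {}"
    then have "E = UNIV \<or> E = {}" using connected_disjoint_frontier[of UNIV E] by auto
    then show False using high[of a] Ea assms(6) by (auto simp: not_le[symmetric])
  qed
  define b where "b = (SUP y\<in>frontier E. y \<bullet> e)"
  have bdd: "bdd_above ((\<lambda>y. y \<bullet> e) ` frontier E)"
    using frontier_halfspace_le[OF Ea] by (intro bdd_aboveI2[where M = a])
  have fb: "y \<bullet> e \<le> b" if "y \<in> frontier E" for y
    unfolding b_def using that bdd by (intro cSUP_upper)
  have sup: "\<exists>p\<in>frontier E. b - \<epsilon> \<le> p \<bullet> e" if "0 < \<epsilon>" for \<epsilon>
  proof (rule ccontr)
    assume "\<not> ?thesis"
    then have "b \<le> b - \<epsilon>" unfolding b_def[symmetric]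
      using \<open>frontier E \<noteq> {}\<close> by (subst (1) b_def, intro cSUP_least) force+
    then show False using that by simp
  qed
  \<comment> \<open>\<open>b\<close> is a supremum over the frontier, not over \<open>E\<close>. The
    region above \<open>b\<close> is connected, avoids the frontier and contains points outside
    \<open>E\<close>, so it misses \<open>E\<close> entirely.\<close>
  have EH: "E \<subseteq> {y. y \<bullet> e \<le> b}"
  proof -
    have "{y. b < y \<bullet> e} = {y. e \<bullet> y > b}" by (auto simp: inner_commute)
    then have "connected {y. b < y \<bullet> e}" by (simp only: convex_connected convex_halfspace_gt)
    moreover have "{y. b < y \<bullet> e} \<inter> frontier E = {}" using fb by force
    moreover obtain y where "max a b < y \<bullet> e" using high by blast
    then have "y \<in> {y. b < y \<bullet> e}" "y \<notin> E" using Ea by auto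
    ultimately have "{y. b < y \<bullet> e} \<inter> E = {}" using connected_disjoint_frontier by blast
    then show ?thesis by force
  qed
  have inside: "supersolution_at s E z" and outside: "supersolution_at s (- E) z" if "z \<in> frontier E" for z
    using assms(8) that unfolding visc_zero_def
    by (blast intro: visc_nonneg_supersolution visc_nonpos_supersolution)+
  have "2 \<le> DIM('a)" using assms(1,2) by simp
  note depth = frontier_depth_zero[OF assms(3,4) this E e EH inside outside sup]
  have level: "q \<bullet> e = b" if q: "q \<in> frontier E" for q
    using assms(9)
  proof
    assume "thick_complement E"
    then obtain c where "0 < c" "\<forall>q\<in>frontier E. \<forall>\<rho>>0. c * \<rho> ^ DIM('a) \<le> measure lebesgue (ball q \<rho> - E)"
      by (auto simp: thick_complement_def)
    then show ?thesis using q by (intro depth[of c "{}" "{}"]) auto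
  next
    assume "C1_boundary_outside_compact E"
    then obtain K where K: "compact K" "\<forall>x\<in>frontier E - K. Ck_hypersurface_near 1 (frontier E) x"
      by (auto simp: C1_boundary_outside_compact_def)
    have "negligible (frontier E - K)" using K(2) by (intro negligible_Ck_hypersurface) auto
    \<comment> \<open>With this \<open>N\<close> no frontier point is left outside \<open>K\<close>
      and \<open>N\<close>: the density requirement is vacuous, and the value 1 for \<kappa> is
      arbitrary.\<close>
    then show ?thesis using q compact_imp_bounded[OF K(1)] by (intro depth[of 1 K "frontier E - K"]) auto
  qed
  define H where "H = {y. y \<bullet> e < b}"
  have null: "{y. y \<bullet> e = b} \<in> null_sets lebesgue" using null_sets_hyperplane(1)[OF \<open>e \<noteq> 0\<close>] .
  have H: "H \<in> sets lebesgue" by (simp add: H_def)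
  have "H = {y. e \<bullet> y < b}" by (auto simp: H_def inner_commute)
  then have "connected H" by (simp add: convex_connected convex_halfspace_lt)
  moreover have "H \<inter> frontier E = {}" using level by (force simp: H_def)
  moreover have "H \<inter> E \<noteq> {}"
  proof
    assume "H \<inter> E = {}"
    then have "E \<subseteq> {y. y \<bullet> e = b}" using EH by (force simp: H_def)
    then show False using null_sets_subset[OF null E] assms(6) by blast
  qed
  ultimately have "H \<subseteq> E" using connected_disjoint_frontier by blast
  then have "(E - H) \<union> (H - E) \<subseteq> {y. y \<bullet> e = b}" using EH by (force simp: H_def)
  then have "ae_equal E H"
    unfolding ae_equal_def using E H by (intro null_sets_subset[OF null]) (auto intro: sets.Diff)
  moreover have "halfspace H" unfolding halfspace_def H_def using e by blast
  ultimately show ?thesis by blast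
qed

end
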